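(* Let $I \subset R = k[x_0,\ldots,x_n]$ be a homogeneous perfect ideal of codimension two with graded minimal free resolution $0 \to F \xrightarrow{\varphi} G \to I \to 0$. Let $m$ be a positive integer and assume that $I$ is a local complete intersection and that $\min\{\mathrm{rk}\, G - 1,\ m\} \leq n$. Then the canonical surjection $\mathrm{Sym}^m I \to I^m$ is an isomorphism, and the complex \[0 \to \textstyle\bigwedge^m F \to \bigwedge^{m-1} F \otimes \mathrm{Sym}^1 G \to \cdots \to F \otimes \mathrm{Sym}^{m-1} G \to \mathrm{Sym}^m G \to I^m \to 0\] (with maps as described in the context) is a graded minimal free resolution of $I^m$.
   Context: $R = k[x_0,\ldots,x_n]$ with $k$ an algebraically closed field of characteristic zero, $\mathfrak{m} = (x_0,\ldots,x_n)$. A homogeneous ideal $I$ is perfect (Cohen–Macaulay) if $\operatorname{depth}(R/I) = \dim(R/I)$. $I$ is a local complete intersection if for every prime $\mathfrak{p} \neq \mathfrak{m}$ with $I \subseteq \mathfrak{p}$, $I_{\mathfrak{p}}$ is a complete intersection of codimension equal to the height of $I$. The complex: let $G$ have homogeneous basis $e_1,\dots,e_r$ with $e_i \mapsto f_i$ (minimal generators of $I$), identify $\mathrm{Sym}\,G = R[t_1,\ldots,t_r]$ with $t_i = e_i$, and let $F$ have basis $u_1,\dots,u_s$ with $\varphi(u_j) = c_j := \sum_i \varphi_{ij} t_i \in \mathrm{Sym}^1 G$. The differential $\bigwedge^i F \otimes \mathrm{Sym}^{m-i} G \to \bigwedge^{i-1} F \otimes \mathrm{Sym}^{m-i+1} G$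 sends $(u_{j_1} \wedge \cdots \wedge u_{j_i}) \otimes g$ to $\sum_{l=1}^i (-1)^{l+1} (u_{j_1} \wedge \cdots \widehat{u_{j_l}} \cdots \wedge u_{j_i}) \otimes c_{j_l} g$ (the degree-$m$ strand in the $t$-variables of the Koszul complex on $c_1,\ldots,c_s$ over $\mathrm{Sym}\,G$), and $\mathrm{Sym}^m G \to I^m$ sends $t_1^{a_1}\cdots t_r^{a_r}$ to $f_1^{a_1}\cdots f_r^{a_r}$. All modules carry the induced gradings. *)

theory Defs
  imports Main "HOL-Library.Poly_Mapping" "HOL-Library.Extended_Nat"
    "HOL-Computational_Algebra.Polynomial"
begin

text \<open>The polynomial ring k[x_v : v in 'v] over k, with 'v a finite type of
  n+1 variables.  Elements are finitely supported maps from monomials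
  (exponent vectors 'v =>0 nat) to coefficients.\<close>
type_synonym ('v, 'k) mpoly = "('v \<Rightarrow>\<^sub>0 nat) \<Rightarrow>\<^sub>0 'k"

definition alg_closed_field :: "'k::field itself \<Rightarrow> bool" where
  "alg_closed_field _ \<longleftrightarrow> (\<forall>p :: 'k poly. degree p > 0 \<longrightarrow> (\<exists>x. poly p x = 0))"

text \<open>Homogeneous of degree e (the zero polynomial is homogeneous of every degree).\<close>
definition homogeneous :: "('v::finite, 'k::zero) mpoly \<Rightarrow> nat \<Rightarrow> bool" where
  "homogeneous p e \<longleftrightarrow> (\<forall>a \<in> Poly_Mapping.keys p. (\<Sum>v\<in>UNIV. Poly_Mapping.lookup a v) = e)"

definition max_ideal :: "('v::finite, 'k::zero) mpoly set" where
  "max_ideal = {p. Poly_Mapping.lookup p 0 = 0}"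

definition is_ideal :: "'a::comm_ring_1 set \<Rightarrow> bool" where
  "is_ideal J \<longleftrightarrow> 0 \<in> J \<and> (\<forall>x\<in>J. \<forall>y\<in>J. x + y \<in> J) \<and> (\<forall>x\<in>J. \<forall>a. a * x \<in> J)"

definition is_prime_ideal :: "'a::comm_ring_1 set \<Rightarrow> bool" where
  "is_prime_ideal P \<longleftrightarrow> is_ideal P \<and> P \<noteq> UNIV \<and> (\<forall>a b. a * b \<in> P \<longrightarrow> a \<in> P \<or> b \<in> P)"

definition ideal_gen :: "'a::comm_ring_1 set \<Rightarrow> 'a set" where
  "ideal_gen S = \<Inter>{J. is_ideal J \<and> S \<subseteq> J}"

definition ideal_pow :: "'a::comm_ring_1 set \<Rightarrow> nat \<Rightarrow> 'a set" where
  "ideal_pow I m = ideal_gen {(\<Prod>k<m. y k) | y. \<forall>k<m. y k \<in> I}"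

definition prime_chain :: "(nat \<Rightarrow> 'a::comm_ring_1 set) \<Rightarrow> nat \<Rightarrow> bool" where
  "prime_chain C k \<longleftrightarrow> (\<forall>i\<le>k. is_prime_ideal (C i)) \<and> (\<forall>i<k. C i \<subset> C (Suc i))"

definition height_prime :: "'a::comm_ring_1 set \<Rightarrow> enat" where
  "height_prime P = (SUP k \<in> {k. \<exists>C. prime_chain C k \<and> C k = P}. enat k)"

definition height :: "'a::comm_ring_1 set \<Rightarrow> enat" where
  "height I = (INF P \<in> {P. is_prime_ideal P \<and> I \<subseteq> P}. height_prime P)"

definition krull_dim_quot :: "'a::comm_ring_1 set \<Rightarrow> enat" where
  "krull_dim_quot I = (SUP k \<in> {k. \<exists>C. prime_chain C k \<and> I \<subseteq> C 0}. enat k)"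

definition regular_seq_quot :: "('v::finite, 'k::field) mpoly set \<Rightarrow> (nat \<Rightarrow> ('v, 'k) mpoly) \<Rightarrow> nat \<Rightarrow> bool" where
  "regular_seq_quot I y k \<longleftrightarrow> (\<forall>j<k. y j \<in> max_ideal) \<and>
     ideal_gen (I \<union> y ` {..<k}) \<noteq> UNIV \<and>
     (\<forall>j<k. \<forall>z. z * y j \<in> ideal_gen (I \<union> y ` {..<j}) \<longrightarrow> z \<in> ideal_gen (I \<union> y ` {..<j}))"

definition depth_quot :: "('v::finite, 'k::field) mpoly set \<Rightarrow> enat" where
  "depth_quot I = (SUP k \<in> {k. \<exists>y. regular_seq_quot I y k}. enat k)"

definition perfect_ideal :: "('v::finite, 'k::field) mpoly set \<Rightarrow> bool" where
  "perfect_ideal I \<longleftrightarrow> depth_quot I = krull_dim_quot I"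

text \<open>Local complete intersection: for every prime P ~= m containing I, the
  localization I_P is generated by height(I) elements, i.e. there are
  g_1..g_h in I (h = height I) and u not in P with u*I contained in (g_1..g_h).\<close>
definition local_complete_intersection :: "('v::finite, 'k::field) mpoly set \<Rightarrow> bool" where
  "local_complete_intersection I \<longleftrightarrow>
     (\<forall>P. is_prime_ideal P \<and> P \<noteq> max_ideal \<and> I \<subseteq> P \<longrightarrow>
        (\<exists>g :: ('v, 'k) mpoly list. \<exists>u. enat (length g) = height I \<and> set g \<subseteq> I \<and> u \<notin> P \<and>
            (\<forall>x\<in>I. u * x \<in> ideal_gen (set g))))"

text \<open>Basis of wedge^i F (x) Sym^(m-i) G, with F of rank s and G of rank r:
  pairs (J, a) where J is an i-subset of {0..<s} (u_J = wedge of u_j, j in J in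
  increasing order) and a is an exponent vector of a monomial t^a of degree m-i
  in t_0,...,t_{r-1}.\<close>
definition cx_basis :: "nat \<Rightarrow> nat \<Rightarrow> nat \<Rightarrow> nat \<Rightarrow> (nat set \<times> (nat \<Rightarrow> nat)) set" where
  "cx_basis r s m i = {(J, a). J \<subseteq> {..<s} \<and> card J = i \<and> i \<le> m \<and>
      (\<forall>k\<ge>r. a k = 0) \<and> (\<Sum>k<r. a k) = m - i}"

definition cx_module :: "nat \<Rightarrow> nat \<Rightarrow> nat \<Rightarrow> nat \<Rightarrow> ((nat set \<times> (nat \<Rightarrow> nat)) \<Rightarrow> 'a::comm_ring_1) set" where
  "cx_module r s m i = {x. \<forall>b. b \<notin> cx_basis r s m i \<longrightarrow> x b = 0}"

text \<open>The differential wedge^i F (x) Sym^(m-i) G -> wedge^(i-1) F (x) Sym^(m-i+1) G: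
  u_J (x) t^a maps to sum over j in J of (-1)^(pos of j in J) u_(J-{j}) (x) c_j t^a,
  with c_j = sum_l phi l j * t_l.  (Position counted from 0, matching (-1)^(l+1)
  with l counted from 1.)\<close>
definition cx_diff :: "nat \<Rightarrow> nat \<Rightarrow> nat \<Rightarrow> (nat \<Rightarrow> nat \<Rightarrow> 'a::comm_ring_1) \<Rightarrow> nat \<Rightarrow>
     ((nat set \<times> (nat \<Rightarrow> nat)) \<Rightarrow> 'a) \<Rightarrow> ((nat set \<times> (nat \<Rightarrow> nat)) \<Rightarrow> 'a)" where
  "cx_diff r s m \<phi> i x = (\<lambda>(K, a'). \<Sum>(J, a) \<in> cx_basis r s m i.
      x (J, a) * (\<Sum>j\<in>J. \<Sum>l<r.
         (if K = J - {j} \<and> a' = a(l := Suc (a l))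
          then (-1) ^ card {j'\<in>J. j' < j} * \<phi> l j else 0)))"

definition cx_aug :: "nat \<Rightarrow> nat \<Rightarrow> nat \<Rightarrow> (nat \<Rightarrow> 'a::comm_ring_1) \<Rightarrow>
     ((nat set \<times> (nat \<Rightarrow> nat)) \<Rightarrow> 'a) \<Rightarrow> 'a" where
  "cx_aug r s m f x = (\<Sum>(J, a) \<in> cx_basis r s m 0. x (J, a) * (\<Prod>l<r. f l ^ a l))"

end

theory Submission
  imports Defs
begin

text \<open>
  Write c_1, ..., c_s for the linear forms in t_1, ..., t_r given by the columns of the
  presentation matrix; rank additivity gives s = r - 1.  The augmented strand has length at most
  min s m + 1, which is at most the number of variables, so by the acyclicity lemma of Peskine and
  Szpiro it is exact as soon as its homology (including that at Sym^m G) is torsion with respect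
  to every variable.  By prime avoidance this may be checked at the primes P other than the
  maximal ideal, where I is generated by two elements.  There, up to elements outside P, the
  linear forms c_1, ..., c_s together with two linear forms A and B mapping to the generators span
  all linear forms, with one of these r + 1 forms redundant.  If A or B is redundant, the c_j are
  part of a coordinate system and I is principal.  Otherwise some c_e is redundant and becomes
  p A + q B modulo the others, where (p, q) generates the syzygies of the two generators.
  In both cases c_1, ..., c_s is a regular sequence (in any order) generating the kernel of
  Sym G --> Rees algebra, so the Koszul complex is exact at P.

  Exactness at P is expressed without localizing: a relation holds at P if it holds after
  multiplication by an element outside P.
\<close>


section \<open>Ideals, regular sequences and acyclicity\<close>

text \<open>The recurring obstacle is that the column redundant at P may stand anywhere among c_1,
  ..., c_s, and that nothing can be divided by. The remedy is a substitution: over a coordinate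
  system valid up to a factor w outside P, \<open>proj E\<close> rewrites each t_l in the columns
  and drops those in E. It is a ring homomorphism into a domain whose kernel is, up to factors
  outside P, the ideal of the columns in E. Regularity of a further column then only asks that its
  image be nonzero, which follows from injectivity of \<open>\<phi>\<close>; a redundant column is
  moved into place by exchanging the last two members of a regular sequence. The kernel of
  evaluation is found by the same substitution: at most two columns survive it, so a form becomes a
  binary form. In the acyclicity argument R itself, as target of the augmentation, occupies position
  0; this is the origin of the summand 1 in the length. Primes enter through the annihilator of a
  homology class: a prime that avoids some variable is not the maximal ideal.\<close>

lemma is_idealD:
  assumes "is_ideal J"
  shows ideal_zero: "0 \<in> J" and ideal_add: "x \<in> J \<Longrightarrow> y \<in> J \<Longrightarrow> x + y \<in> J"
    and ideal_mult: "x \<in> J \<Longrightarrow> a * x \<in> J" and ideal_mult2: "x \<in> J \<Longrightarrow> x * a \<in> J"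
  using assms by (auto simp: is_ideal_def mult.commute)

lemma ideal_uminus: "is_ideal J \<Longrightarrow> x \<in> J \<Longrightarrow> - x \<in> J"
  using ideal_mult[of J x "-1"] by simp

lemma ideal_diff: "is_ideal J \<Longrightarrow> x \<in> J \<Longrightarrow> y \<in> J \<Longrightarrow> x - y \<in> J"
  using ideal_add[of J x "-y"] ideal_uminus[of J y] by simp

lemma ideal_sum: "is_ideal J \<Longrightarrow> (\<And>i. i \<in> A \<Longrightarrow> g i \<in> J) \<Longrightarrow> sum g A \<in> J"
  by (induction A rule: infinite_finite_induct) (auto intro: ideal_zero ideal_add)

text \<open>Membership provides an explicit family of cofactors, which ring homomorphisms and
  \<open>degree_scale\<close> can then transport term by term. Indexing by a set, not a prefix,
  allows one column to be left out or added last.\<close>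

definition set_ideal :: "('i \<Rightarrow> 'a::comm_ring_1) \<Rightarrow> 'i set \<Rightarrow> 'a set" where
  "set_ideal c E = {z. \<exists>b. z = (\<Sum>i\<in>E. c i * b i)}"

lemma is_ideal_set_ideal: "is_ideal (set_ideal c E)"
  unfolding is_ideal_def
proof (intro conjI ballI allI)
  show "0 \<in> set_ideal c E" by (auto simp: set_ideal_def intro!: exI[of _ "\<lambda>_. 0"])
  show "x + y \<in> set_ideal c E" if "x \<in> set_ideal c E" "y \<in> set_ideal c E" for x y
    using that by (auto simp: set_ideal_def sum.distrib[symmetric] distrib_left[symmetric])
  show "a * x \<in> set_ideal c E" if x: "x \<in> set_ideal c E" for a x
  proof -
    obtain b where "x = (\<Sum>i\<in>E. c i * b i)" using x by (auto simp: set_ideal_def)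
    then have "a * x = (\<Sum>i\<in>E. c i * (a * b i))" by (simp add: sum_distrib_left mult.left_commute)
    then show ?thesis by (auto simp: set_ideal_def)
  qed
qed

lemmas set_ideal_zero = ideal_zero[OF is_ideal_set_ideal]
  and set_ideal_add = ideal_add[OF is_ideal_set_ideal]
  and set_ideal_diff = ideal_diff[OF is_ideal_set_ideal]
  and set_ideal_mult = ideal_mult[OF is_ideal_set_ideal]
  and set_ideal_mult2 = ideal_mult2[OF is_ideal_set_ideal]
  and set_ideal_sum = ideal_sum[OF is_ideal_set_ideal]

lemma set_ideal_insert:
  assumes "finite E" "i \<notin> E"
  shows "z \<in> set_ideal c (insert i E) \<longleftrightarrow> (\<exists>y q. q \<in> set_ideal c E \<and> z = q + c i * y)"
proof
  assume "z \<in> set_ideal c (insert i E)"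
  then obtain b where "z = (\<Sum>i\<in>E. c i * b i) + c i * b i"
    using assms by (auto simp: set_ideal_def add.commute)
  then show "\<exists>y q. q \<in> set_ideal c E \<and> z = q + c i * y" by (auto simp: set_ideal_def)
next
  assume "\<exists>y q. q \<in> set_ideal c E \<and> z = q + c i * y"
  then obtain y b where z: "z = (\<Sum>i\<in>E. c i * b i) + c i * y" by (auto simp: set_ideal_def)
  have "(\<Sum>j\<in>E. c j * (b(i := y)) j) = (\<Sum>i\<in>E. c i * b i)"
    using assms by (intro sum.cong) auto
  then have "z = (\<Sum>j\<in>insert i E. c j * (b(i := y)) j)"
    using assms by (simp add: z add.commute)
  then show "z \<in> set_ideal c (insert i E)" unfolding set_ideal_def by (intro CollectI exI)
qed

lemma set_ideal_gen:
  assumes "finite E" "i \<in> E"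
  shows "c i \<in> set_ideal c E"
proof -
  have "c i = 0 + c i * 1" by simp
  then have "c i \<in> set_ideal c (insert i (E - {i}))"
    using assms set_ideal_zero by (subst set_ideal_insert) blast+
  then show ?thesis using assms by (simp add: insert_absorb)
qed

definition seq_ideal :: "(nat \<Rightarrow> 'a::comm_ring_1) \<Rightarrow> nat \<Rightarrow> 'a set" where
  "seq_ideal x k = set_ideal x {..<k}"

lemma seq_ideal_0 [simp]: "seq_ideal x 0 = {0}"
  by (auto simp: seq_ideal_def set_ideal_def)

lemma is_ideal_seq_ideal: "is_ideal (seq_ideal x k)"
  unfolding seq_ideal_def by (rule is_ideal_set_ideal)

lemmas seq_ideal_zero [simp] = ideal_zero[OF is_ideal_seq_ideal]
  and seq_ideal_add = ideal_add[OF is_ideal_seq_ideal]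
  and seq_ideal_mult = ideal_mult[OF is_ideal_seq_ideal]
  and seq_ideal_mult2 = ideal_mult2[OF is_ideal_seq_ideal]
  and seq_ideal_uminus = ideal_uminus[OF is_ideal_seq_ideal]
  and seq_ideal_sum = ideal_sum[OF is_ideal_seq_ideal]

lemma seq_ideal_Suc: "z \<in> seq_ideal x (Suc k) \<longleftrightarrow> (\<exists>y p. p \<in> seq_ideal x k \<and> z = x k * y + p)"
  unfolding seq_ideal_def lessThan_Suc by (subst set_ideal_insert) (auto simp: add.commute)

lemma seq_ideal_gen: "i < k \<Longrightarrow> x i \<in> seq_ideal x k"
  unfolding seq_ideal_def by (rule set_ideal_gen) auto

lemma seq_ideal_step: "z \<in> seq_ideal x k \<Longrightarrow> x k * y + z \<in> seq_ideal x (Suc k)"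
  unfolding seq_ideal_Suc by blast

text \<open>A free module is the set of functions vanishing off its basis.  The complex has length
  at most the length of the regular sequence; both halves of the proof are inductions along the
  sequence: homology modulo the first k elements is torsion beyond degree k, and from this
  exactness is propagated from k + 1 back to k.\<close>

locale free_complex =
  fixes B :: "nat \<Rightarrow> 'b set" and d :: "nat \<Rightarrow> ('b \<Rightarrow> 'a::comm_ring_1) \<Rightarrow> 'b \<Rightarrow> 'a"
    and L :: "nat \<Rightarrow> ('b \<Rightarrow> 'a) set"
  assumes L_eq: "L i = {y. \<forall>b. b \<notin> B i \<longrightarrow> y b = 0}"
    and d_mem: "y \<in> L (Suc i) \<Longrightarrow> d (Suc i) y \<in> L i"
    and d_add: "d i (\<lambda>b. y b + z b) = (\<lambda>b. d i y b + d i z b)"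
    and d_smult: "d i (\<lambda>b. a * y b) = (\<lambda>b. a * d i y b)"
    and d_d: "y \<in> L (Suc (Suc i)) \<Longrightarrow> d (Suc i) (d (Suc (Suc i)) y) = (\<lambda>_. 0)"
begin

lemma d_zero: "d i (\<lambda>_. 0) = (\<lambda>_. 0)"
  using d_smult[of i 0 "\<lambda>_. 0"] by simp

lemma d_diff: "d i (\<lambda>b. y b - z b) = (\<lambda>b. d i y b - d i z b)"
proof -
  have "d i (\<lambda>b. y b + (-1) * z b) = (\<lambda>b. d i y b + (-1) * d i z b)"
    unfolding d_add d_smult ..
  then show ?thesis by simp
qed

lemma L_diff: "y \<in> L i \<Longrightarrow> z \<in> L i \<Longrightarrow> (\<lambda>b. y b - z b) \<in> L i"
  and L_smult: "y \<in> L i \<Longrightarrow> (\<lambda>b. a * y b) \<in> L i"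
  and L_zero: "(\<lambda>_. 0) \<in> L i"
  by (auto simp: L_eq)

text \<open>Linearity of \<open>d\<close> is available for one scalar and for binary sums only, so
  the generators are split off one at a time.\<close>

lemma d_seq_ideal:
  assumes "\<And>b. p b \<in> seq_ideal x k"
  shows "d i p b \<in> seq_ideal x k"
  using assms
proof (induction k arbitrary: p b)
  case 0
  then have "p = (\<lambda>_. 0)" by auto
  then show ?case by (simp add: d_zero)
next
  case (Suc k)
  then have "\<forall>b. \<exists>y q. q \<in> seq_ideal x k \<and> p b = x k * y + q" by (simp add: seq_ideal_Suc)
  then obtain y q where q: "\<And>b. q b \<in> seq_ideal x k" and p: "p = (\<lambda>b. x k * y b + q b)"
    by metis
  have "d i p b = x k * d i y b + d i q b" unfolding p d_add d_smult ..
  then show ?case using Suc.IH[OF q] by (auto intro: seq_ideal_step)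
qed

text \<open>The cofactors are chosen coefficient by coefficient; setting them to 0 off the basis
  keeps them in the free module.\<close>

lemma mem_seq_ideal_Suc:
  assumes "\<And>b. z b \<in> seq_ideal x (Suc k)" "z \<in> L i"
  obtains y p where "y \<in> L i" "p \<in> L i" "\<And>b. p b \<in> seq_ideal x k" "z = (\<lambda>b. x k * y b + p b)"
proof -
  have "\<forall>b. \<exists>y p. p \<in> seq_ideal x k \<and> z b = x k * y + p \<and> (b \<notin> B i \<longrightarrow> y = 0 \<and> p = 0)"
  proof
    fix b
    show "\<exists>y p. p \<in> seq_ideal x k \<and> z b = x k * y + p \<and> (b \<notin> B i \<longrightarrow> y = 0 \<and> p = 0)"
    proof (cases "b \<in> B i")
      case True then show ?thesis using assms(1)[of b] by (simp add: seq_ideal_Suc)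
    next
      case False then show ?thesis using assms(2)
        by (intro exI[of _ 0]) (auto simp: L_eq)
    qed
  qed
  then obtain y p where "\<And>b. p b \<in> seq_ideal x k \<and> z b = x k * y b + p b \<and> (b \<notin> B i \<longrightarrow> y b = 0 \<and> p b = 0)"
    by metis
  then show thesis by (intro that[of y p]) (auto simp: L_eq)
qed

text \<open>An elementwise form of the long exact homology sequence for multiplication by x_k on
  L/(x_0, ..., x_(k-1)): homology in degree i modulo one more element lies between the old homology
  in degrees i and i - 1. One degree is lost per element, hence the condition k < i.\<close>

lemma torsion_mod_regular:
  assumes reg: "\<And>k z. k < N \<Longrightarrow> x k * z \<in> seq_ideal x k \<Longrightarrow> z \<in> seq_ideal x k"
    and tors: "\<And>i z k. 1 \<le> i \<Longrightarrow> z \<in> L i \<Longrightarrow> d i z = (\<lambda>_. 0) \<Longrightarrow> k < N \<Longrightarrow>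
                 \<exists>a. \<exists>w\<in>L (Suc i). (\<lambda>b. x k ^ a * z b) = d (Suc i) w"
    and "k \<le> N" "k < i" "z \<in> L i" "\<And>b. d i z b \<in> seq_ideal x k" "j < N"
  shows "\<exists>a. \<exists>w\<in>L (Suc i). \<forall>b. x j ^ a * z b - d (Suc i) w b \<in> seq_ideal x k"
  using assms(3-)
proof (induction k arbitrary: i z)
  case 0
  then have "d i z = (\<lambda>_. 0)" by auto
  then obtain a w where "w \<in> L (Suc i)" "(\<lambda>b. x j ^ a * z b) = d (Suc i) w"
    using tors[of i z j] 0 by auto
  then show ?case by (intro exI[of _ a] bexI[of _ w]) (auto dest: fun_cong)
next
  case (Suc k)
  then obtain i' where i: "i = Suc (Suc i')" by (cases i; cases "i - 1") auto
  have dz: "d i z \<in> L (Suc i')" using Suc.prems(3) d_mem i by simp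
  obtain y p where y: "y \<in> L (Suc i')" and p: "p \<in> L (Suc i')" "\<And>b. p b \<in> seq_ideal x k"
    and eq: "d i z = (\<lambda>b. x k * y b + p b)"
    using mem_seq_ideal_Suc[OF Suc.prems(4) dz] by blast
  have "(\<lambda>b. x k * d (Suc i') y b + d (Suc i') p b) = (\<lambda>_. 0)"
    using d_d[of z i'] Suc.prems(3) unfolding i[symmetric] eq d_add d_smult by simp
  then have "x k * d (Suc i') y b = - d (Suc i') p b" for b
    by (metis add_eq_0_iff add.commute)
  then have "x k * d (Suc i') y b \<in> seq_ideal x k" for b
    by (simp add: seq_ideal_uminus d_seq_ideal p(2))
  then have "d (Suc i') y b \<in> seq_ideal x k" for b
    using reg[of k] Suc.prems(1) by simp
  then obtain a w where w: "w \<in> L i" "\<And>b. x j ^ a * y b - d i w b \<in> seq_ideal x k"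
    using Suc.IH[of "Suc i'" y] Suc.prems y i by auto
  \<comment> \<open>As d z = x_k y + p and d w agrees with x_j^a y modulo the first k elements,
    subtracting x_k w turns x_j^a z into a cycle modulo those elements.\<close>
  define u where "u = (\<lambda>b. x j ^ a * z b - x k * w b)"
  have u: "u \<in> L i" unfolding u_def by (intro L_diff L_smult Suc.prems w)
  have "d i u b = x k * (x j ^ a * y b - d i w b) + x j ^ a * p b" for b
    unfolding u_def d_diff d_smult eq by (simp add: algebra_simps)
  then have "d i u b \<in> seq_ideal x k" for b
    by (auto intro!: seq_ideal_add seq_ideal_mult w(2) p(2))
  then obtain c w' where w': "w' \<in> L (Suc i)" "\<And>b. x j ^ c * u b - d (Suc i) w' b \<in> seq_ideal x k"
    using Suc.IH[of i u] Suc.prems u by auto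
  have "x j ^ (c + a) * z b - d (Suc i) w' b
      = x k * (x j ^ c * w b) + (x j ^ c * u b - d (Suc i) w' b)" for b
    by (simp add: u_def power_add algebra_simps)
  then have "x j ^ (c + a) * z b - d (Suc i) w' b \<in> seq_ideal x (Suc k)" for b
    by (simp only: seq_ideal_step[OF w'(2)])
  then show ?case using w'(1) by blast
qed

text \<open>Descending induction on k. At k = N the chain modules in degrees above N vanish;
  otherwise torsion with respect to x_k itself is removed by means of exactness modulo one more
  element.\<close>

lemma exact_mod_regular:
  assumes reg: "\<And>k z. k < N \<Longrightarrow> x k * z \<in> seq_ideal x k \<Longrightarrow> z \<in> seq_ideal x k"
    and tors: "\<And>i z k. 1 \<le> i \<Longrightarrow> z \<in> L i \<Longrightarrow> d i z = (\<lambda>_. 0) \<Longrightarrow> k < N \<Longrightarrow>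
                 \<exists>a. \<exists>w\<in>L (Suc i). (\<lambda>b. x k ^ a * z b) = d (Suc i) w"
    and len: "\<And>i. N < i \<Longrightarrow> B i = {}"
    and "k \<le> N" "k < i" "z \<in> L i" "\<And>b. d i z b \<in> seq_ideal x k"
  shows "\<exists>w\<in>L (Suc i). \<forall>b. z b - d (Suc i) w b \<in> seq_ideal x k"
  using assms(4-)
proof (induction "N - k" arbitrary: k i z)
  case 0
  then have "z = (\<lambda>_. 0)" using len[of i] by (auto simp: L_eq)
  then show ?case by (intro bexI[of _ "\<lambda>_. 0"]) (auto simp: d_zero L_zero)
next
  case (Suc M)
  note outer_IH = Suc.hyps(1)
  have k: "k < N" "M = N - Suc k" "k < i" using Suc.hyps(2) Suc.prems by auto
  \<comment> \<open>One factor x_k is cancelled at a time: a lift w of x_k^(a+1) z is a cycle modulo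
    x_0, ..., x_k, hence a boundary plus x_k u modulo the first k elements, and u lifts x_k^a
    z.\<close>
  have *: "\<exists>w\<in>L (Suc i). \<forall>b. z b - d (Suc i) w b \<in> seq_ideal x k"
    if "w \<in> L (Suc i)" "\<And>b. x k ^ a * z b - d (Suc i) w b \<in> seq_ideal x k" for a w
    using that
  proof (induction a arbitrary: w)
    case 0 then show ?case by auto
  next
    case (Suc a)
    have "d (Suc i) w b = x k * (x k ^ a * z b) + - (x k ^ Suc a * z b - d (Suc i) w b)" for b
      by (simp add: algebra_simps)
    then have "d (Suc i) w b \<in> seq_ideal x (Suc k)" for b
      using seq_ideal_step[OF seq_ideal_uminus[OF Suc.prems(2)]] by metis
    \<comment> \<open>The hypothesis for k + 1 applies because w lives one degree higher, so that k
      + 1 < i + 1.\<close>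
    then obtain v where v: "v \<in> L (Suc (Suc i))"
      and vw: "\<And>b. w b - d (Suc (Suc i)) v b \<in> seq_ideal x (Suc k)"
      using outer_IH[of "Suc k" "Suc i" w] Suc.prems(1) k
      by auto
    have wv: "(\<lambda>b. w b - d (Suc (Suc i)) v b) \<in> L (Suc i)"
      by (intro L_diff Suc.prems d_mem v)
    obtain u p where u: "u \<in> L (Suc i)" and p: "\<And>b. p b \<in> seq_ideal x k"
      and eq: "(\<lambda>b. w b - d (Suc (Suc i)) v b) = (\<lambda>b. x k * u b + p b)"
      using mem_seq_ideal_Suc[where z = "\<lambda>b. w b - d (Suc (Suc i)) v b", OF vw wv] by blast
    have "d (Suc i) w b = x k * d (Suc i) u b + d (Suc i) p b" for b
      using arg_cong[OF eq, of "\<lambda>f. d (Suc i) f b"] d_d[OF v]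
      unfolding d_diff d_add d_smult by simp
    then have eq': "x k * (x k ^ a * z b - d (Suc i) u b)
        = (x k ^ Suc a * z b - d (Suc i) w b) + d (Suc i) p b" for b
      by (simp add: algebra_simps)
    have "x k ^ a * z b - d (Suc i) u b \<in> seq_ideal x k" for b
      by (rule reg[OF k(1)]) (simp only: eq' seq_ideal_add[OF Suc.prems(2) d_seq_ideal[OF p]])
    then show ?case using Suc.IH[OF u] by blast
  qed
  have "\<exists>a. \<exists>w\<in>L (Suc i). \<forall>b. x k ^ a * z b - d (Suc i) w b \<in> seq_ideal x k"
    by (rule torsion_mod_regular[OF reg tors]) (use Suc.prems k in auto)
  then show ?case using * by blast
qed

lemma acyclicity:
  assumes reg: "\<And>k z. k < N \<Longrightarrow> x k * z \<in> seq_ideal x k \<Longrightarrow> z \<in> seq_ideal x k"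
    and tors: "\<And>i z k. 1 \<le> i \<Longrightarrow> z \<in> L i \<Longrightarrow> d i z = (\<lambda>_. 0) \<Longrightarrow> k < N \<Longrightarrow>
                 \<exists>a. \<exists>w\<in>L (Suc i). (\<lambda>b. x k ^ a * z b) = d (Suc i) w"
    and len: "\<And>i. N < i \<Longrightarrow> B i = {}"
    and "1 \<le> i" "z \<in> L i" "d i z = (\<lambda>_. 0)"
  shows "\<exists>w\<in>L (Suc i). z = d (Suc i) w"
proof -
  have "\<exists>w\<in>L (Suc i). \<forall>b. z b - d (Suc i) w b \<in> seq_ideal x 0"
    by (rule exact_mod_regular[OF reg tors len]) (use assms(4-) in auto)
  then show ?thesis by (auto simp: fun_eq_iff)
qed

end

section \<open>The Koszul complex\<close>

text \<open>The Koszul differential in coefficients: position K collects what the basis elements on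
  K with one index j added send there. Families on all subsets treat all homological degrees at
  once.\<close>

definition kdiff :: "nat \<Rightarrow> (nat \<Rightarrow> 'a::comm_ring_1) \<Rightarrow> (nat set \<Rightarrow> 'a) \<Rightarrow> nat set \<Rightarrow> 'a" where
  "kdiff s c x K = (\<Sum>j\<in>{..<s} - K. (-1) ^ card {i\<in>K. i < j} * c j * x (insert j K))"

lemma kdiff_cong:
  assumes "\<And>j. j < s \<Longrightarrow> j \<notin> K \<Longrightarrow> x (insert j K) = y (insert j K)"
  shows "kdiff s c x K = kdiff s c y K"
  unfolding kdiff_def using assms by (intro sum.cong) auto

lemma kdiff_add: "kdiff s c (\<lambda>J. x J + y J) K = kdiff s c x K + kdiff s c y K"
  unfolding kdiff_def by (simp add: algebra_simps sum.distrib)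

lemma kdiff_smult: "kdiff s c (\<lambda>J. a * x J) K = a * kdiff s c x K"
  unfolding kdiff_def by (simp add: sum_distrib_left mult_ac)

text \<open>The differential changes cardinality by one, so it anticommutes with the alternating
  sign; this is the sign of the mapping cone in \<open>kdiff_Suc\<close>.\<close>

lemma kdiff_twist:
  assumes "K \<subseteq> {..<s}"
  shows "kdiff s c (\<lambda>J. (-1) ^ card J * x J) K = - ((-1) ^ card K * kdiff s c x K)"
proof -
  have "finite K" using assms finite_subset by blast
  then show ?thesis unfolding kdiff_def
    by (auto simp: sum_distrib_left sum_negf[symmetric] mult_ac intro!: sum.cong)
qed

text \<open>With \<open>kdiff_Suc_insert\<close> this presents the Koszul complex on s + 1 elements
  as the cone of multiplication by c_s on that of s elements. The new index is the largest one, so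
  its sign counts all of K.\<close>

lemma kdiff_Suc:
  assumes "K \<subseteq> {..<s}"
  shows "kdiff (Suc s) c x K = kdiff s c x K + (-1) ^ card K * c s * x (insert s K)"
proof -
  have "{..<Suc s} - K = insert s ({..<s} - K)" using assms by auto
  moreover have "{i\<in>K. i < s} = K" using assms by auto
  ultimately show ?thesis unfolding kdiff_def by (simp add: add.commute)
qed

lemma kdiff_Suc_insert:
  assumes "K \<subseteq> {..<s}"
  shows "kdiff (Suc s) c x (insert s K) = kdiff s c (\<lambda>J. x (insert s J)) K"
proof -
  have "{..<Suc s} - insert s K = {..<s} - K" using assms by auto
  moreover have "{i. (i = s \<or> i \<in> K) \<and> i < j} = {i\<in>K. i < j}" if "j < s" for j using that by auto
  ultimately show ?thesis unfolding kdiff_def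
    by (auto simp: insert_commute intro!: sum.cong)
qed

lemma subset_lessThan_Suc_cases:
  assumes "K \<subseteq> {..<Suc s}"
  obtains "K \<subseteq> {..<s}" | K' where "K' \<subseteq> {..<s}" "K = insert s K'"
proof (cases "s \<in> K")
  case True
  then have "K - {s} \<subseteq> {..<s}" "K = insert s (K - {s})" using assms less_Suc_eq by auto
  then show thesis by (rule that(2))
next
  case False
  then show thesis using assms by (intro that(1)) (force simp: less_Suc_eq)
qed

lemma kdiff_kdiff: "K \<subseteq> {..<s} \<Longrightarrow> kdiff s c (kdiff s c x) K = 0"
proof (induction s arbitrary: x K)
  case 0 then show ?case by (simp add: kdiff_def)
next
  case (Suc s)
  from Suc.prems show ?case
  proof (cases rule: subset_lessThan_Suc_cases)
    case 1
    have "kdiff s c (kdiff (Suc s) c x) K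
        = kdiff s c (\<lambda>J. kdiff s c x J + c s * ((-1) ^ card J * x (insert s J))) K"
      using 1 by (intro kdiff_cong) (auto simp: kdiff_Suc mult_ac)
    also have "\<dots> = - (c s * ((-1) ^ card K * kdiff s c (\<lambda>J. x (insert s J)) K))"
      unfolding kdiff_add kdiff_smult kdiff_twist[OF 1] Suc.IH[OF 1] by simp
    finally show ?thesis using 1 by (simp add: kdiff_Suc kdiff_Suc_insert)
  next
    case (2 K')
    have "kdiff s c (\<lambda>J. kdiff (Suc s) c x (insert s J)) K'
        = kdiff s c (kdiff s c (\<lambda>J. x (insert s J))) K'"
      using 2 by (intro kdiff_cong) (auto simp: kdiff_Suc_insert)
    then show ?thesis using 2 Suc.IH by (simp add: kdiff_Suc_insert)
  qed
qed

lemma kdiff_in_seq_ideal: "kdiff s c x K \<in> seq_ideal c s"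
  unfolding kdiff_def by (intro seq_ideal_sum seq_ideal_mult seq_ideal_mult2 seq_ideal_gen) auto

text \<open>The hypothesis on \<open>x {}\<close> treats exactness in positive degrees (where \<open>x {} = 0\<close>) and in
  degree zero uniformly.\<close>

lemma koszul_exact_up_to:
  fixes c :: "nat \<Rightarrow> 'a::comm_ring_1"
  assumes U: "1 \<in> U" "\<And>v w. v \<in> U \<Longrightarrow> w \<in> U \<Longrightarrow> v * w \<in> U"
    and reg: "\<And>j z. j < s \<Longrightarrow> c j * z \<in> seq_ideal c j \<Longrightarrow> \<exists>w\<in>U. w * z \<in> seq_ideal c j"
    and cycle: "\<And>K. K \<subseteq> {..<s} \<Longrightarrow> kdiff s c x K = 0"
    and empty: "\<exists>w\<in>U. w * x {} \<in> seq_ideal c s"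
  shows "\<exists>w\<in>U. \<exists>y. \<forall>K\<subseteq>{..<s}. w * x K = kdiff s c y K"
  using reg cycle empty
proof (induction s arbitrary: x)
  case 0
  then show ?case by (auto simp: kdiff_def)
next
  case (Suc s)
  \<comment> \<open>The component of x along u_s: it is a cycle for the first s elements, and c_s
    times it is a boundary up to sign.\<close>
  define x1 where "x1 = (\<lambda>J. x (insert s J))"
  have x1: "kdiff s c x1 K = 0" if "K \<subseteq> {..<s}" for K
    using Suc.prems(2)[of "insert s K"] that kdiff_Suc_insert[OF that, of c x]
    unfolding x1_def by (simp add: subset_insertI2 lessThan_Suc)
  have x0: "kdiff s c x K = - ((-1) ^ card K * c s * x1 K)" if "K \<subseteq> {..<s}" for K
    using Suc.prems(2)[of K] that kdiff_Suc[OF that, of c x]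
    unfolding x1_def by (simp add: subset_insertI2 lessThan_Suc add_eq_0_iff)
  obtain w0 e p where w0: "w0 \<in> U" and p: "p \<in> seq_ideal c s" and x_empty: "w0 * x {} = c s * e + p"
    using Suc.prems(3) by (auto simp: seq_ideal_Suc)
  have "c s * x1 {} \<in> seq_ideal c s"
    using x0[of "{}"] kdiff_in_seq_ideal[of s c x "{}"] seq_ideal_uminus by fastforce
  then have "\<exists>w\<in>U. w * x1 {} \<in> seq_ideal c s" using Suc.prems(1) by blast
  then obtain w1 y1 where w1: "w1 \<in> U" and y1: "\<And>K. K \<subseteq> {..<s} \<Longrightarrow> w1 * x1 K = kdiff s c y1 K"
    using Suc.IH[of x1] Suc.prems(1) x1 less_SucI by metis
  \<comment> \<open>\<open>kdiff\<close> never reads the value at the empty set, so this value is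
    free. Taking w1 * e there cancels the c_s-part of x at the empty set in the next
    definition.\<close>
  define y1' where "y1' = (\<lambda>J. if J = {} then w1 * e else w0 * y1 J)"
  \<comment> \<open>What remains of the component without u_s after subtracting the contribution of
    u_s and y1': a cycle for s elements whose value at the empty set is w1 * p, so the induction
    hypothesis applies again.\<close>
  define x0' where "x0' = (\<lambda>J. w0 * w1 * x J + (- c s) * ((-1) ^ card J * y1' J))"
  have y1': "w0 * w1 * x1 K = kdiff s c y1' K" if "K \<subseteq> {..<s}" for K
  proof -
    have "kdiff s c y1' K = kdiff s c (\<lambda>J. w0 * y1 J) K"
      by (intro kdiff_cong) (auto simp: y1'_def)
    then show ?thesis using y1[OF that] by (simp add: kdiff_smult mult_ac)
  qed
  have "kdiff s c x0' K = 0" if "K \<subseteq> {..<s}" for K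
    unfolding x0'_def kdiff_add kdiff_smult kdiff_twist[OF that] x0[OF that] y1'[OF that, symmetric]
    by (simp add: algebra_simps)
  moreover have "x0' {} = w1 * p"
  proof -
    have "x0' {} = w1 * (w0 * x {}) - c s * (w1 * e)" by (simp add: x0'_def y1'_def mult_ac)
    then show ?thesis unfolding x_empty by (simp add: algebra_simps)
  qed
  then have "\<exists>w\<in>U. w * x0' {} \<in> seq_ideal c s"
    using p U(1) by (intro bexI[of _ 1]) (auto intro: seq_ideal_mult)
  ultimately obtain w2 y0 where w2: "w2 \<in> U"
    and y0: "\<And>K. K \<subseteq> {..<s} \<Longrightarrow> w2 * x0' K = kdiff s c y0 K"
    using Suc.IH[of x0'] Suc.prems(1) less_SucI by metis
  define y where "y = (\<lambda>J. if s \<in> J then w2 * y1' (J - {s}) else y0 J)"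
  have "w2 * (w0 * w1) * x K = kdiff (Suc s) c y K" if "K \<subseteq> {..<Suc s}" for K
    using that
  proof (cases rule: subset_lessThan_Suc_cases)
    case 1
    have "kdiff s c y K = kdiff s c y0 K" using 1 by (intro kdiff_cong) (auto simp: y_def)
    moreover have "K - {s} = K" using 1 by auto
    then have "y (insert s K) = w2 * y1' K" by (simp add: y_def)
    ultimately have "kdiff (Suc s) c y K = w2 * x0' K + (-1) ^ card K * c s * (w2 * y1' K)"
      using 1 by (simp add: kdiff_Suc y0)
    then show ?thesis by (simp add: x0'_def algebra_simps)
  next
    case (2 K')
    have "kdiff s c (\<lambda>J. y (insert s J)) K' = kdiff s c (\<lambda>J. w2 * y1' J) K'"
    proof (intro kdiff_cong)
      fix j assume "j < s"
      then have "insert j K' - {s} = insert j K'" using 2 by auto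
      then show "y (insert s (insert j K')) = w2 * y1' (insert j K')" by (simp add: y_def)
    qed
    then show ?thesis using 2 y1'[of K', symmetric]
      by (simp add: kdiff_Suc_insert kdiff_smult x1_def mult_ac)
  qed
  moreover have "w2 * (w0 * w1) \<in> U" using w0 w1 w2 U by blast
  ultimately show ?case by blast
qed

section \<open>Prime ideals and linear algebra modulo a prime\<close>

lemma prime_idealD:
  assumes "is_prime_ideal P"
  shows prime_ideal_ideal: "is_ideal P" and prime_ideal_one: "1 \<notin> P"
    and prime_ideal_mult: "a \<notin> P \<Longrightarrow> b \<notin> P \<Longrightarrow> a * b \<notin> P"
proof -
  show *: "is_ideal P" using assms by (simp add: is_prime_ideal_def)
  show "1 \<notin> P" using assms ideal_mult[OF *, of 1] by (auto simp: is_prime_ideal_def)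
  show "a \<notin> P \<Longrightarrow> b \<notin> P \<Longrightarrow> a * b \<notin> P" using assms by (auto simp: is_prime_ideal_def)
qed

text \<open>An ideal maximal among those containing J and missing all powers of x is prime. It will
  be applied to the annihilator of a homology class.\<close>

lemma prime_ideal_avoiding_powers:
  fixes J :: "'a::comm_ring_1 set"
  assumes J: "is_ideal J" and x: "\<And>n. x ^ n \<notin> J"
  obtains P where "is_prime_ideal P" "J \<subseteq> P" "x \<notin> P"
proof -
  define A where "A = {Q. is_ideal Q \<and> J \<subseteq> Q \<and> (\<forall>n. x ^ n \<notin> Q)}"
  have "\<exists>M\<in>A. \<forall>X\<in>A. M \<subseteq> X \<longrightarrow> X = M"
  proof (rule subset_Zorn_nonempty)
    show "A \<noteq> {}" using J x by (auto simp: A_def)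
    fix C assume C: "C \<noteq> {}" "subset.chain A C"
    then have CA: "C \<subseteq> A" and tot: "\<And>X Y. X \<in> C \<Longrightarrow> Y \<in> C \<Longrightarrow> X \<subseteq> Y \<or> Y \<subseteq> X"
      by (auto simp: subset.chain_def)
    have "is_ideal (\<Union>C)"
      unfolding is_ideal_def
    proof (intro conjI ballI allI)
      show "0 \<in> \<Union>C" using C(1) CA by (auto simp: A_def intro: ideal_zero)
      show "a * y \<in> \<Union>C" if "y \<in> \<Union>C" for a y
        using that CA by (auto simp: A_def intro: ideal_mult)
      show "y + z \<in> \<Union>C" if yz: "y \<in> \<Union>C" "z \<in> \<Union>C" for y z
      proof -
        obtain Y Z where YZ: "Y \<in> C" "Z \<in> C" "y \<in> Y" "z \<in> Z" using yz by blast
        have "is_ideal Y" "is_ideal Z" using YZ CA by (auto simp: A_def)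
        then show ?thesis using tot[OF YZ(1,2)] YZ by (meson UnionI ideal_add subsetD)
      qed
    qed
    then show "\<Union>C \<in> A" using C(1) CA by (auto simp: A_def)
  qed
  then obtain M where M: "is_ideal M" "J \<subseteq> M" "\<And>n. x ^ n \<notin> M"
    and max: "\<And>X. is_ideal X \<Longrightarrow> M \<subseteq> X \<Longrightarrow> (\<And>n. x ^ n \<notin> X) \<Longrightarrow> X = M"
    by (auto simp: A_def)
  \<comment> \<open>Otherwise M enlarged by a would still miss all powers of x, against
    maximality.\<close>
  have grow: "\<exists>n m r. m \<in> M \<and> x ^ n = m + r * a" if a: "a \<notin> M" for a
  proof (rule ccontr)
    assume neg: "\<not> ?thesis"
    define X where "X = {m + r * a | m r. m \<in> M}"
    have "is_ideal X" unfolding is_ideal_def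
    proof (intro conjI ballI allI)
      show "0 \<in> X" unfolding X_def using ideal_zero[OF M(1)] by (auto intro!: exI[of _ 0])
      show "y + z \<in> X" if yz: "y \<in> X" "z \<in> X" for y z
      proof -
        obtain m r m' r' where "m \<in> M" "m' \<in> M" "y = m + r * a" "z = m' + r' * a"
          using yz by (auto simp: X_def)
        then have "m + m' \<in> M" "y + z = (m + m') + (r + r') * a"
          using ideal_add[OF M(1)] by (auto simp: algebra_simps)
        then show ?thesis unfolding X_def by blast
      qed
      show "b * y \<in> X" if y: "y \<in> X" for b y
      proof -
        obtain m r where "m \<in> M" "y = m + r * a" using y by (auto simp: X_def)
        moreover from this have "b * m \<in> M" by (intro ideal_mult[OF M(1)])
        moreover have "b * (m + r * a) = b * m + (b * r) * a" by (simp add: algebra_simps)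
        ultimately show ?thesis unfolding X_def by blast
      qed
    qed
    moreover have "m = m + 0 * a" for m by simp
    then have "M \<subseteq> X" unfolding X_def by blast
    moreover have "x ^ n \<notin> X" for n using neg by (auto simp: X_def)
    ultimately have "X = M" using max by blast
    moreover have "a = 0 + 1 * a" by simp
    then have "a \<in> X" unfolding X_def using ideal_zero[OF M(1)] by blast
    ultimately show False using a by blast
  qed
  have "is_prime_ideal M"
    unfolding is_prime_ideal_def
  proof (intro conjI allI impI)
    show "is_ideal M" by fact
    show "M \<noteq> UNIV" using M(3) by auto
    fix a b assume ab: "a * b \<in> M"
    show "a \<in> M \<or> b \<in> M"
    proof (rule ccontr)
      assume "\<not> ?thesis"
      then have "a \<notin> M" "b \<notin> M" by auto
      then obtain n m r n' m' r' where *: "m \<in> M" "x ^ n = m + r * a" "m' \<in> M" "x ^ n' = m' + r' * b"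
        using grow by blast
      have "x ^ (n + n') = (m' + r' * b) * m + ((r * a) * m' + (r * r') * (a * b))"
        unfolding power_add *(2) *(4) by (simp add: algebra_simps)
      also have "\<dots> \<in> M" using * ab M(1) by (simp add: ideal_add ideal_mult)
      finally show False using M(3) by blast
    qed
  qed
  moreover have "x \<notin> M" using M(3)[of 1] by simp
  ultimately show thesis using M(2) that by blast
qed

text \<open>More columns than rows force a dependency over the residue field of P; elimination
  without division proves this inside the ring. Applied to the zero ideal of a domain, it gives
  linear dependence over the fraction field.\<close>

lemma dependent_columns_mod_prime:
  fixes M :: "'r \<Rightarrow> 'c \<Rightarrow> 'a::comm_ring_1"
  assumes P: "is_prime_ideal P" and "finite R" "finite C" "card R < card C"
  shows "\<exists>y. (\<exists>c\<in>C. y c \<notin> P) \<and> (\<forall>r\<in>R. (\<Sum>c\<in>C. M r c * y c) \<in> P)"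
  using assms(2-)
proof (induction R arbitrary: C M rule: finite_induct)
  case empty
  then obtain c where "c \<in> C" by (metis card.empty ex_in_conv less_irrefl)
  then show ?case using prime_ideal_one[OF P] by (auto intro!: exI[of _ "\<lambda>_. 1"])
next
  case (insert r0 R)
  note Pi = prime_ideal_ideal[OF P]
  show ?case
  proof (cases "\<forall>c\<in>C. M r0 c \<in> P")
    case True
    obtain y where "\<exists>c\<in>C. y c \<notin> P" "\<forall>r\<in>R. (\<Sum>c\<in>C. M r c * y c) \<in> P"
      using insert.IH[of C M] insert.prems insert.hyps by auto
    moreover have "(\<Sum>c\<in>C. M r0 c * y c) \<in> P" using True
      by (intro ideal_sum[OF Pi] ideal_mult2[OF Pi]) auto
    ultimately show ?thesis by blast
  next
    case False
    then obtain c0 where c0: "c0 \<in> C" "M r0 c0 \<notin> P" by blast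
    define e where "e = M r0 c0"
    \<comment> \<open>Rows cleared in column c0 by the pivot e, multiplied through by e to avoid
      division.\<close>
    define M' where "M' = (\<lambda>r c. e * M r c - M r c0 * M r0 c)"
    have "finite (C - {c0})" "card R < card (C - {c0})" using insert c0 by auto
    then obtain y' c1 where c1: "c1 \<in> C - {c0}" "y' c1 \<notin> P"
      and y': "\<And>r. r \<in> R \<Longrightarrow> (\<Sum>c\<in>C - {c0}. M' r c * y' c) \<in> P"
      using insert.IH[of "C - {c0}" M'] by blast
    \<comment> \<open>Back substitution, scaled by e: row r0 is then solved exactly, and the other
      rows become rows of M'.\<close>
    define y where "y = (\<lambda>c. if c = c0 then - (\<Sum>c\<in>C - {c0}. M r0 c * y' c) else e * y' c)"
    have row: "(\<Sum>c\<in>C. M r c * y c) = (\<Sum>c\<in>C - {c0}. M' r c * y' c)" for r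
    proof -
      have "(\<Sum>c\<in>C. M r c * y c) = M r c0 * y c0 + (\<Sum>c\<in>C - {c0}. M r c * y c)"
        using insert.prems c0 by (simp add: sum.remove)
      also have "\<dots> = (\<Sum>c\<in>C - {c0}. M r c * (e * y' c)) - M r c0 * (\<Sum>c\<in>C - {c0}. M r0 c * y' c)"
        by (simp add: y_def)
      also have "\<dots> = (\<Sum>c\<in>C - {c0}. M' r c * y' c)"
        by (simp add: M'_def sum_distrib_left sum_subtractf[symmetric] algebra_simps)
      finally show ?thesis .
    qed
    have "(\<Sum>c\<in>C. M r c * y c) \<in> P" if "r \<in> insert r0 R" for r
    proof (cases "r = r0")
      case True
      have "M' r0 c = 0" for c by (simp add: M'_def e_def)
      then show ?thesis unfolding row True by (simp add: ideal_zero[OF Pi])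
    next
      case False then show ?thesis unfolding row using that y' by simp
    qed
    moreover have "y c1 \<notin> P" using c1 c0 prime_ideal_mult[OF P] by (simp add: y_def e_def)
    ultimately show ?thesis using c1 by blast
  qed
qed

section \<open>Polynomials and evaluation\<close>

definition is_ring_hom :: "('a::comm_ring_1 \<Rightarrow> 'b::comm_ring_1) \<Rightarrow> bool" where
  "is_ring_hom h \<longleftrightarrow> h 1 = 1 \<and> (\<forall>x y. h (x + y) = h x + h y) \<and> (\<forall>x y. h (x * y) = h x * h y)"

lemma is_ring_homD:
  assumes "is_ring_hom h"
  shows ring_hom_one: "h 1 = 1" and ring_hom_add: "h (x + y) = h x + h y"
    and ring_hom_mult: "h (x * y) = h x * h y"
  using assms by (auto simp: is_ring_hom_def)

lemma ring_hom_zero: "is_ring_hom h \<Longrightarrow> h 0 = 0"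
  using ring_hom_add[of h 0 0] by simp

lemma ring_hom_uminus: "is_ring_hom h \<Longrightarrow> h (- x) = - h x"
  using ring_hom_add[of h x "-x"] by (simp add: ring_hom_zero eq_neg_iff_add_eq_0 add.commute)

lemma ring_hom_diff: "is_ring_hom h \<Longrightarrow> h (x - y) = h x - h y"
  using ring_hom_add[of h x "-y"] by (simp add: ring_hom_uminus)

lemma ring_hom_sum: "is_ring_hom h \<Longrightarrow> h (sum g A) = (\<Sum>i\<in>A. h (g i))"
  by (induction A rule: infinite_finite_induct) (auto simp: ring_hom_zero ring_hom_add)

lemma ring_hom_prod: "is_ring_hom h \<Longrightarrow> h (prod g A) = (\<Prod>i\<in>A. h (g i))"
  by (induction A rule: infinite_finite_induct) (auto simp: ring_hom_one ring_hom_mult)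

lemma ring_hom_power: "is_ring_hom h \<Longrightarrow> h (x ^ n) = h x ^ n"
  by (induction n) (auto simp: ring_hom_one ring_hom_mult)

lemma ring_hom_id: "is_ring_hom (\<lambda>x. x)"
  by (simp add: is_ring_hom_def)

section \<open>Additive maps on finitely supported functions, and induction on polynomials\<close>

definition pm_extend :: "('a \<Rightarrow> 'b::comm_monoid_add \<Rightarrow> 'c::comm_monoid_add) \<Rightarrow> ('a \<Rightarrow>\<^sub>0 'b) \<Rightarrow> 'c" where
  "pm_extend h p = (\<Sum>a\<in>Poly_Mapping.keys p. h a (Poly_Mapping.lookup p a))"

lemma pm_extend_superset:
  assumes "finite A" "Poly_Mapping.keys p \<subseteq> A" "\<And>a. h a 0 = 0"
  shows "pm_extend h p = (\<Sum>a\<in>A. h a (Poly_Mapping.lookup p a))"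
  unfolding pm_extend_def using assms by (intro sum.mono_neutral_left) (auto simp: in_keys_iff)

lemma pm_extend_single:
  assumes "\<And>a. h a 0 = 0"
  shows "pm_extend h (Poly_Mapping.single a c) = h a c"
  using pm_extend_superset[of "{a}" "Poly_Mapping.single a c" h] assms by auto

lemma pm_extend_add:
  assumes "\<And>a. h a 0 = 0" "\<And>a c d. h a (c + d) = h a c + h a d"
  shows "pm_extend h (p + q) = pm_extend h p + pm_extend h q"
proof -
  define A where "A = Poly_Mapping.keys p \<union> Poly_Mapping.keys q"
  have "finite A" "Poly_Mapping.keys p \<subseteq> A" "Poly_Mapping.keys q \<subseteq> A" "Poly_Mapping.keys (p + q) \<subseteq> A"
    using keys_add[of p q] by (auto simp: A_def)
  then show ?thesis
    using assms by (simp add: pm_extend_superset[of A] lookup_add sum.distrib)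
qed

lemma poly_mapping_induct [case_names single add]:
  fixes p :: "'a \<Rightarrow>\<^sub>0 'b::comm_monoid_add"
  assumes single: "\<And>a c. P (Poly_Mapping.single a c)" and add: "\<And>p q. P p \<Longrightarrow> P q \<Longrightarrow> P (p + q)"
  shows "P p"
proof -
  have zero: "P 0" using single[of undefined 0] by simp
  have "P (\<Sum>a\<in>A. Poly_Mapping.single a (Poly_Mapping.lookup p a))" if "finite A" for A
    using that by induction (auto intro: zero single add)
  moreover have "p = (\<Sum>a\<in>Poly_Mapping.keys p. Poly_Mapping.single a (Poly_Mapping.lookup p a))"
    by (rule poly_mapping_eqI) (auto simp: lookup_sum lookup_single when_def in_keys_iff sum.delta)
  ultimately show ?thesis by (metis finite_keys)
qed

definition pconst :: "'b::comm_ring_1 \<Rightarrow> ('a::comm_monoid_add \<Rightarrow>\<^sub>0 'b)" where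
  "pconst c = Poly_Mapping.single 0 c"

definition pvar :: "'v \<Rightarrow> (('v \<Rightarrow>\<^sub>0 nat) \<Rightarrow>\<^sub>0 'b::comm_ring_1)" where
  "pvar l = Poly_Mapping.single (Poly_Mapping.single l 1) 1"

lemma pconst_hom: "is_ring_hom pconst"
  by (auto simp: is_ring_hom_def pconst_def single_add mult_single)

lemma pconst_0 [simp]: "pconst 0 = 0" and pconst_1 [simp]: "pconst 1 = 1"
  by (simp_all add: pconst_def)

lemma pconst_mult_single: "pconst c * Poly_Mapping.single a d = Poly_Mapping.single a (c * d)"
  by (simp add: pconst_def mult_single)

lemma lookup_pconst_mult: "Poly_Mapping.lookup (pconst c * p) a = c * Poly_Mapping.lookup p a"
  by (induction p rule: poly_mapping_induct)
    (auto simp: pconst_mult_single lookup_single when_def lookup_add algebra_simps)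

lemma lookup_pvar_mult:
  "Poly_Mapping.lookup (pvar l * p) a
    = (if 0 < Poly_Mapping.lookup a l then Poly_Mapping.lookup p (a - Poly_Mapping.single l 1) else 0)"
proof (induction p rule: poly_mapping_induct)
  case (single b c)
  have "Poly_Mapping.single l 1 + b = a \<longleftrightarrow> 0 < Poly_Mapping.lookup a l \<and> b = a - Poly_Mapping.single l 1"
  proof
    assume *: "Poly_Mapping.single l 1 + b = a"
    then have "Poly_Mapping.lookup a l = 1 + Poly_Mapping.lookup b l" by (auto simp: lookup_add)
    then show "0 < Poly_Mapping.lookup a l \<and> b = a - Poly_Mapping.single l 1" using * by auto
  next
    assume "0 < Poly_Mapping.lookup a l \<and> b = a - Poly_Mapping.single l 1"
    then show "Poly_Mapping.single l 1 + b = a"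
      by (intro poly_mapping_eqI) (auto simp: lookup_add lookup_minus lookup_single when_def)
  qed
  then show ?case by (auto simp: pvar_def mult_single lookup_single when_def)
next
  case (add p q) then show ?case by (simp add: algebra_simps lookup_add)
qed

lemma single_left_inj: "inj (\<lambda>l. Poly_Mapping.single l (Suc 0))"
proof (rule injI)
  fix l l' :: 'a
  assume "Poly_Mapping.single l (Suc 0) = Poly_Mapping.single l' (Suc 0)"
  then have "Poly_Mapping.keys (Poly_Mapping.single l (Suc 0)) = Poly_Mapping.keys (Poly_Mapping.single l' (Suc 0))"
    by (rule arg_cong)
  then show "l = l'" by simp
qed

lemma pvar_mult_single:
  "pvar l * Poly_Mapping.single a c = Poly_Mapping.single (Poly_Mapping.single l 1 + a) c"
  by (simp add: pvar_def mult_single)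

lemma polynomial_induct [case_names const var add mult]:
  fixes p :: "('v \<Rightarrow>\<^sub>0 nat) \<Rightarrow>\<^sub>0 'b::comm_ring_1"
  assumes const: "\<And>c. P (pconst c)" and var: "\<And>l. P (pvar l)"
    and add: "\<And>p q. P p \<Longrightarrow> P q \<Longrightarrow> P (p + q)" and mult: "\<And>p q. P p \<Longrightarrow> P q \<Longrightarrow> P (p * q)"
  shows "P p"
proof (induction p rule: poly_mapping_induct)
  case (single a c)
  have "P (Poly_Mapping.single a 1)"
  proof (induction a rule: poly_mapping_induct)
    case (single l n)
    show ?case
    proof (induction n)
      case 0 then show ?case using const[of 1] by simp
    next
      case (Suc n)
      have "pvar l * Poly_Mapping.single (Poly_Mapping.single l n) 1
          = (Poly_Mapping.single (Poly_Mapping.single l (Suc n)) 1 :: ('v \<Rightarrow>\<^sub>0 nat) \<Rightarrow>\<^sub>0 'b)"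
        by (simp add: pvar_mult_single single_add[symmetric])
      then show ?case using mult[OF var Suc] by metis
    qed
  next
    case (add a b) then show ?case using mult[OF add] by (simp add: mult_single)
  qed
  then have "P (pconst c * Poly_Mapping.single a 1)" by (rule mult[OF const])
  then show ?case by (simp add: pconst_mult_single)
next
  case (add p q) then show ?case by (rule assms(3))
qed

section \<open>Evaluation homomorphisms\<close>

definition monom_eval :: "('v \<Rightarrow> 'c::comm_ring_1) \<Rightarrow> ('v \<Rightarrow>\<^sub>0 nat) \<Rightarrow> 'c" where
  "monom_eval y a = (\<Prod>l\<in>Poly_Mapping.keys a. y l ^ Poly_Mapping.lookup a l)"

lemma monom_eval_superset:
  assumes "finite A" "Poly_Mapping.keys a \<subseteq> A"
  shows "monom_eval y a = (\<Prod>l\<in>A. y l ^ Poly_Mapping.lookup a l)"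
  unfolding monom_eval_def using assms by (intro prod.mono_neutral_left) (auto simp: in_keys_iff)

lemma monom_eval_add: "monom_eval y (a + b) = monom_eval y a * monom_eval y b"
proof -
  define A where "A = Poly_Mapping.keys a \<union> Poly_Mapping.keys b"
  have "finite A" "Poly_Mapping.keys a \<subseteq> A" "Poly_Mapping.keys b \<subseteq> A" "Poly_Mapping.keys (a + b) \<subseteq> A"
    using keys_add[of a b] by (auto simp: A_def)
  then show ?thesis
    by (simp add: monom_eval_superset[of A] lookup_add power_add prod.distrib)
qed

lemma monom_eval_single [simp]: "monom_eval y (Poly_Mapping.single l n) = y l ^ n"
  using monom_eval_superset[of "{l}" "Poly_Mapping.single l n" y] by auto

lemma monom_eval_zero [simp]: "monom_eval y 0 = 1"
  by (simp add: monom_eval_def)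

definition poly_eval :: "('b::comm_ring_1 \<Rightarrow> 'c::comm_ring_1) \<Rightarrow> ('v \<Rightarrow> 'c) \<Rightarrow> (('v \<Rightarrow>\<^sub>0 nat) \<Rightarrow>\<^sub>0 'b) \<Rightarrow> 'c" where
  "poly_eval h y = pm_extend (\<lambda>a c. h c * monom_eval y a)"

context
  fixes h :: "'b::comm_ring_1 \<Rightarrow> 'c::comm_ring_1"
  assumes h: "is_ring_hom h"
begin

lemma poly_eval_single: "poly_eval h y (Poly_Mapping.single a c) = h c * monom_eval y a"
  unfolding poly_eval_def using h by (subst pm_extend_single) (auto simp: ring_hom_zero)

lemma poly_eval_add: "poly_eval h y (p + q) = poly_eval h y p + poly_eval h y q"
  unfolding poly_eval_def using h
  by (subst pm_extend_add) (auto simp: ring_hom_zero ring_hom_add algebra_simps)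

lemma poly_eval_hom: "is_ring_hom (poly_eval h y)"
proof -
  have "poly_eval h y (p * q) = poly_eval h y p * poly_eval h y q" for p q
  proof (induction p rule: poly_mapping_induct)
    case (single a c)
    show ?case
      by (induction q rule: poly_mapping_induct)
        (simp_all add: mult_single poly_eval_single poly_eval_add monom_eval_add ring_hom_mult[OF h] algebra_simps)
  next
    case (add p p') then show ?case by (simp add: poly_eval_add algebra_simps)
  qed
  moreover have "poly_eval h y 1 = 1"
    using poly_eval_single[of y 0 1] ring_hom_one[OF h] by simp
  ultimately show ?thesis by (simp add: is_ring_hom_def poly_eval_add)
qed

lemma poly_eval_const [simp]: "poly_eval h y (pconst c) = h c"
  by (simp add: pconst_def poly_eval_single)

lemma poly_eval_var [simp]: "poly_eval h y (pvar l) = y l"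
  using poly_eval_single[of y "Poly_Mapping.single l 1" 1] ring_hom_one[OF h] by (simp add: pvar_def)

end

section \<open>Embeddings of polynomial rings and absence of zero divisors\<close>

definition pm_map :: "('a \<Rightarrow> 'd) \<Rightarrow> ('b::comm_ring_1 \<Rightarrow> 'c::comm_ring_1) \<Rightarrow> ('a \<Rightarrow>\<^sub>0 'b) \<Rightarrow> ('d \<Rightarrow>\<^sub>0 'c)" where
  "pm_map h g = pm_extend (\<lambda>a c. Poly_Mapping.single (h a) (g c))"

lemma pm_map_embedding:
  fixes h :: "'a::comm_monoid_add \<Rightarrow> 'd::cancel_comm_monoid_add"
    and g :: "'b::comm_ring_1 \<Rightarrow> 'c::comm_ring_1"
  assumes h: "\<And>a b. h (a + b) = h a + h b" "inj h" and g: "is_ring_hom g" "inj g"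
  shows "is_ring_hom (pm_map h g)" "inj (pm_map h g)"
proof -
  have h0: "h 0 = 0" using h(1)[of 0 0] by simp
  have single': "pm_map h g (Poly_Mapping.single a c) = Poly_Mapping.single (h a) (g c)" for a c
    unfolding pm_map_def by (subst pm_extend_single) (auto simp: ring_hom_zero[OF g(1)])
  have add': "pm_map h g (p + q) = pm_map h g p + pm_map h g q" for p q
    unfolding pm_map_def
    by (subst pm_extend_add) (auto simp: ring_hom_zero[OF g(1)] ring_hom_add[OF g(1)] single_add)
  have mult': "pm_map h g (p * q) = pm_map h g p * pm_map h g q" for p q
  proof (induction p rule: poly_mapping_induct)
    case (single a c)
    show ?case
      by (induction q rule: poly_mapping_induct)
        (simp_all add: mult_single single' add' h(1) ring_hom_mult[OF g(1)] algebra_simps)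
  next
    case (add p p') then show ?case by (simp add: add' algebra_simps)
  qed
  have one': "pm_map h g 1 = 1"
    using single'[of 0 1] by (simp add: h0 ring_hom_one[OF g(1)])
  show "is_ring_hom (pm_map h g)" by (simp add: is_ring_hom_def add' mult' one')
  have "Poly_Mapping.lookup (pm_map h g p) (h a) = g (Poly_Mapping.lookup p a)" for p a
    by (induction p rule: poly_mapping_induct)
      (auto simp: single' add' lookup_add ring_hom_add[OF g(1)] lookup_single when_def
        ring_hom_zero[OF g(1)] dest: injD[OF h(2)])
  then show "inj (pm_map h g)"
    by (intro injI poly_mapping_eqI) (metis injD[OF g(2)])
qed

lemma embedding_no_zero_divisors:
  fixes g :: "'a::comm_ring_1 \<Rightarrow> 'b::idom" and x y :: 'a
  assumes "is_ring_hom g" "inj g" "x * y = 0"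
  shows "x = 0 \<or> y = 0"
proof -
  have "g x * g y = 0" using assms by (metis ring_hom_mult ring_hom_zero)
  then have "g x = g 0 \<or> g y = g 0" by (simp add: ring_hom_zero[OF assms(1)])
  then show ?thesis using injD[OF assms(2)] by blast
qed

text \<open>Numbering the variables embeds the monomials additively into those with variables in
  \<open>nat\<close>. These carry a total order compatible with addition, by which polynomials over
  a domain form a domain.\<close>

definition rename_vars :: "('v::finite \<Rightarrow>\<^sub>0 nat) \<Rightarrow> (nat \<Rightarrow>\<^sub>0 nat)" where
  "rename_vars = (let e = (SOME e :: 'v \<Rightarrow> nat. inj e) in
     (\<lambda>a. \<Sum>v\<in>UNIV. Poly_Mapping.single (e v) (Poly_Mapping.lookup a v)))"

lemma rename_vars: "rename_vars (a + b) = rename_vars a + rename_vars b" "inj rename_vars"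
proof -
  define e where "e = (SOME e :: 'v::finite \<Rightarrow> nat. inj e)"
  have "\<exists>e :: 'v \<Rightarrow> nat. inj e" using finite_imp_inj_to_nat_seg[of "UNIV :: 'v set"] by auto
  then have e: "inj e" unfolding e_def by (rule someI_ex)
  have r: "rename_vars = (\<lambda>a. \<Sum>v\<in>UNIV. Poly_Mapping.single (e v) (Poly_Mapping.lookup a v))"
    by (simp add: rename_vars_def Let_def e_def)
  show "rename_vars (a + b) = rename_vars a + rename_vars b" for a b :: "'v \<Rightarrow>\<^sub>0 nat"
    by (simp add: r lookup_add single_add sum.distrib)
  have "Poly_Mapping.lookup (rename_vars a) (e v) = Poly_Mapping.lookup a v" for a v
    using inj_eq[OF e] by (simp add: r lookup_sum lookup_single when_def)
  then show "inj (rename_vars :: ('v \<Rightarrow>\<^sub>0 nat) \<Rightarrow> _)"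
    by (intro injI poly_mapping_eqI) metis
qed

lemma mpoly_no_zero_divisors:
  fixes p q :: "('v::finite, 'k::idom) mpoly"
  assumes "p * q = 0"
  shows "p = 0 \<or> q = 0"
proof (rule embedding_no_zero_divisors)
  show "is_ring_hom (pm_map rename_vars (\<lambda>x. x) :: ('v, 'k) mpoly \<Rightarrow> _)"
    "inj (pm_map rename_vars (\<lambda>x. x) :: ('v, 'k) mpoly \<Rightarrow> _)"
    by (rule pm_map_embedding; simp add: rename_vars ring_hom_id)+
qed fact

lemma mpoly_poly_no_zero_divisors:
  fixes p q :: "(nat \<Rightarrow>\<^sub>0 nat) \<Rightarrow>\<^sub>0 ('v::finite, 'k::idom) mpoly"
  assumes "p * q = 0"
  shows "p = 0 \<or> q = 0"
proof (rule embedding_no_zero_divisors)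
  have *: "is_ring_hom (pm_map rename_vars (\<lambda>x. x) :: ('v, 'k) mpoly \<Rightarrow> _)"
    "inj (pm_map rename_vars (\<lambda>x. x) :: ('v, 'k) mpoly \<Rightarrow> _)"
    by (rule pm_map_embedding; simp add: rename_vars ring_hom_id)+
  show "is_ring_hom (pm_map (\<lambda>x. x) (pm_map rename_vars (\<lambda>x. x)) :: ((nat \<Rightarrow>\<^sub>0 nat) \<Rightarrow>\<^sub>0 ('v, 'k) mpoly) \<Rightarrow> _)"
    "inj (pm_map (\<lambda>x. x) (pm_map rename_vars (\<lambda>x. x)) :: ((nat \<Rightarrow>\<^sub>0 nat) \<Rightarrow>\<^sub>0 ('v, 'k) mpoly) \<Rightarrow> _)"
    by (rule pm_map_embedding; simp add: *)+
qed fact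

section \<open>Total degree, linear forms and scaling of the variables\<close>

definition tdeg :: "('v \<Rightarrow>\<^sub>0 nat) \<Rightarrow> nat" where
  "tdeg a = (\<Sum>l\<in>Poly_Mapping.keys a. Poly_Mapping.lookup a l)"

lemma tdeg_superset:
  assumes "finite A" "Poly_Mapping.keys a \<subseteq> A"
  shows "tdeg a = (\<Sum>l\<in>A. Poly_Mapping.lookup a l)"
  unfolding tdeg_def using assms by (intro sum.mono_neutral_left) (auto simp: in_keys_iff)

lemma tdeg_add: "tdeg (a + b) = tdeg a + tdeg b"
proof -
  define A where "A = Poly_Mapping.keys a \<union> Poly_Mapping.keys b"
  have "finite A" "Poly_Mapping.keys a \<subseteq> A" "Poly_Mapping.keys b \<subseteq> A" "Poly_Mapping.keys (a + b) \<subseteq> A"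
    using keys_add[of a b] by (auto simp: A_def)
  then show ?thesis by (simp add: tdeg_superset[of A] lookup_add sum.distrib)
qed

lemma tdeg_single [simp]: "tdeg (Poly_Mapping.single l n) = n"
  using tdeg_superset[of "{l}" "Poly_Mapping.single l n"] by auto

lemma monom_eval_smult: "monom_eval (\<lambda>l. c * y l) a = c ^ tdeg a * monom_eval y a"
  by (simp add: monom_eval_def tdeg_def power_mult_distrib prod.distrib power_sum)

lemma monom_eval_pvar: "monom_eval pvar a = (Poly_Mapping.single a 1 :: ('v \<Rightarrow>\<^sub>0 nat) \<Rightarrow>\<^sub>0 'b::comm_ring_1)"
proof (induction a rule: poly_mapping_induct)
  case (single l n)
  have "pvar l ^ n = (Poly_Mapping.single (Poly_Mapping.single l n) 1 :: ('v \<Rightarrow>\<^sub>0 nat) \<Rightarrow>\<^sub>0 'b)"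
    by (induction n) (simp_all add: pvar_mult_single single_add[symmetric])
  then show ?case by simp
next
  case (add a b) then show ?case by (simp add: monom_eval_add mult_single)
qed

definition lin_form :: "nat \<Rightarrow> (nat \<Rightarrow> 'b::comm_ring_1) \<Rightarrow> (nat \<Rightarrow>\<^sub>0 nat) \<Rightarrow>\<^sub>0 'b" where
  "lin_form r a = (\<Sum>l<r. pconst (a l) * pvar l)"

lemma lin_form_eval: "is_ring_hom h \<Longrightarrow> poly_eval h y (lin_form r a) = (\<Sum>l<r. h (a l) * y l)"
  by (simp add: lin_form_def ring_hom_sum[OF poly_eval_hom] ring_hom_mult[OF poly_eval_hom])

lemma lookup_lin_form:
  "l < r \<Longrightarrow> Poly_Mapping.lookup (lin_form r a) (Poly_Mapping.single l 1) = a l"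
proof -
  assume "l < r"
  have "Poly_Mapping.lookup (lin_form r a) (Poly_Mapping.single l 1) = (\<Sum>i<r. a i when i = l)"
    unfolding lin_form_def lookup_sum lookup_pconst_mult
    by (rule sum.cong) (auto simp: pvar_def lookup_single when_def inj_eq[OF single_left_inj])
  then show ?thesis using \<open>l < r\<close> by (simp add: when_def)
qed

lemma lin_form_smult: "pconst c * lin_form r a = lin_form r (\<lambda>l. c * a l)"
  by (simp add: lin_form_def sum_distrib_left ring_hom_mult[OF pconst_hom] mult_ac)

lemma lin_form_sum: "(\<Sum>i\<in>A. lin_form r (a i)) = lin_form r (\<lambda>l. \<Sum>i\<in>A. a i l)"
  unfolding lin_form_def by (subst sum.swap) (simp add: ring_hom_sum[OF pconst_hom] sum_distrib_right)

lemma lin_form_cong: "(\<And>l. l < r \<Longrightarrow> a l = b l) \<Longrightarrow> lin_form r a = lin_form r b"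
  by (simp add: lin_form_def)

text \<open>Scaling by the degree defect inverts, up to a power of c, the substitution of
  c t for t, and it is compatible with multiplication by linear forms.\<close>

definition degree_scale :: "'b::comm_ring_1 \<Rightarrow> nat \<Rightarrow> ((nat \<Rightarrow>\<^sub>0 nat) \<Rightarrow>\<^sub>0 'b) \<Rightarrow> (nat \<Rightarrow>\<^sub>0 nat) \<Rightarrow>\<^sub>0 'b" where
  "degree_scale c n = pm_extend (\<lambda>a e. Poly_Mapping.single a (c ^ (n - tdeg a) * e))"

lemma degree_scale_single:
  "degree_scale c n (Poly_Mapping.single a e) = Poly_Mapping.single a (c ^ (n - tdeg a) * e)"
  unfolding degree_scale_def by (subst pm_extend_single) auto

lemma degree_scale_add: "degree_scale c n (p + q) = degree_scale c n p + degree_scale c n q"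
  unfolding degree_scale_def by (subst pm_extend_add) (auto simp: algebra_simps single_add)

lemma degree_scale_sum: "degree_scale c n (sum g A) = (\<Sum>i\<in>A. degree_scale c n (g i))"
proof -
  have "degree_scale c n 0 = 0" using degree_scale_single[of c n 0 0] by simp
  then show ?thesis
    by (induction A rule: infinite_finite_induct) (auto simp: degree_scale_add)
qed

text \<open>A linear form raises every degree by one, so raising n by one leaves each defect, even a
  truncated one, unchanged.\<close>

lemma degree_scale_lin_form:
  "degree_scale c (Suc n) (lin_form r a * p) = lin_form r a * degree_scale c n p"
proof (induction p rule: poly_mapping_induct)
  case (single b e)
  have "degree_scale c (Suc n) (pconst (a l) * pvar l * Poly_Mapping.single b e)
      = pconst (a l) * pvar l * degree_scale c n (Poly_Mapping.single b e)" for l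
    unfolding mult.assoc pvar_mult_single pconst_mult_single degree_scale_single
    by (simp add: tdeg_add mult_ac)
  then show ?case
    by (simp add: lin_form_def sum_distrib_right degree_scale_sum)
next
  case (add p q) then show ?case by (simp add: degree_scale_add algebra_simps)
qed

text \<open>Each n above all degrees in p works: the substitution multiplies a term of degree d by
  c^d, and the scaling supplies the missing c^(n - d). Smaller n would meet truncated
  subtraction.\<close>

lemma degree_scale_substitution:
  "\<exists>n0. \<forall>n\<ge>n0. degree_scale c n (poly_eval pconst (\<lambda>l. pconst c * pvar l) p) = pconst (c ^ n) * p"
proof (induction p rule: poly_mapping_induct)
  case (single a e)
  have "poly_eval pconst (\<lambda>l. pconst c * pvar l) (Poly_Mapping.single a e)
      = Poly_Mapping.single a (e * c ^ tdeg a)"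
    by (simp add: poly_eval_single[OF pconst_hom] monom_eval_smult monom_eval_pvar
        ring_hom_power[OF pconst_hom, symmetric] pconst_mult_single)
  then have "degree_scale c n (poly_eval pconst (\<lambda>l. pconst c * pvar l) (Poly_Mapping.single a e))
      = pconst (c ^ n) * Poly_Mapping.single a e" if "n \<ge> tdeg a" for n
  proof -
    have "c ^ (n - tdeg a) * (e * c ^ tdeg a) = (c ^ (n - tdeg a) * c ^ tdeg a) * e"
      by (simp only: mult_ac)
    also have "\<dots> = c ^ n * e" using that by (simp add: power_add[symmetric])
    finally show ?thesis
      unfolding \<open>poly_eval _ _ _ = _\<close> degree_scale_single pconst_mult_single by simp
  qed
  then show ?case by blast
next
  case (add p q)
  then obtain m n where
    "\<forall>k\<ge>m. degree_scale c k (poly_eval pconst (\<lambda>l. pconst c * pvar l) p) = pconst (c ^ k) * p"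
    "\<forall>k\<ge>n. degree_scale c k (poly_eval pconst (\<lambda>l. pconst c * pvar l) q) = pconst (c ^ k) * q" by blast
  then show ?case
    by (intro exI[of _ "max m n"]) (auto simp: poly_eval_add[OF pconst_hom] degree_scale_add algebra_simps)
qed

section \<open>Linear forms up to elements outside a prime\<close>

lemma ring_hom_set_ideal_zero:
  assumes "is_ring_hom h" "\<And>i. i \<in> E \<Longrightarrow> h (c i) = 0" "z \<in> set_ideal c E"
  shows "h z = 0"
  using assms by (auto simp: set_ideal_def ring_hom_sum ring_hom_mult)

lemma lookup_lin_form_mult:
  assumes "l < r"
  shows "Poly_Mapping.lookup (lin_form r a * p) (Poly_Mapping.single l 1) = a l * Poly_Mapping.lookup p 0"
proof -
  have "Poly_Mapping.lookup (lin_form r a * p) (Poly_Mapping.single l 1)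
      = (\<Sum>i<r. a i * Poly_Mapping.lookup p 0 when i = l)"
    unfolding lin_form_def sum_distrib_right lookup_sum mult.assoc lookup_pconst_mult lookup_pvar_mult
    by (rule sum.cong) (auto simp: lookup_single when_def)
  then show ?thesis using assms by (simp add: when_def)
qed

text \<open>Absence of zero divisors is a locale assumption for the ring and for the polynomials
  over it; \<open>mpoly_no_zero_divisors\<close> and \<open>mpoly_poly_no_zero_divisors\<close> will
  supply both.\<close>

locale poly_prime =
  fixes P :: "'b::comm_ring_1 set"
  assumes prime: "is_prime_ideal P"
    and dom: "\<And>x y :: 'b. x * y = 0 \<Longrightarrow> x = 0 \<or> y = 0"
    and poly_dom: "\<And>x y :: (nat \<Rightarrow>\<^sub>0 nat) \<Rightarrow>\<^sub>0 'b. x * y = 0 \<Longrightarrow> x = 0 \<or> y = 0"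
begin

lemma notin_nonzero: "v \<notin> P \<Longrightarrow> v \<noteq> 0"
  using ideal_zero[OF prime_ideal_ideal[OF prime]] by auto

lemma notin_mult: "v \<notin> P \<Longrightarrow> w \<notin> P \<Longrightarrow> v * w \<notin> P"
  by (rule prime_ideal_mult[OF prime])

lemma notin_power: "v \<notin> P \<Longrightarrow> v ^ n \<notin> P"
  by (induction n) (simp_all add: notin_mult prime_ideal_one[OF prime])

lemma power_eq_zero: "x ^ n = (0::'b) \<Longrightarrow> x = 0"
proof (induction n)
  case 0 then show ?case using notin_nonzero[OF prime_ideal_one[OF prime]] by simp
next
  case (Suc n) then show ?case using dom[of x "x ^ n"] by auto
qed

end

text \<open>Up to the factor w, the columns of M indexed by D form a basis of the linear forms.\<close>

locale coordinates = poly_prime P for P :: "'b::comm_ring_1 set" +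
  fixes M :: "nat \<Rightarrow> nat \<Rightarrow> 'b" and N :: "nat \<Rightarrow> nat \<Rightarrow> 'b" and r :: nat and w :: 'b and D :: "nat set"
  assumes finD: "finite D" and wP: "w \<notin> P"
    and MN: "\<And>l l'. l < r \<Longrightarrow> l' < r \<Longrightarrow> (\<Sum>d\<in>D. M l' d * N d l) = (if l' = l then w else 0)"
    and NM: "\<And>d d'. d \<in> D \<Longrightarrow> d' \<in> D \<Longrightarrow> (\<Sum>l<r. N d l * M l d') = (if d = d' then w else 0)"
begin

definition col :: "nat \<Rightarrow> (nat \<Rightarrow>\<^sub>0 nat) \<Rightarrow>\<^sub>0 'b" where
  "col d = lin_form r (\<lambda>l. M l d)"

text \<open>Since w t_l is the sum of the N d l times column d over D, this is w times the
  projection that kills the columns in E. Variables from r on are multiplied by w to match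
  \<open>scale\<close>.\<close>

definition proj :: "nat set \<Rightarrow> ((nat \<Rightarrow>\<^sub>0 nat) \<Rightarrow>\<^sub>0 'b) \<Rightarrow> (nat \<Rightarrow>\<^sub>0 nat) \<Rightarrow>\<^sub>0 'b" where
  "proj E = poly_eval pconst (\<lambda>l. if l < r then \<Sum>d\<in>D - E. pconst (N d l) * col d else pconst w * pvar l)"

abbreviation scale :: "((nat \<Rightarrow>\<^sub>0 nat) \<Rightarrow>\<^sub>0 'b) \<Rightarrow> (nat \<Rightarrow>\<^sub>0 nat) \<Rightarrow>\<^sub>0 'b" where
  "scale \<equiv> poly_eval pconst (\<lambda>l. pconst w * pvar l)"

lemma proj_hom: "is_ring_hom (proj E)"
  unfolding proj_def by (rule poly_eval_hom[OF pconst_hom])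

lemma proj_lin_form:
  "proj E (lin_form r a) = (\<Sum>d\<in>D - E. pconst (\<Sum>l<r. N d l * a l) * col d)"
proof -
  have "proj E (lin_form r a) = (\<Sum>l<r. pconst (a l) * (\<Sum>d\<in>D - E. pconst (N d l) * col d))"
    unfolding proj_def lin_form_eval[OF pconst_hom] by (intro sum.cong) auto
  also have "\<dots> = (\<Sum>d\<in>D - E. \<Sum>l<r. pconst (a l) * (pconst (N d l) * col d))"
    unfolding sum_distrib_left by (rule sum.swap)
  also have "\<dots> = (\<Sum>d\<in>D - E. pconst (\<Sum>l<r. N d l * a l) * col d)"
    by (simp add: ring_hom_sum[OF pconst_hom] ring_hom_mult[OF pconst_hom] sum_distrib_right
        sum_distrib_left mult_ac)
  finally show ?thesis .
qed

lemma proj_col: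
  assumes "d \<in> D"
  shows "proj E (col d) = (if d \<in> E then 0 else pconst w * col d)"
proof -
  have "proj E (col d) = (\<Sum>d'\<in>D - E. if d' = d then pconst w * col d else 0)"
    unfolding col_def[of d] proj_lin_form using NM assms by (intro sum.cong) (auto simp: col_def)
  then show ?thesis using assms finD by (simp add: sum.delta)
qed

lemma pconst_w_pvar: "l < r \<Longrightarrow> pconst w * pvar l = (\<Sum>d\<in>D. pconst (N d l) * col d)"
proof -
  assume l: "l < r"
  have "(\<Sum>d\<in>D. pconst (N d l) * col d) = lin_form r (\<lambda>l'. \<Sum>d\<in>D. M l' d * N d l)"
    unfolding col_def lin_form_smult lin_form_sum by (simp add: mult.commute)
  also have "\<dots> = (\<Sum>l'<r. if l' = l then pconst w * pvar l else 0)"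
    unfolding lin_form_def using MN[OF l] by (intro sum.cong) auto
  finally show ?thesis using l by simp
qed

text \<open>On a variable the difference is the part of its expansion along E. Both substitutions
  are ring homomorphisms, so agreement modulo an ideal passes to sums and products.\<close>

lemma scale_minus_proj:
  assumes E: "E \<subseteq> D"
  shows "scale z - proj E z \<in> set_ideal col E"
proof (induction z rule: polynomial_induct)
  case (const c)
  show ?case by (simp add: proj_def poly_eval_const[OF pconst_hom] set_ideal_zero)
next
  case (var l)
  show ?case
  proof (cases "l < r")
    case True
    have "(\<Sum>d\<in>D. pconst (N d l) * col d) - (\<Sum>d\<in>D - E. pconst (N d l) * col d)
        = (\<Sum>d\<in>E. pconst (N d l) * col d)"
      using E finD by (simp add: sum_diff)
    then have "scale (pvar l) - proj E (pvar l) = (\<Sum>d\<in>E. pconst (N d l) * col d)"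
      using True pconst_w_pvar by (simp add: proj_def poly_eval_var[OF pconst_hom])
    then show ?thesis
      using E finD finite_subset by (auto intro!: set_ideal_sum set_ideal_mult set_ideal_gen)
  qed (simp add: proj_def poly_eval_var[OF pconst_hom] set_ideal_zero)
next
  case (add p q)
  have "scale (p + q) - proj E (p + q) = (scale p - proj E p) + (scale q - proj E q)"
    by (simp add: poly_eval_add[OF pconst_hom] ring_hom_add[OF proj_hom])
  then show ?case using set_ideal_add[OF add] by simp
next
  case (mult p q)
  have "scale (p * q) - proj E (p * q) = scale p * (scale q - proj E q) + (scale p - proj E p) * proj E q"
    by (simp add: ring_hom_mult[OF poly_eval_hom[OF pconst_hom]] ring_hom_mult[OF proj_hom] algebra_simps)
  then show ?case using set_ideal_add[OF set_ideal_mult[OF mult(2)] set_ideal_mult2[OF mult(1)]] by simp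
qed

text \<open>Vanishing under \<open>proj\<close> puts z(w t) into the ideal;
  \<open>degree_scale\<close> turns z(w t) back into a power of w times z and carries multiples of
  the linear columns to such multiples.\<close>

lemma proj_zeroD:
  assumes E: "E \<subseteq> D" and "proj E z = 0"
  shows "\<exists>v. v \<notin> P \<and> pconst v * z \<in> set_ideal col E"
proof -
  have "scale z \<in> set_ideal col E" using scale_minus_proj[OF E, of z] assms(2) by simp
  then obtain b where b: "scale z = (\<Sum>d\<in>E. col d * b d)" by (auto simp: set_ideal_def)
  obtain n0 where n0: "\<forall>n\<ge>n0. degree_scale w n (scale z) = pconst (w ^ n) * z"
    using degree_scale_substitution by blast
  \<comment> \<open>The exponent exceeds n0 by one because each column takes up one degree in
    \<open>degree_scale_lin_form\<close>.\<close>
  have "pconst (w ^ Suc n0) * z = degree_scale w (Suc n0) (scale z)" using n0 by simp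
  also have "\<dots> = (\<Sum>d\<in>E. col d * degree_scale w n0 (b d))"
    unfolding b degree_scale_sum by (simp add: col_def degree_scale_lin_form)
  finally have "pconst (w ^ Suc n0) * z \<in> set_ideal col E" by (auto simp: set_ideal_def)
  then show ?thesis using notin_power[OF wP] by blast
qed

lemma proj_zeroI: "E \<subseteq> D \<Longrightarrow> z \<in> set_ideal col E \<Longrightarrow> proj E z = 0"
  by (rule ring_hom_set_ideal_zero[OF proj_hom]) (auto simp: proj_col)

text \<open>Up to factors outside P the ideal is the kernel of a homomorphism into a domain, so an
  element with nonzero image is a nonzerodivisor modulo it.\<close>

lemma regular_case_basis:
  assumes E: "E \<subseteq> D" and nz: "proj E (col j) \<noteq> 0" and z: "col j * z \<in> set_ideal col E"
  shows "\<exists>v. v \<notin> P \<and> pconst v * z \<in> set_ideal col E"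
proof -
  have "proj E (col j) * proj E z = 0"
    using proj_zeroI[OF E z] by (simp add: ring_hom_mult[OF proj_hom])
  then have "proj E z = 0" using poly_dom nz by blast
  then show ?thesis by (rule proj_zeroD[OF E])
qed

text \<open>Column e need not belong to D, so \<open>proj\<close> cannot kill it. Regularity is
  known in the order E, j, e and is transferred to E, e, j: from c_j z = q + c_e y one finds y
  congruent to a multiple c_j y' up to a factor v, and then c_j cancels in c_j (v z - c_e
  y').\<close>

lemma regular_case_permute:
  assumes E: "insert j E \<subseteq> D" "j \<notin> E" "e \<notin> E"
    and nz: "proj E (col j) \<noteq> 0" "proj (insert j E) (col e) \<noteq> 0"
    and z: "col j * z \<in> set_ideal col (insert e E)"
  shows "\<exists>v. v \<notin> P \<and> pconst v * z \<in> set_ideal col (insert e E)"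
proof -
  have fin: "finite E" using E(1) finite_subset[OF _ finD, of E] by simp
  obtain y q where q: "q \<in> set_ideal col E" and zq: "col j * z = q + col e * y"
    using z set_ideal_insert[OF fin E(3), of _ col] by blast
  have "col e * y = col j * z - q" using zq by simp
  moreover have "q \<in> set_ideal col (insert j E)"
    using q unfolding set_ideal_insert[OF fin E(2)] by (intro exI[of _ 0] exI[of _ q]) simp
  ultimately have "col e * y \<in> set_ideal col (insert j E)"
    using fin by (auto intro!: set_ideal_diff set_ideal_mult2 set_ideal_gen)
  then obtain v y' q' where v: "v \<notin> P" and q': "q' \<in> set_ideal col E" and vy: "pconst v * y = q' + col j * y'"
    using regular_case_basis[OF E(1) nz(2)] set_ideal_insert[OF fin E(2), of _ col] by blast
  have "col j * (pconst v * z - col e * y') = pconst v * (col j * z) - col e * (col j * y')"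
    by (simp add: algebra_simps)
  also have "\<dots> = pconst v * q + col e * (pconst v * y - col j * y')"
    unfolding zq by (simp add: algebra_simps)
  also have "\<dots> = pconst v * q + col e * q'" unfolding vy by simp
  also have "\<dots> \<in> set_ideal col E" using q q' by (intro set_ideal_add set_ideal_mult)
  finally obtain v' where v': "v' \<notin> P" and "pconst v' * (pconst v * z - col e * y') \<in> set_ideal col E"
    using regular_case_basis[OF _ nz(1)] E(1) by blast
  moreover have "pconst (v' * v) * z = pconst v' * (pconst v * z - col e * y') + col e * (pconst v' * y')"
    by (simp add: ring_hom_mult[OF pconst_hom] algebra_simps)
  ultimately have "pconst (v' * v) * z \<in> set_ideal col (insert e E)"
    unfolding set_ideal_insert[OF fin E(3)] by blast
  then show ?thesis using notin_mult[OF v' v] by blast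
qed

end

text \<open>Values of binary forms of degree m at A and B, with the pure power of B split off for
  inductions on m. A and B may be dependent or zero, and a representation need not be
  unique.\<close>

primrec binary_forms :: "('b::comm_ring_1 \<Rightarrow> 'c::comm_ring_1) \<Rightarrow> 'c \<Rightarrow> 'c \<Rightarrow> nat \<Rightarrow> 'c set" where
  "binary_forms h A B 0 = range h"
| "binary_forms h A B (Suc m) = {h c * B ^ Suc m + A * G | c G. G \<in> binary_forms h A B m}"

lemma binary_forms_SucI:
  "G \<in> binary_forms h A B m \<Longrightarrow> H = h c * B ^ Suc m + A * G \<Longrightarrow> H \<in> binary_forms h A B (Suc m)"
  by (simp only: binary_forms.simps(2)) blast

context
  fixes h :: "'b::comm_ring_1 \<Rightarrow> 'c::comm_ring_1" and A B :: 'c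
  assumes h: "is_ring_hom h"
begin

lemma binary_forms_zero: "0 \<in> binary_forms h A B m"
proof (induction m)
  case 0 show ?case using ring_hom_zero[OF h] by (simp add: image_iff) metis
next
  case (Suc m)
  have "0 = h 0 * B ^ Suc m + A * 0" using ring_hom_zero[OF h] by simp
  then show ?case by (rule binary_forms_SucI[OF Suc])
qed

lemma binary_forms_add:
  "G \<in> binary_forms h A B m \<Longrightarrow> H \<in> binary_forms h A B m \<Longrightarrow> G + H \<in> binary_forms h A B m"
proof (induction m arbitrary: G H)
  case 0 then show ?case using ring_hom_add[OF h, symmetric] by auto
next
  case (Suc m)
  then obtain c G' d H' where *: "G' \<in> binary_forms h A B m" "H' \<in> binary_forms h A B m"
    "G = h c * B ^ Suc m + A * G'" "H = h d * B ^ Suc m + A * H'" by auto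
  have "G + H = h (c + d) * B ^ Suc m + A * (G' + H')"
    by (simp add: * ring_hom_add[OF h] algebra_simps)
  then show ?case by (rule binary_forms_SucI[OF Suc.IH[OF *(1,2)]])
qed

lemma binary_forms_const: "G \<in> binary_forms h A B m \<Longrightarrow> h c * G \<in> binary_forms h A B m"
proof (induction m arbitrary: G)
  case 0 then show ?case using ring_hom_mult[OF h, symmetric] by auto
next
  case (Suc m)
  then obtain d G' where *: "G' \<in> binary_forms h A B m" "G = h d * B ^ Suc m + A * G'" by auto
  have "h c * G = h (c * d) * B ^ Suc m + A * (h c * G')"
    by (simp add: * ring_hom_mult[OF h] algebra_simps)
  then show ?case by (rule binary_forms_SucI[OF Suc.IH[OF *(1)]])
qed

lemma binary_forms_A: "G \<in> binary_forms h A B m \<Longrightarrow> A * G \<in> binary_forms h A B (Suc m)"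
proof -
  assume G: "G \<in> binary_forms h A B m"
  have "A * G = h 0 * B ^ Suc m + A * G" using ring_hom_zero[OF h] by simp
  then show ?thesis by (rule binary_forms_SucI[OF G])
qed

lemma binary_forms_B: "G \<in> binary_forms h A B m \<Longrightarrow> B * G \<in> binary_forms h A B (Suc m)"
proof (induction m arbitrary: G)
  case 0
  then obtain c where c: "G = h c" by auto
  have "B * G = h c * B ^ Suc 0 + A * 0" by (simp add: c mult.commute)
  then show ?case by (rule binary_forms_SucI[OF binary_forms_zero])
next
  case (Suc m)
  then obtain d G' where *: "G' \<in> binary_forms h A B m" "G = h d * B ^ Suc m + A * G'" by auto
  have "B * G = h d * B ^ Suc (Suc m) + A * (B * G')" by (simp add: * algebra_simps)
  then show ?case by (rule binary_forms_SucI[OF Suc.IH[OF *(1)]])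
qed

lemma binary_forms_sum:
  "(\<And>i. i \<in> S \<Longrightarrow> g i \<in> binary_forms h A B m) \<Longrightarrow> sum g S \<in> binary_forms h A B m"
  by (induction S rule: infinite_finite_induct) (auto intro: binary_forms_zero binary_forms_add)

lemma binary_forms_lin:
  assumes "G \<in> binary_forms h A B m"
  shows "(h p * A + h q * B) * G \<in> binary_forms h A B (Suc m)"
proof -
  have "(h p * A + h q * B) * G = h p * (A * G) + h q * (B * G)" by (simp add: algebra_simps)
  then show ?thesis using assms
    by (metis binary_forms_add binary_forms_const binary_forms_A binary_forms_B)
qed

lemma binary_forms_prod:
  assumes "finite S" "\<And>l. l \<in> S \<Longrightarrow> y l = h (p l) * A + h (q l) * B" "G \<in> binary_forms h A B m"
  shows "(\<Prod>l\<in>S. y l ^ k l) * G \<in> binary_forms h A B (sum k S + m)"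
  using assms
proof (induction S arbitrary: G m rule: finite_induct)
  case empty then show ?case by simp
next
  case (insert l S)
  have "y l ^ n * G \<in> binary_forms h A B (n + m)" for n
  proof (induction n)
    case 0 then show ?case using insert by simp
  next
    case (Suc n) then show ?case using binary_forms_lin[OF Suc, of "p l" "q l"] insert.prems(1)[of l]
      by (simp only: power_Suc mult.assoc add_Suc insertI1)
  qed
  then have "(\<Prod>l\<in>S. y l ^ k l) * (y l ^ k l * G) \<in> binary_forms h A B (sum k S + (k l + m))"
    using insert by blast
  then show ?case using insert.hyps by (simp add: mult_ac add_ac)
qed

end

context poly_prime
begin

text \<open>If (p, q) generates the syzygies of (ev A, ev B), the binary forms that vanish under ev are
  multiples of p A + q B.\<close>

lemma binary_form_vanishing:
  fixes A B :: "(nat \<Rightarrow>\<^sub>0 nat) \<Rightarrow>\<^sub>0 'b" and p q :: 'b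
  assumes ev: "is_ring_hom ev" "\<And>c. ev (pconst c) = c"
    and pq: "p * ev A + q * ev B = 0"
    and syz: "\<And>p' q'. p' * ev A + q' * ev B = 0 \<Longrightarrow> \<exists>v y. v \<notin> P \<and> v * p' = y * p \<and> v * q' = y * q"
    and nz: "ev A \<noteq> 0 \<or> ev B \<noteq> 0"
    and "G \<in> binary_forms pconst A B m" "ev G = 0"
  shows "\<exists>v H. v \<notin> P \<and> pconst v * G = (pconst p * A + pconst q * B) * H"
  using assms(6-)
proof (induction m arbitrary: G)
  case 0
  then obtain c where "G = pconst c" by auto
  then have "G = 0" using 0 ev by simp
  then show ?case using prime_ideal_one[OF prime] by (intro exI[of _ 1] exI[of _ 0]) simp
next
  case (Suc m)
  define lf where "lf = pconst p * A + pconst q * B"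
  note ev_simps = ring_hom_add[OF ev(1)] ring_hom_mult[OF ev(1)] ring_hom_power[OF ev(1)]
    ring_hom_diff[OF ev(1)] ev(2)
  note pc_simps = ring_hom_add[OF pconst_hom] ring_hom_mult[OF pconst_hom]
  obtain c G' where G': "G' \<in> binary_forms pconst A B m" and G: "G = pconst c * B ^ Suc m + A * G'"
    using Suc.prems by auto
  have evG: "c * ev B ^ Suc m + ev A * ev G' = 0" using Suc.prems(2) unfolding G ev_simps .
  consider "ev B = 0" | "ev B \<noteq> 0" "q = 0" | "ev B \<noteq> 0" "q \<noteq> 0" by blast
  then show ?case
  proof cases
    \<comment> \<open>Here (0, 1) is a syzygy, so p = 0 and B is a multiple of the linear form up to
      v; the A-part has smaller degree.\<close>
    case 1
    obtain v y where v: "v \<notin> P" "v * 0 = y * p" "v * 1 = y * q" using syz[of 0 1] 1 by auto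
    then have "p = 0" using dom[of y p] notin_nonzero[OF v(1)] by auto
    have "ev G' = 0" using dom[OF evG[unfolded 1, simplified]] nz 1 by auto
    then obtain v' H where v': "v' \<notin> P" and H: "pconst v' * G' = lf * H"
      using Suc.IH[OF G'] unfolding lf_def by blast
    have vB: "pconst v * B = pconst y * lf" using v(3) \<open>p = 0\<close> by (simp add: lf_def pc_simps mult.assoc)
    have "pconst (v' * v) * G
        = pconst v' * pconst c * B ^ m * (pconst v * B) + A * pconst v * (pconst v' * G')"
      by (simp add: G pc_simps algebra_simps)
    also have "\<dots> = lf * (pconst v' * pconst c * B ^ m * pconst y + A * pconst v * H)"
      unfolding vB H by (simp add: algebra_simps)
    finally show ?thesis using notin_mult[OF v' v(1)] unfolding lf_def by blast
  next
    \<comment> \<open>The Koszul syzygy (ev B, - ev A) shows that p is nonzero, whence ev A = 0.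
      Then (1, 0) is a syzygy, A is a multiple of the linear form up to v, and the pure power of B
      has coefficient 0.\<close>
    case 2
    have "ev B * ev A + (- ev A) * ev B = 0" by (simp add: algebra_simps)
    then obtain v y where v: "v \<notin> P" "v * ev B = y * p" using syz by blast
    then have "p \<noteq> 0" using dom[of v "ev B"] notin_nonzero[OF v(1)] 2 by auto
    then have evA: "ev A = 0" using pq 2 dom[of p "ev A"] by auto
    obtain v y where v: "v \<notin> P" "v * 1 = y * p" using syz[of 1 0] evA by auto
    have "c = 0" using evG dom[of c "ev B ^ Suc m"] power_eq_zero[of "ev B" "Suc m"] evA 2 by auto
    then have "pconst v * G = lf * (pconst y * G')"
      using v(2) 2 by (simp add: G lf_def pc_simps mult_ac)
    then show ?thesis using v(1) unfolding lf_def by blast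
  next
    case 3
    have evA: "ev A \<noteq> 0"
    proof
      assume "ev A = 0" then show False using pq 3 dom[of q "ev B"] by auto
    qed
    \<comment> \<open>Up to P, p is a nonzerodivisor modulo q: g p = q d makes (d, g) a syzygy,
      hence a multiple of (p, q).\<close>
    have divide: "\<exists>v y. v \<notin> P \<and> v * g = q * y" if "g * p = q * d" for g d
    proof -
      have "q * (d * ev A + g * ev B) = (q * d) * ev A + g * (q * ev B)"
        by (simp add: algebra_simps)
      also have "\<dots> = g * (p * ev A + q * ev B)"
        unfolding that[symmetric] by (simp add: algebra_simps)
      finally have "q * (d * ev A + g * ev B) = g * (p * ev A + q * ev B)" .
      then have "d * ev A + g * ev B = 0" using dom[of q "d * ev A + g * ev B"] 3 pq by auto
      then obtain v y where "v \<notin> P" "v * g = y * q" using syz by blast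
      then have "v \<notin> P \<and> v * g = q * y" by (simp add: mult.commute[of q])
      then show ?thesis by blast
    qed
    have divide_power: "\<exists>v y. v \<notin> P \<and> v * g = q * y" if "g * p ^ n = q * d" for g n d
      using that
    proof (induction n arbitrary: g d)
      case 0 then show ?case using prime_ideal_one[OF prime] by (intro exI[of _ 1] exI[of _ d]) simp
    next
      case (Suc n)
      then obtain v y where v: "v \<notin> P" "v * (g * p ^ n) = q * y"
        using divide[of "g * p ^ n" d] by (auto simp: mult_ac)
      then have "(v * g) * p ^ n = q * y" by (simp add: mult_ac)
      then obtain v' y' where "v' \<notin> P" "v' * (v * g) = q * y'" using Suc.IH by blast
      then have "v' * v \<notin> P" "(v' * v) * g = q * y'" using v(1) by (simp_all add: notin_mult mult.assoc)
      then show ?case by blast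
    qed
    \<comment> \<open>Each factor p turns one ev A into - q ev B, so p^n clears ev A from a form of
      degree n.\<close>
    have "\<exists>x. p ^ n * ev H = ev B ^ n * x" if "H \<in> binary_forms pconst A B n" for H n
      using that
    proof (induction n arbitrary: H)
      case 0 then show ?case by auto
    next
      case (Suc n)
      then obtain d H' where H': "H' \<in> binary_forms pconst A B n" "H = pconst d * B ^ Suc n + A * H'"
        by auto
      obtain x where x: "p ^ n * ev H' = ev B ^ n * x" using Suc.IH[OF H'(1)] by blast
      have pA: "p * ev A = - q * ev B" using pq by (simp add: eq_neg_iff_add_eq_0)
      have "p ^ Suc n * ev H = p ^ Suc n * d * ev B ^ Suc n + (p * ev A) * (p ^ n * ev H')"
        unfolding H'(2) ev_simps by (simp add: algebra_simps)
      also have "\<dots> = ev B ^ Suc n * (p ^ Suc n * d - q * x)"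
        unfolding pA x by (simp add: algebra_simps)
      finally show ?case by blast
    qed
    then obtain x where x: "p ^ m * ev G' = ev B ^ m * x" using G' by blast
    have pA: "p * ev A = - q * ev B" using pq by (simp add: eq_neg_iff_add_eq_0)
    \<comment> \<open>Cancelling the power of ev B leaves c p^(m+1) = q x, so q divides c up to a
      factor outside P.\<close>
    have "ev B ^ Suc m * (c * p ^ Suc m - q * x)
        = p ^ Suc m * (c * ev B ^ Suc m + ev A * ev G')"
    proof -
      have "p ^ Suc m * (c * ev B ^ Suc m + ev A * ev G')
          = p ^ Suc m * c * ev B ^ Suc m + (p * ev A) * (p ^ m * ev G')" by (simp add: algebra_simps)
      then show ?thesis unfolding pA x by (simp add: algebra_simps)
    qed
    then have "c * p ^ Suc m - q * x = 0"
      using dom[of "ev B ^ Suc m" "c * p ^ Suc m - q * x"] power_eq_zero[of "ev B" "Suc m"] 3 evG by auto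
    then obtain v y where v: "v \<notin> P" and vc: "v * c = q * y"
      using divide_power[of c "Suc m" x] by auto
    \<comment> \<open>Since v c = q y, subtracting y B^m (p A + q B) from v G removes the pure power
      of B; the rest is A times this form of degree m.\<close>
    define G2 where "G2 = pconst v * G' + pconst (- y * p) * B ^ m"
    have "B ^ m \<in> binary_forms pconst A B m" for m
    proof (induction m)
      case 0 show ?case using rangeI[of pconst 1] by simp
    next
      case (Suc m) then show ?case using binary_forms_B[OF pconst_hom Suc] by simp
    qed
    then have G2: "G2 \<in> binary_forms pconst A B m"
      unfolding G2_def using G' by (intro binary_forms_add binary_forms_const pconst_hom)
    have vG: "pconst v * G = pconst y * B ^ m * lf + A * G2"
    proof -
      have "pconst v * G = pconst (v * c) * B ^ Suc m + pconst v * A * G'"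
        by (simp add: G pc_simps algebra_simps)
      then show ?thesis unfolding vc G2_def lf_def
        by (simp add: pc_simps ring_hom_uminus[OF pconst_hom] algebra_simps)
    qed
    have "ev lf = 0" using pq by (simp add: lf_def ev_simps)
    then have "ev A * ev G2 = 0"
      using arg_cong[OF vG, of ev] Suc.prems(2) by (simp add: ev_simps)
    then have "ev G2 = 0" using dom evA by blast
    then obtain v' H where v': "v' \<notin> P" and H: "pconst v' * G2 = lf * H"
      using Suc.IH[OF G2] unfolding lf_def by blast
    have "pconst (v' * v) * G = pconst v' * (pconst v * G)" by (simp add: pc_simps mult.assoc)
    also have "\<dots> = pconst v' * pconst y * B ^ m * lf + A * (pconst v' * G2)"
      unfolding vG by (simp add: algebra_simps)
    also have "\<dots> = lf * (pconst v' * pconst y * B ^ m + A * H)"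
      unfolding H by (simp add: algebra_simps)
    finally show ?thesis using notin_mult[OF v' v] unfolding lf_def by blast
  qed
qed

end

section \<open>Regularity and kernel of evaluation at a prime where the ideal has two
  generators\<close>

definition homogeneous_form :: "nat \<Rightarrow> nat \<Rightarrow> ((nat \<Rightarrow>\<^sub>0 nat) \<Rightarrow>\<^sub>0 'b::zero) \<Rightarrow> bool" where
  "homogeneous_form r m F \<longleftrightarrow>
    (\<forall>a\<in>Poly_Mapping.keys F. Poly_Mapping.keys a \<subseteq> {..<r} \<and> tdeg a = m)"

lemma homogeneous_lin_form: "homogeneous_form r 1 (lin_form r c)"
  unfolding homogeneous_form_def
proof
  fix a assume "a \<in> Poly_Mapping.keys (lin_form r c)"
  then have "(\<Sum>l<r. Poly_Mapping.lookup (pconst (c l) * pvar l) a) \<noteq> 0"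
    by (simp add: lin_form_def in_keys_iff lookup_sum)
  then obtain l where l: "l < r" "Poly_Mapping.lookup (pconst (c l) * pvar l) a \<noteq> 0"
    by (rule sum.not_neutral_contains_not_neutral) simp
  then have "a = Poly_Mapping.single l 1"
    by (auto simp: lookup_pconst_mult pvar_def lookup_single when_def split: if_splits)
  then show "Poly_Mapping.keys a \<subseteq> {..<r} \<and> tdeg a = 1" using l by simp
qed

text \<open>Columns below s are those of the presentation; s and s + 1 will be the linear forms
  evaluating to the local generators. Of these s + 2 columns only e is left out of the coordinate
  system.\<close>

locale two_generated_at_prime = coordinates P M N r w D
  for P :: "'b::comm_ring_1 set" and M N r w D +
  fixes f :: "nat \<Rightarrow> 'b" and s e :: nat
  assumes D: "D = {..<Suc (Suc s)} - {e}" and e: "e < Suc (Suc s)"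
    and inj: "\<And>y. (\<And>l. l < r \<Longrightarrow> (\<Sum>j<s. M l j * y j) = 0) \<Longrightarrow> \<forall>j<s. y j = 0"
    and complex: "\<And>j. j < s \<Longrightarrow> (\<Sum>l<r. f l * M l j) = 0"
    and exact: "\<And>z. (\<Sum>l<r. z l * f l) = 0 \<Longrightarrow> \<exists>y. \<forall>l<r. z l = (\<Sum>j<s. M l j * y j)"
    and f_nz: "\<exists>l<r. f l \<noteq> 0"
begin

abbreviation ev :: "((nat \<Rightarrow>\<^sub>0 nat) \<Rightarrow>\<^sub>0 'b) \<Rightarrow> 'b" where
  "ev \<equiv> poly_eval (\<lambda>x. x) f"

lemma ev_hom: "is_ring_hom ev"
  by (rule poly_eval_hom[OF ring_hom_id])

lemma ev_const [simp]: "ev (pconst c) = c"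
  by (rule poly_eval_const[OF ring_hom_id])

lemma ev_col: "j < s \<Longrightarrow> ev (col j) = 0"
  using complex[of j] by (simp add: col_def lin_form_eval[OF ring_hom_id] mult.commute)

text \<open>A zero image would make v times column j a combination of the columns in E. Comparing
  coefficients of each t_l keeps only the constant terms of the cofactors and gives a relation on
  the columns of the injective presentation with coefficient v at j.\<close>

lemma proj_col_nonzero:
  assumes E: "E \<subseteq> D" "E \<subseteq> {..<s}" and j: "j < s" "j \<notin> E"
  shows "proj E (col j) \<noteq> 0"
proof
  assume "proj E (col j) = 0"
  then obtain v where v: "v \<notin> P" and "pconst v * col j \<in> set_ideal col E"
    using proj_zeroD[OF E(1)] by blast
  then obtain b where b: "pconst v * col j = (\<Sum>i\<in>E. col i * b i)" by (auto simp: set_ideal_def)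
  define y where "y = (\<lambda>i. if i = j then v else if i \<in> E then - Poly_Mapping.lookup (b i) 0 else 0)"
  have "(\<Sum>i<s. M l i * y i) = 0" if l: "l < r" for l
  proof -
    have "v * M l j = Poly_Mapping.lookup (pconst v * col j) (Poly_Mapping.single l 1)"
      using l by (simp add: lookup_pconst_mult col_def lookup_lin_form[of l r, simplified])
    also have "\<dots> = (\<Sum>i\<in>E. M l i * Poly_Mapping.lookup (b i) 0)"
      unfolding b by (simp add: lookup_sum col_def lookup_lin_form_mult[OF l, simplified])
    also have "\<dots> = - (\<Sum>i\<in>E. M l i * y i)"
      using j by (auto simp: y_def sum_negf[symmetric] intro!: sum.cong)
    also have "(\<Sum>i\<in>E. M l i * y i) = (\<Sum>i\<in>{..<s} - {j}. M l i * y i)"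
      using E(2) j by (intro sum.mono_neutral_left) (auto simp: y_def)
    finally have "v * M l j + (\<Sum>i\<in>{..<s} - {j}. M l i * y i) = 0" by simp
    moreover have "(\<Sum>i<s. M l i * y i) = M l j * y j + (\<Sum>i\<in>{..<s} - {j}. M l i * y i)"
      using j by (subst sum.remove[of _ j]) auto
    ultimately show ?thesis by (simp add: y_def mult.commute)
  qed
  then have "y j = 0" using inj j by blast
  then show False using notin_nonzero[OF v] by (simp add: y_def)
qed

lemma regular:
  assumes j: "j < s" and z: "col j * z \<in> set_ideal col {..<j}"
  shows "\<exists>v. v \<notin> P \<and> pconst v * z \<in> set_ideal col {..<j}"
proof (cases "e < j")
  case False
  then have "{..<j} \<subseteq> D" using j D by auto
  then show ?thesis using z j by (intro regular_case_basis proj_col_nonzero) auto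
next
  case True
  \<comment> \<open>The redundant column precedes j, so it is taken out and put back last, after j,
    for the exchange.\<close>
  define E where "E = {..<j} - {e}"
  have ins: "insert e E = {..<j}" using True by (auto simp: E_def)
  have ED: "insert j E \<subseteq> D" "j \<notin> E" "e \<notin> E" "insert j E \<subseteq> {..<s}"
    using True j by (auto simp: E_def D)
  have "proj E (col j) \<noteq> 0" "proj (insert j E) (col e) \<noteq> 0"
    by (rule proj_col_nonzero; use ED True j in auto)+
  then show ?thesis
    using regular_case_permute[OF ED(1-3)] z unfolding ins by blast
qed

lemma scale_homogeneous:
  assumes "homogeneous_form r m F"
  shows "scale F = pconst (w ^ m) * F"
proof -
  have "F = pm_extend Poly_Mapping.single F"
    unfolding pm_extend_def
    by (rule poly_mapping_eqI) (auto simp: lookup_sum lookup_single when_def in_keys_iff sum.delta)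
  have "scale F = (\<Sum>a\<in>Poly_Mapping.keys F.
      pconst (Poly_Mapping.lookup F a) * (pconst (w ^ m) * Poly_Mapping.single a 1))"
    unfolding poly_eval_def pm_extend_def monom_eval_smult monom_eval_pvar
    using assms by (intro sum.cong) (auto simp: homogeneous_form_def ring_hom_power[OF pconst_hom])
  also have "\<dots> = pconst (w ^ m) * pm_extend Poly_Mapping.single F"
    by (simp add: pm_extend_def sum_distrib_left pconst_mult_single) (simp add: mult.commute)
  finally show ?thesis using \<open>F = _\<close> by simp
qed

text \<open>\<open>proj\<close> and \<open>scale\<close> differ by columns that \<open>ev\<close>
  kills, and on a form of degree m \<open>scale\<close> is multiplication by w^m.\<close>

lemma ev_proj_homogeneous:
  assumes "homogeneous_form r m F" "ev F = 0" "E \<subseteq> D" "E \<subseteq> {..<s}"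
  shows "ev (proj E F) = 0"
proof -
  have "ev (scale F - proj E F) = 0"
    by (rule ring_hom_set_ideal_zero[OF ev_hom _ scale_minus_proj[OF assms(3)]])
      (use assms(4) ev_col in auto)
  then show ?thesis
    using assms(2)
    by (simp add: scale_homogeneous[OF assms(1)] ring_hom_diff[OF ev_hom] ring_hom_mult[OF ev_hom])
qed

text \<open>Stated with arbitrary A and B so that A = 0 covers the case of a single surviving
  column.\<close>

lemma proj_homogeneous_binary:
  assumes F: "homogeneous_form r m F"
    and y: "\<And>l. l < r \<Longrightarrow> (\<Sum>d\<in>D - E. pconst (N d l) * col d) = pconst (p l) * A + pconst (q l) * B"
  shows "proj E F \<in> binary_forms pconst A B m"
proof -
  have "pconst (Poly_Mapping.lookup F a) * monom_eval
      (\<lambda>l. if l < r then \<Sum>d\<in>D - E. pconst (N d l) * col d else pconst w * pvar l) a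
      \<in> binary_forms pconst A B m" if a: "a \<in> Poly_Mapping.keys F" for a
  proof -
    have a': "Poly_Mapping.keys a \<subseteq> {..<r}" "tdeg a = m" using F a by (auto simp: homogeneous_form_def)
    have "1 \<in> binary_forms pconst A B 0" using rangeI[of pconst 1] by simp
    then have "monom_eval (\<lambda>l. if l < r then \<Sum>d\<in>D - E. pconst (N d l) * col d else pconst w * pvar l) a * 1
        \<in> binary_forms pconst A B (tdeg a + 0)"
      unfolding monom_eval_def tdeg_def using a' y
      by (intro binary_forms_prod[where p = p and q = q]) (auto simp: pconst_hom)
    then show ?thesis using a' by (simp add: binary_forms_const[OF pconst_hom])
  qed
  then show ?thesis
    unfolding proj_def poly_eval_def pm_extend_def by (intro binary_forms_sum pconst_hom)
qed

lemma w_f: "l < r \<Longrightarrow> w * f l = (\<Sum>d\<in>D. N d l * ev (col d))"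
  using arg_cong[OF pconst_w_pvar, of l ev]
  by (simp add: ring_hom_mult[OF ev_hom] ring_hom_sum[OF ev_hom] poly_eval_var[OF ring_hom_id])

lemma w_f_restrict: "l < r \<Longrightarrow> w * f l = (\<Sum>d\<in>D - {..<s}. N d l * ev (col d))"
  unfolding w_f using finD ev_col by (intro sum.mono_neutral_right) auto

text \<open>All columns below s belong to the coordinate system and one further column e' survives.
  F becomes c times the m-th power of e', and e' has nonzero value because w f_l is a multiple of
  it; so c = 0.\<close>

lemma kernel_one_generator:
  assumes F: "homogeneous_form r m F" "ev F = 0" and es: "s \<le> e"
  shows "\<exists>v. v \<notin> P \<and> pconst v * F \<in> set_ideal col {..<s}"
proof -
  define e' where "e' = (if e = s then Suc s else s)"
  have E: "{..<s} \<subseteq> D" and De: "D - {..<s} = {e'}" using es e by (auto simp: D e'_def)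
  have evB: "ev (col e') \<noteq> 0"
  proof
    assume "ev (col e') = 0"
    then have "w * f l = 0" if "l < r" for l using w_f_restrict[OF that] De by simp
    then show False using f_nz dom notin_nonzero[OF wP] by blast
  qed
  have "proj {..<s} F \<in> binary_forms pconst 0 (col e') m"
    by (rule proj_homogeneous_binary[OF F(1), where p = "\<lambda>_. 0" and q = "N e'"]) (simp add: De)
  then obtain c where c: "proj {..<s} F = pconst c * col e' ^ m"
    by (cases m) auto
  have "c * ev (col e') ^ m = 0"
    using ev_proj_homogeneous[OF F E] by (simp add: c ring_hom_mult[OF ev_hom] ring_hom_power[OF ev_hom])
  then have "c = 0" using dom power_eq_zero evB by blast
  then show ?thesis using proj_zeroD[OF E] c by simp
qed

text \<open>After killing the columns below s other than e, F is a binary form vanishing under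
  \<open>ev\<close>, hence a multiple of the image p A + q B of column e up to P. Undoing the
  projection brings back only columns below s.\<close>

lemma kernel_two_generators:
  assumes F: "homogeneous_form r m F" "ev F = 0" and es: "e < s"
  shows "\<exists>v. v \<notin> P \<and> pconst v * F \<in> set_ideal col {..<s}"
proof -
  define E where "E = {..<s} - {e}"
  have E: "E \<subseteq> D" "E \<subseteq> {..<s}" "e \<notin> E" "insert e E = {..<s}" "finite E"
    and DE: "D - E = {s, Suc s}" using es by (auto simp: D E_def)
  define A B where "A = col s" and "B = col (Suc s)"
  \<comment> \<open>The coordinates, up to w, of column e along the two surviving columns.\<close>
  define p q where "p = (\<Sum>l<r. N s l * M l e)" and "q = (\<Sum>l<r. N (Suc s) l * M l e)"
  have proj_e: "proj E (col e) = pconst p * A + pconst q * B"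
    unfolding col_def[of e] proj_lin_form DE by (simp add: p_def q_def A_def B_def)
  have homog_e: "homogeneous_form r 1 (col e)" unfolding col_def by (rule homogeneous_lin_form)
  have pq: "p * ev A + q * ev B = 0"
    using ev_proj_homogeneous[OF homog_e ev_col[OF es] E(1,2)]
    by (simp add: proj_e ring_hom_mult[OF ev_hom] ring_hom_add[OF ev_hom])
  have indep: "x = 0 \<and> y = 0" if xy: "pconst x * A + pconst y * B = 0" for x y
  proof -
    have "pconst x * A + pconst y * B = lin_form r (\<lambda>l. x * M l s + y * M l (Suc s))"
      unfolding A_def B_def col_def lin_form_smult
      by (simp add: lin_form_def sum.distrib[symmetric] ring_hom_add[OF pconst_hom] distrib_right)
    then have 0: "x * M l s + y * M l (Suc s) = 0" if "l < r" for l
      using lookup_lin_form[OF that, of "\<lambda>l. x * M l s + y * M l (Suc s)"] xy by simp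
    have sD: "s \<in> D" "Suc s \<in> D" using DE by auto
    have *: "x * (\<Sum>l<r. N d l * M l s) + y * (\<Sum>l<r. N d l * M l (Suc s)) = 0" for d
    proof -
      have "x * (\<Sum>l<r. N d l * M l s) + y * (\<Sum>l<r. N d l * M l (Suc s))
          = (\<Sum>l<r. N d l * (x * M l s + y * M l (Suc s)))"
        by (simp add: sum_distrib_left sum.distrib[symmetric] algebra_simps)
      then show ?thesis using 0 by simp
    qed
    have "x * w = 0" "y * w = 0" using *[of s] *[of "Suc s"] NM sD by simp_all
    then show ?thesis using dom notin_nonzero[OF wP] by blast
  qed
  \<comment> \<open>By exactness p' A + q' B is a combination of presentation columns. Under
    \<open>proj E\<close> only column e survives, and independence of A and B gives (w p', w q') = y
    e * (p, q).\<close>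
  have syz: "\<exists>v y. v \<notin> P \<and> v * p' = y * p \<and> v * q' = y * q" if p'q': "p' * ev A + q' * ev B = 0" for p' q'
  proof -
    have "(\<Sum>l<r. (p' * M l s + q' * M l (Suc s)) * f l) = p' * ev A + q' * ev B"
      by (simp add: A_def B_def col_def lin_form_eval[OF ring_hom_id] sum_distrib_left
          sum.distrib[symmetric] algebra_simps)
    then obtain y where y: "\<And>l. l < r \<Longrightarrow> p' * M l s + q' * M l (Suc s) = (\<Sum>j<s. M l j * y j)"
      using exact[of "\<lambda>l. p' * M l s + q' * M l (Suc s)"] p'q' by auto
    have "pconst p' * A + pconst q' * B = lin_form r (\<lambda>l. p' * M l s + q' * M l (Suc s))"
      unfolding A_def B_def col_def lin_form_smult
      by (simp add: lin_form_def sum.distrib[symmetric] ring_hom_add[OF pconst_hom] distrib_right)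
    also have "\<dots> = lin_form r (\<lambda>l. \<Sum>j<s. y j * M l j)"
      by (rule lin_form_cong) (simp add: y mult.commute)
    also have "\<dots> = (\<Sum>j<s. pconst (y j) * col j)"
      unfolding col_def lin_form_smult lin_form_sum ..
    finally have *: "pconst p' * A + pconst q' * B = (\<Sum>j<s. pconst (y j) * col j)" .
    have projAB: "proj E A = pconst w * A" "proj E B = pconst w * B"
    proof -
      have "s \<in> D - E" "Suc s \<in> D - E" unfolding DE by auto
      then show "proj E A = pconst w * A" "proj E B = pconst w * B"
        by (simp_all add: A_def B_def proj_col)
    qed
    have "pconst p' * (pconst w * A) + pconst q' * (pconst w * B)
        = proj E (pconst p' * A + pconst q' * B)"
      by (simp add: ring_hom_add[OF proj_hom] ring_hom_mult[OF proj_hom] projAB)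
        (simp add: proj_def poly_eval_const[OF pconst_hom])
    also have "\<dots> = (\<Sum>j<s. pconst (y j) * proj E (col j))"
      unfolding * by (simp add: ring_hom_sum[OF proj_hom] ring_hom_mult[OF proj_hom])
        (simp add: proj_def poly_eval_const[OF pconst_hom])
    also have "\<dots> = (\<Sum>j<s. if j = e then pconst (y e) * proj E (col e) else 0)"
    proof (rule sum.cong)
      fix j assume j: "j \<in> {..<s}"
      show "pconst (y j) * proj E (col j) = (if j = e then pconst (y e) * proj E (col e) else 0)"
      proof (cases "j = e")
        case False
        then have "j \<in> E" "j \<in> D" using j E(1) by (auto simp: E_def)
        then show ?thesis using False by (simp add: proj_col)
      qed simp
    qed simp
    also have "\<dots> = pconst (y e) * (pconst p * A + pconst q * B)"
      using es by (simp add: proj_e)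
    finally have "pconst (w * p' - y e * p) * A + pconst (w * q' - y e * q) * B = 0"
      by (simp add: ring_hom_diff[OF pconst_hom] ring_hom_mult[OF pconst_hom] algebra_simps)
    from indep[OF this] show ?thesis using wP by auto
  qed
  have nz: "ev A \<noteq> 0 \<or> ev B \<noteq> 0"
  proof (rule ccontr)
    assume "\<not> ?thesis"
    then have 0: "ev (col s) = 0" "ev (col (Suc s)) = 0" by (auto simp: A_def B_def)
    have "D - {..<s} = {s, Suc s}" using es by (auto simp: D)
    then have "w * f l = 0" if "l < r" for l using w_f_restrict[OF that] 0 by simp
    then show False using f_nz dom notin_nonzero[OF wP] by blast
  qed
  have "proj E F \<in> binary_forms pconst A B m"
    by (rule proj_homogeneous_binary[OF F(1), where p = "N s" and q = "N (Suc s)"])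
      (simp add: DE A_def B_def)
  then obtain v H where v: "v \<notin> P" and H: "pconst v * proj E F = proj E (col e) * H"
    unfolding proj_e
    using binary_form_vanishing[OF ev_hom ev_const pq syz nz _ ev_proj_homogeneous[OF F E(1,2)]]
    by blast
  have "pconst (v * w ^ m) * F = pconst v * scale F"
    by (simp add: scale_homogeneous[OF F(1)] ring_hom_mult[OF pconst_hom] mult.assoc)
  \<comment> \<open>Replaces \<open>proj E\<close> by \<open>scale\<close> for both F and column e;
    the two errors lie in the ideal of the columns in E.\<close>
  also have "\<dots> = pconst v * (scale F - proj E F) - (scale (col e) - proj E (col e)) * H + scale (col e) * H"
    using H by (simp add: algebra_simps)
  also have "scale (col e) = pconst w * col e"
    using scale_homogeneous[OF homog_e] by simp
  also have "pconst v * (scale F - proj E F) - (pconst w * col e - proj E (col e)) * H + pconst w * col e * H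
      \<in> set_ideal col {..<s}"
  proof -
    have sub: "set_ideal col E \<subseteq> set_ideal col {..<s}"
    proof
      fix z assume "z \<in> set_ideal col E"
      then show "z \<in> set_ideal col {..<s}"
        unfolding E(4)[symmetric] set_ideal_insert[OF E(5,3)] by (intro exI[of _ 0] exI[of _ z]) simp
    qed
    have "scale z - proj E z \<in> set_ideal col {..<s}" for z
      by (rule subsetD[OF sub scale_minus_proj[OF E(1)]])
    from this[of F] this[of "col e"] have "scale F - proj E F \<in> set_ideal col {..<s}"
      "pconst w * col e - proj E (col e) \<in> set_ideal col {..<s}"
      using scale_homogeneous[OF homog_e] by simp_all
    moreover have "col e \<in> set_ideal col {..<s}" using es by (intro set_ideal_gen) auto
    ultimately show ?thesis
      by (simp add: set_ideal_add set_ideal_diff set_ideal_mult set_ideal_mult2)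
  qed
  finally show ?thesis using notin_mult[OF v notin_power[OF wP]] by blast
qed

lemma koszul_exact_at_prime:
  assumes cycle: "\<And>K. K \<subseteq> {..<s} \<Longrightarrow> kdiff s col x K = 0"
    and empty: "homogeneous_form r m (x {})" "ev (x {}) = 0"
  shows "\<exists>v y. v \<notin> P \<and> (\<forall>K\<subseteq>{..<s}. pconst v * x K = kdiff s col y K)"
proof -
  have "\<exists>w'\<in>pconst ` (- P). \<exists>y. \<forall>K\<subseteq>{..<s}. w' * x K = kdiff s col y K"
  proof (rule koszul_exact_up_to)
    show "1 \<in> pconst ` (- P)"
      using prime_ideal_one[OF prime] by (intro image_eqI[of _ _ 1]) auto
    show "v * w \<in> pconst ` (- P)" if vw: "v \<in> pconst ` (- P)" "w \<in> pconst ` (- P)"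
      for v w :: "(nat \<Rightarrow>\<^sub>0 nat) \<Rightarrow>\<^sub>0 'b"
    proof -
      obtain a b where "a \<notin> P" "v = pconst a" "b \<notin> P" "w = pconst b" using vw by blast
      then have "v * w = pconst (a * b)" "a * b \<in> - P"
        using notin_mult by (simp_all add: ring_hom_mult[OF pconst_hom])
      then show ?thesis by blast
    qed
    show "\<exists>w\<in>pconst ` (- P). w * z \<in> seq_ideal col j"
      if "j < s" "col j * z \<in> seq_ideal col j" for j z
      using regular[of j z] that unfolding seq_ideal_def by blast
    show "\<exists>w\<in>pconst ` (- P). w * x {} \<in> seq_ideal col s"
    proof -
      have "\<exists>v. v \<notin> P \<and> pconst v * x {} \<in> set_ideal col {..<s}"
        using kernel_one_generator[OF empty] kernel_two_generators[OF empty] by (cases "e < s") simp_all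
      then show ?thesis unfolding seq_ideal_def by blast
    qed
  qed (rule cycle)
  then show ?thesis by blast
qed

end

section \<open>Removing a redundant column, and the ranks in the resolution\<close>

context poly_prime
begin

lemma zero_prime: "is_prime_ideal {0::'b}"
proof -
  have "1 \<notin> {0::'b}" using notin_nonzero[OF prime_ideal_one[OF prime]] by simp
  then have "{0::'b} \<noteq> UNIV" by blast
  then show ?thesis unfolding is_prime_ideal_def is_ideal_def using dom by simp
qed

text \<open>M has r rows and r + 1 columns and a right inverse up to u. Hence its columns satisfy a
  relation with some coefficient outside P, and that column can be expressed through the others up
  to this coefficient.\<close>

lemma delete_column:
  fixes M N0 :: "nat \<Rightarrow> nat \<Rightarrow> 'b"
  assumes u: "u \<notin> P"
    and MN0: "\<And>l l'. l < r \<Longrightarrow> l' < r \<Longrightarrow> (\<Sum>d<Suc r. M l' d * N0 d l) = (if l' = l then u else 0)"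
  shows "\<exists>e N w. e < Suc r \<and> coordinates P M N r w ({..<Suc r} - {e})"
proof -
  note Pi = prime_ideal_ideal[OF prime]
  \<comment> \<open>The defect u - N0 M. As M N0 = u, M annihilates it, so every column of Q is a
    relation among the columns of M.\<close>
  define Q where "Q = (\<lambda>d d'. (if d = d' then u else 0) - (\<Sum>l<r. N0 d l * M l d'))"
  have MQ: "(\<Sum>d<Suc r. M l' d * Q d d') = 0" if "l' < r" "d' < Suc r" for l' d'
  proof -
    have "(\<Sum>d<Suc r. M l' d * Q d d')
        = (\<Sum>d<Suc r. M l' d * (if d = d' then u else 0)) - (\<Sum>d<Suc r. \<Sum>l<r. M l' d * N0 d l * M l d')"
      unfolding Q_def right_diff_distrib sum_subtractf sum_distrib_left by (simp only: mult.assoc)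
    also have "(\<Sum>d<Suc r. M l' d * (if d = d' then u else 0)) = u * M l' d'"
      using that by (simp add: if_distrib[of "(*) _"] mult.commute cong: if_cong)
    also have "(\<Sum>d<Suc r. \<Sum>l<r. M l' d * N0 d l * M l d') = (\<Sum>l<r. (\<Sum>d<Suc r. M l' d * N0 d l) * M l d')"
      unfolding sum_distrib_right by (rule sum.swap)
    also have "\<dots> = (\<Sum>l<r. if l' = l then u * M l d' else 0)"
      using that MN0 by (intro sum.cong) auto
    also have "\<dots> = u * M l' d'" using that by simp
    finally show ?thesis by simp
  qed
  \<comment> \<open>If all entries of Q were in P, a vector y with M y = 0 modulo P and some entry
    outside P would give u y = Q y + N0 (M y) in P.\<close>
  have "\<exists>e<Suc r. \<exists>e'<Suc r. Q e e' \<notin> P"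
  proof (rule ccontr)
    assume "\<not> ?thesis"
    then have QP: "Q d d' \<in> P" if "d < Suc r" "d' < Suc r" for d d' using that by blast
    have "\<exists>y. (\<exists>c\<in>{..<Suc r}. y c \<notin> P) \<and> (\<forall>l\<in>{..<r}. (\<Sum>c<Suc r. M l c * y c) \<in> P)"
      by (rule dependent_columns_mod_prime[OF prime]) simp_all
    then obtain y d where d: "d < Suc r" "y d \<notin> P"
      and y: "\<And>l. l < r \<Longrightarrow> (\<Sum>c<Suc r. M l c * y c) \<in> P" by blast
    have eq: "(\<Sum>c<Suc r. Q d c * y c) + (\<Sum>l<r. N0 d l * (\<Sum>c<Suc r. M l c * y c)) = u * y d"
    proof -
      have "(\<Sum>c<Suc r. Q d c * y c)
          = (\<Sum>c<Suc r. if d = c then u * y c else 0) - (\<Sum>c<Suc r. \<Sum>l<r. N0 d l * (M l c * y c))"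
        unfolding sum_subtractf[symmetric]
        by (intro sum.cong) (auto simp: Q_def left_diff_distrib sum_distrib_right mult.assoc)
      also have "(\<Sum>c<Suc r. if d = c then u * y c else 0) = u * y d" using d by simp
      also have "(\<Sum>c<Suc r. \<Sum>l<r. N0 d l * (M l c * y c)) = (\<Sum>l<r. N0 d l * (\<Sum>c<Suc r. M l c * y c))"
        unfolding sum_distrib_left by (rule sum.swap)
      finally show ?thesis by simp
    qed
    have "(\<Sum>c<Suc r. Q d c * y c) \<in> P" 
      by (rule ideal_sum[OF Pi], rule ideal_mult2[OF Pi], rule QP) (use d in auto)
    moreover have "(\<Sum>l<r. N0 d l * (\<Sum>c<Suc r. M l c * y c)) \<in> P"
      by (rule ideal_sum[OF Pi], rule ideal_mult[OF Pi], rule y) simp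
    ultimately have "u * y d \<in> P" unfolding eq[symmetric] by (rule ideal_add[OF Pi])
    then show False using notin_mult[OF u d(2)] by blast
  qed
  then obtain e e' where e: "e < Suc r" "e' < Suc r" and Qe: "Q e e' \<notin> P" by blast
  \<comment> \<open>N0 times the pivot, corrected by the relation in column e' so that row e becomes
    0 while the product with M changes only by the factor Q e e'.\<close>
  define N where "N = (\<lambda>d l. Q e e' * N0 d l - Q d e' * N0 e l)"
  define w where "w = Q e e' * u"
  define D where "D = {..<Suc r} - {e}"
  have w: "w \<notin> P" unfolding w_def by (rule notin_mult[OF Qe u])
  have finD: "finite D" and cardD: "card D = r" using e by (auto simp: D_def)
  have MN: "(\<Sum>d\<in>D. M l' d * N d l) = (if l' = l then w else 0)" if l: "l < r" "l' < r" for l l'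
  proof -
    have "(\<Sum>d\<in>D. M l' d * N d l) = (\<Sum>d<Suc r. M l' d * N d l)"
      unfolding D_def by (intro sum.mono_neutral_left) (auto simp: N_def)
    also have "\<dots> = Q e e' * (\<Sum>d<Suc r. M l' d * N0 d l) - (\<Sum>d<Suc r. M l' d * Q d e') * N0 e l"
      unfolding sum_distrib_left sum_distrib_right sum_subtractf[symmetric] N_def
      by (intro sum.cong) (simp_all add: algebra_simps)
    also have "\<dots> = (if l' = l then w else 0)"
      unfolding MQ[OF l(2) e(2)] MN0[OF l] by (simp add: w_def)
    finally show ?thesis .
  qed
  \<comment> \<open>A right inverse up to w of a square matrix over a domain is also a left one. The
    defect column y satisfies M y = 0; the r columns of N together with y are dependent in r rows,
    and applying M shows that only y can carry a nonzero coefficient, so y = 0.\<close>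
  have NM: "(\<Sum>l<r. N d l * M l d') = (if d = d' then w else 0)" if d: "d \<in> D" "d' \<in> D" for d d'
  proof -
    define y where "y = (\<lambda>d. (\<Sum>l<r. N d l * M l d') - (if d = d' then w else 0))"
    have My: "(\<Sum>d\<in>D. M l' d * y d) = 0" if "l' < r" for l'
    proof -
      have "(\<Sum>d\<in>D. M l' d * y d)
          = (\<Sum>d\<in>D. \<Sum>l<r. M l' d * N d l * M l d') - (\<Sum>d\<in>D. if d = d' then w * M l' d else 0)"
        unfolding sum_subtractf[symmetric]
        by (intro sum.cong) (auto simp: y_def right_diff_distrib sum_distrib_left mult.assoc mult.commute[of w])
      also have "(\<Sum>d\<in>D. \<Sum>l<r. M l' d * N d l * M l d') = (\<Sum>l<r. (\<Sum>d\<in>D. M l' d * N d l) * M l d')"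
        unfolding sum_distrib_right by (rule sum.swap)
      also have "\<dots> = (\<Sum>l<r. if l' = l then w * M l d' else 0)"
        using MN that by (intro sum.cong) auto
      also have "\<dots> = w * M l' d'" using that by simp
      also have "(\<Sum>d\<in>D. if d = d' then w * M l' d else 0) = w * M l' d'"
        using d finD by simp
      finally show ?thesis by simp
    qed
    have "\<exists>z. (\<exists>c\<in>{..<Suc r}. z c \<notin> {0}) \<and>
        (\<forall>d\<in>D. (\<Sum>c<Suc r. (if c < r then N d c else y d) * z c) \<in> {0})"
      by (rule dependent_columns_mod_prime[OF zero_prime]) (use finD cardD in simp_all)
    then obtain z c where c: "c < Suc r" "z c \<noteq> 0"
      and z: "\<And>d. d \<in> D \<Longrightarrow> (\<Sum>c<Suc r. (if c < r then N d c else y d) * z c) = 0" by blast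
    have z': "(\<Sum>c<r. N d c * z c) + y d * z r = 0" if "d \<in> D" for d using z[OF that] by simp
    have z0: "z l' = 0" if l': "l' < r" for l'
    proof -
      have "0 = (\<Sum>d\<in>D. M l' d * ((\<Sum>c<r. N d c * z c) + y d * z r))" using z' by simp
      also have "\<dots> = (\<Sum>d\<in>D. \<Sum>c<r. M l' d * N d c * z c) + (\<Sum>d\<in>D. M l' d * y d) * z r"
        by (simp add: distrib_left sum.distrib sum_distrib_left sum_distrib_right mult.assoc)
      also have "(\<Sum>d\<in>D. \<Sum>c<r. M l' d * N d c * z c) = (\<Sum>c<r. (\<Sum>d\<in>D. M l' d * N d c) * z c)"
        unfolding sum_distrib_right by (rule sum.swap)
      also have "\<dots> = (\<Sum>c<r. if l' = c then w * z c else 0)"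
        using MN l' by (intro sum.cong) auto
      finally have "w * z l' = 0" using My l' by simp
      then show ?thesis using dom notin_nonzero[OF w] by blast
    qed
    then have "z r \<noteq> 0" using c less_Suc_eq by metis
    moreover have "y d * z r = 0" using z'[OF d(1)] z0 by simp
    ultimately have "y d = 0" using dom by blast
    then show ?thesis by (simp add: y_def)
  qed
  have "coordinates P M N r w D"
    using poly_prime_axioms by (intro coordinates.intro coordinates_axioms.intro finD w MN NM)
  then show ?thesis using e unfolding D_def by blast
qed

lemma koszul_exact_two_generated:
  assumes rs: "r = Suc s"
    and inj: "\<And>y. (\<And>l. l < r \<Longrightarrow> (\<Sum>j<s. \<phi> l j * y j) = 0) \<Longrightarrow> \<forall>j<s. y j = 0"
    and complex: "\<And>j. j < s \<Longrightarrow> (\<Sum>l<r. f l * \<phi> l j) = 0"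
    and exact: "\<And>z. (\<Sum>l<r. z l * f l) = 0 \<Longrightarrow> \<exists>y. \<forall>l<r. z l = (\<Sum>j<s. \<phi> l j * y j)"
    and f_nz: "\<exists>l<r. f l \<noteq> 0"
    and u: "u \<notin> P" and g1: "g1 = (\<Sum>l<r. a l * f l)" and g2: "g2 = (\<Sum>l<r. b l * f l)"
    and uf: "\<And>l. l < r \<Longrightarrow> u * f l = \<alpha> l * g1 + \<beta> l * g2"
    and cycle: "\<And>K. K \<subseteq> {..<s} \<Longrightarrow> kdiff s (\<lambda>j. lin_form r (\<lambda>l. \<phi> l j)) x K = 0"
    and empty: "homogeneous_form r m (x {})" "poly_eval (\<lambda>x. x) f (x {}) = 0"
  shows "\<exists>v y. v \<notin> P \<and> (\<forall>K\<subseteq>{..<s}. pconst v * x K = kdiff s (\<lambda>j. lin_form r (\<lambda>l. \<phi> l j)) y K)"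
proof -
  define M where "M = (\<lambda>l j. if j < s then \<phi> l j else if j = s then a l else b l)"
  \<comment> \<open>By \<open>uf\<close>, the vector u t_l - \<alpha>_l a - \<beta>_l b is a syzygy
    of f, hence in the column span of \<open>\<phi>\<close>. Its coefficients together with
    \<alpha>_l and \<beta>_l form the right inverse N0.\<close>
  have "\<exists>y. \<forall>l'<r. (if l' = l then u else 0) - \<alpha> l * a l' - \<beta> l * b l' = (\<Sum>j<s. \<phi> l' j * y j)"
    if l: "l < r" for l
  proof (rule exact)
    have "(\<Sum>l'<r. ((if l' = l then u else 0) - \<alpha> l * a l' - \<beta> l * b l') * f l')
        = (\<Sum>l'<r. if l' = l then u * f l' else 0) - \<alpha> l * g1 - \<beta> l * g2"
      unfolding g1 g2 sum_distrib_left sum_subtractf[symmetric]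
      by (intro sum.cong) (auto simp: algebra_simps)
    then show "(\<Sum>l'<r. ((if l' = l then u else 0) - \<alpha> l * a l' - \<beta> l * b l') * f l') = 0"
      using l uf[OF l] by simp
  qed
  then obtain Y where Y: "\<And>l l'. l < r \<Longrightarrow> l' < r \<Longrightarrow>
      (if l' = l then u else 0) - \<alpha> l * a l' - \<beta> l * b l' = (\<Sum>j<s. \<phi> l' j * Y l j)"
    by metis
  define N0 where "N0 = (\<lambda>j l. if j < s then Y l j else if j = s then \<alpha> l else \<beta> l)"
  have MN0: "(\<Sum>d<Suc r. M l' d * N0 d l) = (if l' = l then u else 0)" if "l < r" "l' < r" for l l'
  proof -
    have "(\<Sum>d<Suc r. M l' d * N0 d l) = (\<Sum>j<s. \<phi> l' j * Y l j) + a l' * \<alpha> l + b l' * \<beta> l"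
      unfolding rs by (simp add: M_def N0_def)
    then show ?thesis unfolding Y[OF that, symmetric] by (simp add: mult.commute)
  qed
  obtain e N w where e: "e < Suc r" and coord: "coordinates P M N r w ({..<Suc r} - {e})"
    using delete_column[OF u MN0] by blast
  interpret two_generated_at_prime P M N r w "{..<Suc r} - {e}" f s e
  proof (intro two_generated_at_prime.intro two_generated_at_prime_axioms.intro coord)
    show "{..<Suc r} - {e} = {..<Suc (Suc s)} - {e}" "e < Suc (Suc s)" using e rs by auto
  qed (use inj complex exact f_nz in \<open>auto simp: M_def\<close>)
  have "col j = lin_form r (\<lambda>l. \<phi> l j)" if "j < s" for j
    unfolding col_def using that by (intro lin_form_cong) (simp add: M_def)
  then have col: "kdiff s col z K = kdiff s (\<lambda>j. lin_form r (\<lambda>l. \<phi> l j)) z K" for z K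
    unfolding kdiff_def by (intro sum.cong) auto
  show ?thesis using koszul_exact_at_prime[of x m] cycle empty unfolding col by blast
qed

text \<open>Rank additivity by dependencies over the fraction field, relative to an index l0 with f
  l0 nonzero. For s > r - 1 the rows other than l0 have a common kernel vector, which also kills row
  l0 because f annihilates \<open>\<phi>\<close>, against injectivity.\<close>

lemma resolution_rank:
  assumes inj: "\<And>y. (\<And>l. l < r \<Longrightarrow> (\<Sum>j<s. \<phi> l j * y j) = (0::'b)) \<Longrightarrow> \<forall>j<s. y j = 0"
    and complex: "\<And>j. j < s \<Longrightarrow> (\<Sum>l<r. f l * \<phi> l j) = 0"
    and exact: "\<And>z. (\<Sum>l<r. z l * f l) = 0 \<Longrightarrow> \<exists>y. \<forall>l<r. z l = (\<Sum>j<s. \<phi> l j * y j)"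
    and f_nz: "\<exists>l<r. f l \<noteq> 0"
  shows "r = Suc s"
proof -
  obtain l0 where l0: "l0 < r" "f l0 \<noteq> 0" using f_nz by blast
  define L where "L = {..<r} - {l0}"
  have cardL: "finite L" "card L = r - 1" using l0 by (auto simp: L_def)
  have split: "(\<Sum>l<r. g l) = g l0 + sum g L" for g :: "nat \<Rightarrow> 'b"
    unfolding L_def using l0 by (subst sum.remove[of _ l0]) auto
  have "\<not> r - 1 < s"
  proof
    assume "r - 1 < s"
    then have "\<exists>y. (\<exists>c\<in>{..<s}. y c \<notin> {0}) \<and> (\<forall>l\<in>L. (\<Sum>j<s. \<phi> l j * y j) \<in> {0})"
      using cardL by (intro dependent_columns_mod_prime[OF zero_prime]) simp_all
    then obtain y c where c: "c < s" "y c \<noteq> 0" and y: "\<And>l. l \<in> L \<Longrightarrow> (\<Sum>j<s. \<phi> l j * y j) = 0"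
      by blast
    have "(\<Sum>l<r. f l * (\<Sum>j<s. \<phi> l j * y j)) = (\<Sum>j<s. (\<Sum>l<r. f l * \<phi> l j) * y j)"
      unfolding sum_distrib_left sum_distrib_right
      by (subst sum.swap) (simp only: mult.assoc)
    then have "f l0 * (\<Sum>j<s. \<phi> l0 j * y j) = 0"
      using complex y by (simp add: split)
    then have "(\<Sum>j<s. \<phi> l0 j * y j) = 0" using dom l0 by blast
    then have "(\<Sum>j<s. \<phi> l j * y j) = 0" if "l < r" for l
      using y that by (cases "l = l0") (auto simp: L_def)
    then show False using inj c by blast
  qed
  moreover have "\<not> s < r - 1"
  proof
    assume less: "s < r - 1"
    \<comment> \<open>The r - 1 syzygies f_l0 t_l - f_l t_l0 are independent, yet come from a module
      of rank s.\<close>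
    have "\<exists>y. \<forall>l'<r. (if l' = l then f l0 else if l' = l0 then - f l else 0) = (\<Sum>j<s. \<phi> l' j * y j)"
      if l: "l \<in> L" for l
    proof (rule exact)
      have "(\<Sum>l'\<in>L. (if l' = l then f l0 else if l' = l0 then - f l else 0) * f l')
          = (\<Sum>l'\<in>L. if l' = l then f l0 * f l else 0)"
        by (intro sum.cong) (auto simp: L_def)
      then show "(\<Sum>l'<r. (if l' = l then f l0 else if l' = l0 then - f l else 0) * f l') = 0"
        using l cardL unfolding split by (auto simp: L_def)
    qed
    then obtain Y where Y: "\<And>l l'. l \<in> L \<Longrightarrow> l' < r \<Longrightarrow>
        (if l' = l then f l0 else if l' = l0 then - f l else 0) = (\<Sum>j<s. \<phi> l' j * Y l j)" by metis
    have "\<exists>z. (\<exists>c\<in>L. z c \<notin> {0}) \<and> (\<forall>j\<in>{..<s}. (\<Sum>l\<in>L. Y l j * z l) \<in> {0})"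
      using cardL less by (intro dependent_columns_mod_prime[OF zero_prime]) simp_all
    then obtain z c where c: "c \<in> L" "z c \<noteq> 0" and z: "\<And>j. j < s \<Longrightarrow> (\<Sum>l\<in>L. Y l j * z l) = 0"
      by blast
    have cr: "c < r" "c \<noteq> l0" using c by (auto simp: L_def)
    have "(\<Sum>l\<in>L. (\<Sum>j<s. \<phi> c j * Y l j) * z l) = (\<Sum>j<s. \<phi> c j * (\<Sum>l\<in>L. Y l j * z l))"
      unfolding sum_distrib_left sum_distrib_right by (subst sum.swap) (simp only: mult.assoc)
    also have "\<dots> = 0" using z by simp
    also have "(\<Sum>l\<in>L. (\<Sum>j<s. \<phi> c j * Y l j) * z l) = (\<Sum>l\<in>L. if l = c then f l0 * z c else 0)"
    proof (rule sum.cong)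
      fix l assume "l \<in> L"
      then show "(\<Sum>j<s. \<phi> c j * Y l j) * z l = (if l = c then f l0 * z c else 0)"
        unfolding Y[OF \<open>l \<in> L\<close> cr(1), symmetric] using cr by auto
    qed simp
    finally have "f l0 * z c = 0" using c cardL by simp
    then show False using dom l0 c by blast
  qed
  ultimately show ?thesis using l0 by linarith
qed

end

section \<open>The strand of the Koszul complex\<close>

lemma finite_cx_basis: "finite (cx_basis r s m i)"
proof -
  have "cx_basis r s m i \<subseteq> Pow {..<s} \<times> {a. \<forall>k. (k \<in> {..<r} \<longrightarrow> a k \<in> {..m}) \<and> (k \<notin> {..<r} \<longrightarrow> a k = 0)}"
  proof
    fix b assume "b \<in> cx_basis r s m i"
    then obtain J a where b: "b = (J, a)" "J \<subseteq> {..<s}" "\<And>k. k \<ge> r \<Longrightarrow> a k = 0" "(\<Sum>k<r. a k) = m - i"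
      by (auto simp: cx_basis_def)
    have "a k \<le> m" if "k < r" for k
      using member_le_sum[of k "{..<r}" a] that b(4) by auto
    then show "b \<in> Pow {..<s} \<times> {a. \<forall>k. (k \<in> {..<r} \<longrightarrow> a k \<in> {..m}) \<and> (k \<notin> {..<r} \<longrightarrow> a k = 0)}"
      using b by auto
  qed
  moreover have "finite (Pow {..<s} \<times> {a. \<forall>k. (k \<in> {..<r} \<longrightarrow> a k \<in> {..m}) \<and> (k \<notin> {..<r} \<longrightarrow> a k = (0::nat))})"
    by (intro finite_cartesian_product finite_set_of_finite_funs) auto
  ultimately show ?thesis by (rule finite_subset)
qed

lemma cx_moduleD: "x \<in> cx_module r s m i \<Longrightarrow> b \<notin> cx_basis r s m i \<Longrightarrow> x b = 0"
  unfolding cx_module_def by blast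

text \<open>Inverts the summation over sources: for given j and l, only the basis element with j
  added to K and a' lowered at l can reach (K, a'). A source outside the basis contributes nothing,
  as x vanishes there.\<close>

lemma cx_diff_eq:
  assumes x: "x \<in> cx_module r s m i"
  shows "cx_diff r s m \<phi> i x (K, a') =
    (\<Sum>j\<in>{..<s} - K. (-1) ^ card {i\<in>K. i < j} *
      (\<Sum>l<r. \<phi> l j * (if 0 < a' l then x (insert j K, a'(l := a' l - 1)) else 0)))"
proof -
  define B where "B = cx_basis r s m i"
  have fin: "finite B" unfolding B_def by (rule finite_cx_basis)
  define t where "t = (\<lambda>J a j l. if K = J - {j} \<and> a' = a(l := Suc (a l))
      then (-1) ^ card {j'\<in>J. j' < j} * \<phi> l j else 0)"
  define G where "G = (\<lambda>b j l. if j \<in> fst b then x b * t (fst b) (snd b) j l else 0)"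
  define R where "R = (\<lambda>j l. if j \<notin> K \<and> 0 < a' l
      then (-1) ^ card {i\<in>K. i < j} * \<phi> l j * x (insert j K, a'(l := a' l - 1)) else 0)"
  have G: "G b j l = (if b = (insert j K, a'(l := a' l - 1)) then R j l else 0)" for b j l
  proof (cases "j \<in> fst b \<and> K = fst b - {j} \<and> a' = (snd b)(l := Suc (snd b l))")
    case True
    then have j: "j \<in> fst b" and K: "K = fst b - {j}" and a': "a' = (snd b)(l := Suc (snd b l))"
      by blast+
    have jK: "j \<notin> K" and fst_b: "fst b = insert j K" using j unfolding K by (blast, blast)
    have a'_l: "0 < a' l" and snd_b: "snd b = a'(l := a' l - 1)" unfolding a' by simp_all
    have "{j'\<in>fst b. j' < j} = {i\<in>K. i < j}" unfolding fst_b by auto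
    then have t: "t (fst b) (snd b) j l = (-1) ^ card {i\<in>K. i < j} * \<phi> l j"
      unfolding t_def if_P[OF conjI[OF K a']] by simp
    have b_eq: "b = (insert j K, a'(l := a' l - 1))" using fst_b snd_b by (simp add: prod_eq_iff)
    have R: "R j l = x (insert j K, a'(l := a' l - 1)) * ((-1) ^ card {i\<in>K. i < j} * \<phi> l j)"
      unfolding R_def using jK a'_l by (simp add: mult_ac)
    have "x b * t (fst b) (snd b) j l = R j l"
      unfolding t R b_eq[symmetric] ..
    then show ?thesis unfolding G_def if_P[OF j] if_P[OF b_eq] .
  next
    case False
    then have "G b j l = 0" by (auto simp: G_def t_def)
    moreover have "R j l = 0" if "b = (insert j K, a'(l := a' l - 1))"
    proof (rule ccontr)
      assume "R j l \<noteq> 0"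
      then have "j \<notin> K" "0 < a' l" by (auto simp: R_def split: if_splits)
      then have "j \<in> fst b" "K = fst b - {j}" "a' = (snd b)(l := Suc (snd b l))"
        unfolding that by (auto simp: fun_eq_iff)
      then show False using False by blast
    qed
    ultimately show ?thesis by simp
  qed
  have GR: "(\<Sum>b\<in>B. G b j l) = R j l" for j l
  proof -
    have "(\<Sum>b\<in>B. G b j l) = (if (insert j K, a'(l := a' l - 1)) \<in> B then R j l else 0)"
      unfolding G using fin by simp
    moreover have "R j l = 0" if "(insert j K, a'(l := a' l - 1)) \<notin> B"
      unfolding R_def using cx_moduleD[OF x] that unfolding B_def by simp
    ultimately show ?thesis by simp
  qed
  have "cx_diff r s m \<phi> i x (K, a') = (\<Sum>b\<in>B. \<Sum>j<s. \<Sum>l<r. G b j l)"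
    unfolding cx_diff_def B_def[symmetric] prod.case
  proof (rule sum.cong)
    fix b assume "b \<in> B"
    then have "fst b \<subseteq> {..<s}" by (auto simp: B_def cx_basis_def)
    then have "(\<Sum>j<s. if j \<in> fst b then \<Sum>l<r. t (fst b) (snd b) j l else 0)
        = (\<Sum>j\<in>fst b. \<Sum>l<r. t (fst b) (snd b) j l)"
      by (simp add: sum.If_cases Int_absorb1)
    moreover have "(\<Sum>j<s. \<Sum>l<r. G b j l)
        = x b * (\<Sum>j<s. if j \<in> fst b then \<Sum>l<r. t (fst b) (snd b) j l else 0)"
      unfolding sum_distrib_left by (intro sum.cong refl) (simp add: G_def sum_distrib_left)
    ultimately have "x b * (\<Sum>j\<in>fst b. \<Sum>l<r. t (fst b) (snd b) j l) = (\<Sum>j<s. \<Sum>l<r. G b j l)"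
      by simp
    then show "(case b of (J, a) \<Rightarrow> x (J, a) * (\<Sum>j\<in>J. \<Sum>l<r. if K = J - {j} \<and> a' = a(l := Suc (a l))
        then (- 1) ^ card {j' \<in> J. j' < j} * \<phi> l j else 0)) = (\<Sum>j<s. \<Sum>l<r. G b j l)"
      by (simp add: t_def case_prod_unfold)
  qed simp
  also have "\<dots> = (\<Sum>j<s. \<Sum>b\<in>B. \<Sum>l<r. G b j l)" by (rule sum.swap)
  also have "\<dots> = (\<Sum>j<s. \<Sum>l<r. R j l)"
    by (intro sum.cong refl) (subst sum.swap, simp add: GR)
  also have "\<dots> = (\<Sum>j\<in>{..<s} - K. \<Sum>l<r. R j l)"
    by (intro sum.mono_neutral_right) (auto simp: R_def)
  also have "\<dots> = (\<Sum>j\<in>{..<s} - K. (-1) ^ card {i\<in>K. i < j} *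
      (\<Sum>l<r. \<phi> l j * (if 0 < a' l then x (insert j K, a'(l := a' l - 1)) else 0)))"
    unfolding sum_distrib_left by (intro sum.cong refl) (auto simp: R_def mult.assoc)
  finally show ?thesis .
qed

lemma cx_basis_diff_source:
  assumes "(insert j K, a(l := a l - 1)) \<in> cx_basis r s m (Suc i)" "j \<notin> K" "0 < a l" "l < r"
  shows "(K, a) \<in> cx_basis r s m i"
proof -
  have fin: "finite K" and "K \<subseteq> {..<s}" using assms(1) finite_subset by (auto simp: cx_basis_def)
  have "(\<Sum>k<r. (a(l := a l - 1)) k) = (a l - 1) + (\<Sum>k\<in>{..<r} - {l}. a k)"
    using assms(4) by (subst sum.remove[of _ l]) auto
  moreover have "(\<Sum>k<r. a k) = a l + (\<Sum>k\<in>{..<r} - {l}. a k)"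
    using assms(4) by (subst sum.remove[of _ l]) auto
  ultimately have "(\<Sum>k<r. a k) = Suc (\<Sum>k<r. (a(l := a l - 1)) k)" using assms(3) by simp
  moreover have "a k = 0" if "k \<ge> r" for k using assms(1,4) that by (auto simp: cx_basis_def split: if_splits)
  ultimately show ?thesis using assms(1,2) fin \<open>K \<subseteq> {..<s}\<close> by (auto simp: cx_basis_def)
qed

lemma cx_basis_diff_target:
  assumes "(K, a) \<in> cx_basis r s m i" "j \<notin> K" "j < s" "0 < a l" "l < r"
  shows "(insert j K, a(l := a l - 1)) \<in> cx_basis r s m (Suc i)"
proof -
  have fin: "finite K" using assms(1) finite_subset by (auto simp: cx_basis_def)
  have "(\<Sum>k<r. (a(l := a l - 1)) k) = (a l - 1) + (\<Sum>k\<in>{..<r} - {l}. a k)"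
    using assms(5) by (subst sum.remove[of _ l]) auto
  moreover have "(\<Sum>k<r. a k) = a l + (\<Sum>k\<in>{..<r} - {l}. a k)"
    using assms(5) by (subst sum.remove[of _ l]) auto
  ultimately show ?thesis using assms fin by (auto simp: cx_basis_def)
qed

lemma cx_diff_mem:
  assumes x: "x \<in> cx_module r s m (Suc i)"
  shows "cx_diff r s m \<phi> (Suc i) x \<in> cx_module r s m i"
  unfolding cx_module_def
proof (intro CollectI allI impI)
  fix b assume b: "b \<notin> cx_basis r s m i"
  obtain K a where Ka: "b = (K, a)" by (cases b)
  have "(if 0 < a l then x (insert j K, a(l := a l - 1)) else 0) = 0" if "j \<in> {..<s} - K" "l < r" for j l
    using cx_basis_diff_source[of j K a l r s m i] b that cx_moduleD[OF x] unfolding Ka by auto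
  then show "cx_diff r s m \<phi> (Suc i) x b = 0"
    unfolding Ka cx_diff_eq[OF x] by simp
qed

text \<open>The coefficient of u_J as a polynomial in t. It translates the strand into the Koszul
  complex over the polynomial ring, where \<open>cx_diff\<close> becomes
  \<open>kdiff\<close>.\<close>

definition strand :: "(nat set \<times> (nat \<Rightarrow> nat) \<Rightarrow> 'a::comm_ring_1) \<Rightarrow> nat set \<Rightarrow> (nat \<Rightarrow>\<^sub>0 nat) \<Rightarrow>\<^sub>0 'a" where
  "strand x J = Abs_poly_mapping (\<lambda>a. x (J, Poly_Mapping.lookup a))"

lemma lookup_strand:
  assumes x: "x \<in> cx_module r s m i"
  shows "Poly_Mapping.lookup (strand x J) a = x (J, Poly_Mapping.lookup a)"
proof -
  have "finite {a. x (J, Poly_Mapping.lookup a) \<noteq> 0}"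
  proof (rule inj_on_finite[OF _ _ finite_cx_basis])
    show "inj_on (\<lambda>a. (J, Poly_Mapping.lookup a)) {a. x (J, Poly_Mapping.lookup a) \<noteq> 0}"
      by (auto simp: inj_on_def poly_mapping_eqI)
    show "(\<lambda>a. (J, Poly_Mapping.lookup a)) ` {a. x (J, Poly_Mapping.lookup a) \<noteq> 0} \<subseteq> cx_basis r s m i"
      using cx_moduleD[OF x] by auto
  qed
  then show ?thesis by (simp add: strand_def)
qed

lemma lookup_Abs_cx_basis:
  assumes "(J, a) \<in> cx_basis r s m i"
  shows "Poly_Mapping.lookup (Abs_poly_mapping a) = a"
proof -
  have "{k. a k \<noteq> 0} \<subseteq> {..<r}" using assms by (auto simp: cx_basis_def not_less[symmetric])
  then show ?thesis by (intro lookup_Abs_poly_mapping) (auto intro: finite_subset)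
qed

lemma lookup_minus_single:
  "Poly_Mapping.lookup (a - Poly_Mapping.single l 1) = (Poly_Mapping.lookup a)(l := Poly_Mapping.lookup a l - 1)"
  by (auto simp: fun_eq_iff lookup_minus lookup_single when_def)

lemma lookup_kdiff:
  fixes \<phi> :: "nat \<Rightarrow> nat \<Rightarrow> 'a::comm_ring_1"
  shows "Poly_Mapping.lookup (kdiff s (\<lambda>j. lin_form r (\<lambda>l. \<phi> l j)) X K) a =
    (\<Sum>j\<in>{..<s} - K. (-1) ^ card {i\<in>K. i < j} * (\<Sum>l<r. \<phi> l j *
      (if 0 < Poly_Mapping.lookup a l then Poly_Mapping.lookup (X (insert j K)) (a - Poly_Mapping.single l 1) else 0)))"
proof -
  have sign: "(- 1) ^ n = (pconst ((- 1) ^ n) :: (nat \<Rightarrow>\<^sub>0 nat) \<Rightarrow>\<^sub>0 'a)" for n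
    by (simp only: ring_hom_power[OF pconst_hom] ring_hom_uminus[OF pconst_hom] pconst_1)
  have lin: "Poly_Mapping.lookup (lin_form r b * p) a = (\<Sum>l<r. b l *
      (if 0 < Poly_Mapping.lookup a l then Poly_Mapping.lookup p (a - Poly_Mapping.single l 1) else 0))"
    for b and p :: "(nat \<Rightarrow>\<^sub>0 nat) \<Rightarrow>\<^sub>0 'a"
    by (simp only: lin_form_def sum_distrib_right lookup_sum mult.assoc lookup_pconst_mult lookup_pvar_mult)
  show ?thesis
    unfolding kdiff_def lookup_sum sign mult.assoc lookup_pconst_mult lin ..
qed

lemma strand_cx_diff:
  assumes x: "x \<in> cx_module r s m (Suc i)"
  shows "strand (cx_diff r s m \<phi> (Suc i) x) K = kdiff s (\<lambda>j. lin_form r (\<lambda>l. \<phi> l j)) (strand x) K"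
  by (rule poly_mapping_eqI)
    (simp only: lookup_strand[OF cx_diff_mem[OF x]] lookup_kdiff cx_diff_eq[OF x] lookup_strand[OF x]
      lookup_minus_single)

lemma strand_inject:
  assumes "x \<in> cx_module r s m i" "y \<in> cx_module r s m i" "\<And>K. K \<subseteq> {..<s} \<Longrightarrow> strand x K = strand y K"
  shows "x = y"
proof
  fix b :: "nat set \<times> (nat \<Rightarrow> nat)"
  obtain K a where b: "b = (K, a)" by (cases b)
  show "x b = y b"
  proof (cases "b \<in> cx_basis r s m i")
    case True
    then have "K \<subseteq> {..<s}" by (simp add: b cx_basis_def)
    have "x (K, Poly_Mapping.lookup (Abs_poly_mapping a)) = y (K, Poly_Mapping.lookup (Abs_poly_mapping a))"
      using assms(3)[OF \<open>K \<subseteq> {..<s}\<close>] lookup_strand[OF assms(1)] lookup_strand[OF assms(2)] by metis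
    then show ?thesis using lookup_Abs_cx_basis True unfolding b by metis
  qed (use assms cx_moduleD in metis)
qed

lemma strand_zero [simp]: "strand (\<lambda>_. 0) K = 0"
  by (simp add: strand_def)

lemma strand_smult:
  assumes "x \<in> cx_module r s m i"
  shows "strand (\<lambda>b. v * x b) K = pconst v * strand x K"
proof -
  have "(\<lambda>b. v * x b) \<in> cx_module r s m i" using assms by (simp add: cx_module_def)
  then show ?thesis
    by (intro poly_mapping_eqI) (simp add: lookup_strand lookup_pconst_mult lookup_strand[OF assms])
qed

lemma kdiff_zero [simp]: "kdiff s c (\<lambda>_. 0) K = 0"
  by (simp add: kdiff_def)

lemma cx_diff_cx_diff:
  assumes x: "x \<in> cx_module r s m (Suc (Suc i))"
  shows "cx_diff r s m \<phi> (Suc i) (cx_diff r s m \<phi> (Suc (Suc i)) x) = (\<lambda>_. 0)"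
proof (rule strand_inject)
  show "cx_diff r s m \<phi> (Suc i) (cx_diff r s m \<phi> (Suc (Suc i)) x) \<in> cx_module r s m i"
    by (intro cx_diff_mem x)
  show "(\<lambda>_. 0) \<in> cx_module r s m i" by (simp add: cx_module_def)
  show "strand (cx_diff r s m \<phi> (Suc i) (cx_diff r s m \<phi> (Suc (Suc i)) x)) K = strand (\<lambda>_. 0) K"
    if "K \<subseteq> {..<s}" for K
    unfolding strand_cx_diff[OF cx_diff_mem[OF x]] strand_cx_diff[OF x, abs_def]
    by (simp add: kdiff_kdiff[OF that])
qed

lemma keys_strand:
  assumes x: "x \<in> cx_module r s m i" and a: "a \<in> Poly_Mapping.keys (strand x J)"
  shows "(J, Poly_Mapping.lookup a) \<in> cx_basis r s m i"
  using a cx_moduleD[OF x] by (auto simp: in_keys_iff lookup_strand[OF x])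

lemma homogeneous_strand:
  assumes x: "x \<in> cx_module r s m i"
  shows "homogeneous_form r (m - i) (strand x J)"
  unfolding homogeneous_form_def
proof
  fix a assume "a \<in> Poly_Mapping.keys (strand x J)"
  then have *: "(J, Poly_Mapping.lookup a) \<in> cx_basis r s m i" by (rule keys_strand[OF x])
  then have keys: "Poly_Mapping.keys a \<subseteq> {..<r}" by (auto simp: cx_basis_def in_keys_iff not_less[symmetric])
  then have "tdeg a = (\<Sum>k<r. Poly_Mapping.lookup a k)" by (intro tdeg_superset) auto
  then show "Poly_Mapping.keys a \<subseteq> {..<r} \<and> tdeg a = m - i" using * keys by (simp add: cx_basis_def)
qed

lemma cx_aug_strand:
  assumes x: "x \<in> cx_module r s m 0"
  shows "cx_aug r s m f x = poly_eval (\<lambda>x. x) f (strand x {})"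
proof -
  let ?K = "Poly_Mapping.keys (strand x {})"
  have inj: "inj_on (\<lambda>a. ({} :: nat set, Poly_Mapping.lookup a)) ?K" by (auto simp: inj_on_def poly_mapping_eqI)
  have "cx_aug r s m f x = (\<Sum>b\<in>cx_basis r s m 0. x b * (\<Prod>l<r. f l ^ snd b l))"
    unfolding cx_aug_def by (simp add: case_prod_unfold)
  also have "\<dots> = (\<Sum>b\<in>(\<lambda>a. ({} :: nat set, Poly_Mapping.lookup a)) ` ?K. x b * (\<Prod>l<r. f l ^ snd b l))"
  proof (rule sum.mono_neutral_right)
    show "(\<lambda>a. ({} :: nat set, Poly_Mapping.lookup a)) ` ?K \<subseteq> cx_basis r s m 0"
      using keys_strand[OF x] by auto
    show "\<forall>b\<in>cx_basis r s m 0 - (\<lambda>a. ({} :: nat set, Poly_Mapping.lookup a)) ` ?K. x b * (\<Prod>l<r. f l ^ snd b l) = 0"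
    proof
      fix b assume b: "b \<in> cx_basis r s m 0 - (\<lambda>a. ({} :: nat set, Poly_Mapping.lookup a)) ` ?K"
      obtain J a where Ja: "b = (J, a)" by (cases b)
      have "finite J" using b unfolding Ja by (auto simp: cx_basis_def intro: finite_subset)
      then have J: "J = {}" using b unfolding Ja by (simp add: cx_basis_def)
      have a: "Poly_Mapping.lookup (Abs_poly_mapping a) = a"
        using b lookup_Abs_cx_basis unfolding Ja by blast
      have "Abs_poly_mapping a \<notin> ?K"
      proof
        assume "Abs_poly_mapping a \<in> ?K"
        then have "({}, Poly_Mapping.lookup (Abs_poly_mapping a)) \<in> (\<lambda>a. ({} :: nat set, Poly_Mapping.lookup a)) ` ?K"
          by (rule imageI)
        then show False using b unfolding Ja J a by simp
      qed
      then have "x b = 0" by (simp add: in_keys_iff lookup_strand[OF x] a Ja J)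
      then show "x b * (\<Prod>l<r. f l ^ snd b l) = 0" by simp
    qed
  qed (rule finite_cx_basis)
  also have "\<dots> = (\<Sum>a\<in>?K. x ({}, Poly_Mapping.lookup a) * (\<Prod>l<r. f l ^ Poly_Mapping.lookup a l))"
    by (subst sum.reindex[OF inj]) simp
  also have "\<dots> = poly_eval (\<lambda>x. x) f (strand x {})"
    unfolding poly_eval_def pm_extend_def
  proof (rule sum.cong)
    fix a assume "a \<in> ?K"
    then have "Poly_Mapping.keys a \<subseteq> {..<r}" using homogeneous_strand[OF x] by (simp add: homogeneous_form_def)
    then show "x ({}, Poly_Mapping.lookup a) * (\<Prod>l<r. f l ^ Poly_Mapping.lookup a l)
        = Poly_Mapping.lookup (strand x {}) a * monom_eval f a"
      by (simp add: lookup_strand[OF x] monom_eval_superset[of "{..<r}"])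
  qed simp
  finally show ?thesis .
qed

lemma cx_aug_cx_diff:
  assumes x: "x \<in> cx_module r s m (Suc 0)" and complex: "\<And>j. j < s \<Longrightarrow> (\<Sum>l<r. f l * \<phi> l j) = 0"
  shows "cx_aug r s m f (cx_diff r s m \<phi> (Suc 0) x) = 0"
proof -
  have "kdiff s (\<lambda>j. lin_form r (\<lambda>l. \<phi> l j)) (strand x) {} \<in> set_ideal (\<lambda>j. lin_form r (\<lambda>l. \<phi> l j)) {..<s}"
    using kdiff_in_seq_ideal unfolding seq_ideal_def .
  then have "poly_eval (\<lambda>x. x) f (kdiff s (\<lambda>j. lin_form r (\<lambda>l. \<phi> l j)) (strand x) {}) = 0"
    by (rule ring_hom_set_ideal_zero[OF poly_eval_hom[OF ring_hom_id], rotated])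
      (use complex in \<open>simp add: lin_form_eval[OF ring_hom_id] mult.commute\<close>)
  then show ?thesis unfolding cx_aug_strand[OF cx_diff_mem[OF x]] strand_cx_diff[OF x] .
qed

text \<open>Y may be inhomogeneous. Only its coefficients in the proper degree are kept, and these
  are all that \<open>kdiff\<close> uses for a coefficient in degree m - i, since the c_j are
  linear.\<close>

lemma kdiff_strand_lift:
  assumes x: "x \<in> cx_module r s m i"
    and Y: "\<And>K. K \<subseteq> {..<s} \<Longrightarrow> strand x K = kdiff s (\<lambda>j. lin_form r (\<lambda>l. \<phi> l j)) Y K"
  shows "\<exists>y\<in>cx_module r s m (Suc i). x = cx_diff r s m \<phi> (Suc i) y"
proof -
  define y where "y = (\<lambda>(J, a). if (J, a) \<in> cx_basis r s m (Suc i)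
      then Poly_Mapping.lookup (Y J) (Abs_poly_mapping a) else 0)"
  have y: "y \<in> cx_module r s m (Suc i)" by (auto simp: y_def cx_module_def)
  have "x = cx_diff r s m \<phi> (Suc i) y"
  proof
    fix b :: "nat set \<times> (nat \<Rightarrow> nat)"
    obtain K a where b: "b = (K, a)" by (cases b)
    show "x b = cx_diff r s m \<phi> (Suc i) y b"
    proof (cases "b \<in> cx_basis r s m i")
      case False
      then show ?thesis using cx_moduleD[OF x] cx_moduleD[OF cx_diff_mem[OF y]] by metis
    next
      case True
      define a' where "a' = Abs_poly_mapping a"
      have a': "Poly_Mapping.lookup a' = a"
        unfolding a'_def using True lookup_Abs_cx_basis unfolding b by blast
      have K: "K \<subseteq> {..<s}" using True by (simp add: b cx_basis_def)
      have "x b = Poly_Mapping.lookup (strand x K) a'" by (simp add: lookup_strand[OF x] a' b)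
      also have "\<dots> = (\<Sum>j\<in>{..<s} - K. (-1) ^ card {i\<in>K. i < j} * (\<Sum>l<r. \<phi> l j *
          (if 0 < a l then Poly_Mapping.lookup (Y (insert j K)) (a' - Poly_Mapping.single l 1) else 0)))"
        unfolding Y[OF K] lookup_kdiff a' ..
      also have "\<dots> = cx_diff r s m \<phi> (Suc i) y b"
        unfolding b cx_diff_eq[OF y]
      proof (intro sum.cong refl arg_cong2[of _ _ _ _ "(*)"] if_cong)
        fix j l assume j: "j \<in> {..<s} - K" and l: "l \<in> {..<r}" and al: "0 < a l"
        have "(insert j K, a(l := a l - 1)) \<in> cx_basis r s m (Suc i)"
          using True j l al unfolding b by (intro cx_basis_diff_target) auto
        moreover have "Abs_poly_mapping (a(l := a l - 1)) = a' - Poly_Mapping.single l 1"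
          using lookup_minus_single[of a' l] unfolding a' by (metis lookup_inverse)
        ultimately show "Poly_Mapping.lookup (Y (insert j K)) (a' - Poly_Mapping.single l 1)
            = y (insert j K, a(l := a l - 1))"
          by (simp add: y_def)
      qed
      finally show ?thesis .
    qed
  qed
  then show ?thesis using y by blast
qed

section \<open>Torsion and exactness\<close>

lemma ideal_gen_image: "ideal_gen (f ` {..<r}) = seq_ideal f r"
proof
  show "ideal_gen (f ` {..<r}) \<subseteq> seq_ideal f r"
    unfolding ideal_gen_def using is_ideal_seq_ideal[of f r] seq_ideal_gen[of _ r f] by blast
  show "seq_ideal f r \<subseteq> ideal_gen (f ` {..<r})"
  proof
    fix z assume "z \<in> seq_ideal f r"
    then obtain b where z: "z = (\<Sum>i<r. f i * b i)" by (auto simp: seq_ideal_def set_ideal_def)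
    have "z \<in> J" if "is_ideal J" "f ` {..<r} \<subseteq> J" for J
      unfolding z using that by (intro ideal_sum ideal_mult2) auto
    then show "z \<in> ideal_gen (f ` {..<r})" by (auto simp: ideal_gen_def)
  qed
qed

lemma is_ideal_ideal_gen: "is_ideal (ideal_gen S)"
  by (auto simp: ideal_gen_def is_ideal_def)

lemma ideal_gen_superset: "S \<subseteq> ideal_gen S"
  by (auto simp: ideal_gen_def)

lemma ideal_gen_least: "is_ideal J \<Longrightarrow> S \<subseteq> J \<Longrightarrow> ideal_gen S \<subseteq> J"
  by (auto simp: ideal_gen_def)

text \<open>Membership in an ideal of variables is decided monomial by monomial, which makes the
  variables a regular sequence by inspection.\<close>

lemma mem_seq_ideal_pvar:
  fixes z :: "('v \<Rightarrow>\<^sub>0 nat) \<Rightarrow>\<^sub>0 'b::comm_ring_1"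
  shows "z \<in> seq_ideal (\<lambda>i. pvar (e i)) k
    \<longleftrightarrow> (\<forall>a\<in>Poly_Mapping.keys z. \<exists>i<k. 0 < Poly_Mapping.lookup a (e i))"
proof
  assume "z \<in> seq_ideal (\<lambda>i. pvar (e i)) k"
  then obtain b where z: "z = (\<Sum>i<k. pvar (e i) * b i)" by (auto simp: seq_ideal_def set_ideal_def)
  show "\<forall>a\<in>Poly_Mapping.keys z. \<exists>i<k. 0 < Poly_Mapping.lookup a (e i)"
  proof
    fix a assume "a \<in> Poly_Mapping.keys z"
    then have "(\<Sum>i<k. Poly_Mapping.lookup (pvar (e i) * b i) a) \<noteq> 0"
      by (simp add: z in_keys_iff lookup_sum)
    then obtain i where "i < k" "Poly_Mapping.lookup (pvar (e i) * b i) a \<noteq> 0"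
      by (rule sum.not_neutral_contains_not_neutral) simp
    then show "\<exists>i<k. 0 < Poly_Mapping.lookup a (e i)"
      by (auto simp: lookup_pvar_mult split: if_splits)
  qed
next
  assume z: "\<forall>a\<in>Poly_Mapping.keys z. \<exists>i<k. 0 < Poly_Mapping.lookup a (e i)"
  have "z = (\<Sum>a\<in>Poly_Mapping.keys z. Poly_Mapping.single a (Poly_Mapping.lookup z a))"
    by (rule poly_mapping_eqI) (auto simp: lookup_sum lookup_single when_def in_keys_iff sum.delta)
  also have "\<dots> \<in> seq_ideal (\<lambda>i. pvar (e i)) k"
  proof (rule seq_ideal_sum)
    fix a assume "a \<in> Poly_Mapping.keys z"
    then obtain i where i: "i < k" "0 < Poly_Mapping.lookup a (e i)" using z by blast
    have "Poly_Mapping.single (e i) 1 + (a - Poly_Mapping.single (e i) 1) = a"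
      using i by (intro poly_mapping_eqI) (auto simp: lookup_add lookup_minus lookup_single when_def)
    then have "Poly_Mapping.single a (Poly_Mapping.lookup z a)
        = pvar (e i) * Poly_Mapping.single (a - Poly_Mapping.single (e i) 1) (Poly_Mapping.lookup z a)"
      by (simp add: pvar_mult_single)
    then show "Poly_Mapping.single a (Poly_Mapping.lookup z a) \<in> seq_ideal (\<lambda>i. pvar (e i)) k"
      using seq_ideal_mult2[OF seq_ideal_gen[OF i(1), of "\<lambda>i. pvar (e i)"]] by simp
  qed
  finally show "z \<in> seq_ideal (\<lambda>i. pvar (e i)) k" .
qed

lemma pvar_regular_sequence:
  fixes z :: "('v \<Rightarrow>\<^sub>0 nat) \<Rightarrow>\<^sub>0 'b::comm_ring_1"
  assumes e: "inj_on e {..<N}" "k < N" and z: "pvar (e k) * z \<in> seq_ideal (\<lambda>i. pvar (e i)) k"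
  shows "z \<in> seq_ideal (\<lambda>i. pvar (e i)) k"
  unfolding mem_seq_ideal_pvar
proof
  fix a assume a: "a \<in> Poly_Mapping.keys z"
  define a' where "a' = Poly_Mapping.single (e k) 1 + a"
  have "a' - Poly_Mapping.single (e k) 1 = a" by (simp add: a'_def)
  then have "a' \<in> Poly_Mapping.keys (pvar (e k) * z)"
    using a by (simp add: in_keys_iff lookup_pvar_mult) (simp add: a'_def lookup_add)
  then obtain i where i: "i < k" "0 < Poly_Mapping.lookup a' (e i)"
    using z unfolding mem_seq_ideal_pvar by blast
  moreover have "e i \<noteq> e k" using e i(1) by (auto simp: inj_on_def)
  ultimately show "\<exists>i<k. 0 < Poly_Mapping.lookup a (e i)"
    by (auto simp: a'_def lookup_add lookup_single when_def intro!: exI[of _ i])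
qed

lemma lookup_mult_zero:
  fixes p q :: "('v \<Rightarrow>\<^sub>0 nat) \<Rightarrow>\<^sub>0 'b::comm_ring_1"
  shows "Poly_Mapping.lookup (p * q) 0 = Poly_Mapping.lookup p 0 * Poly_Mapping.lookup q 0"
proof (induction p rule: poly_mapping_induct)
  case (single a c)
  show ?case
  proof (induction q rule: poly_mapping_induct)
    case (single b d)
    have "a + b = 0 \<longleftrightarrow> a = 0 \<and> b = 0"
      by (auto simp: poly_mapping_eq_iff fun_eq_iff lookup_add)
    then show ?case by (simp add: mult_single lookup_single when_def)
  qed (simp add: lookup_add algebra_simps)
qed (simp add: lookup_add algebra_simps)

lemma is_ideal_max_ideal: "is_ideal (max_ideal :: ('v::finite, 'k::comm_ring_1) mpoly set)"
  by (simp add: is_ideal_def max_ideal_def lookup_add lookup_mult_zero)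

lemma pvar_in_max_ideal: "pvar v \<in> (max_ideal :: ('v::finite, 'k::comm_ring_1) mpoly set)"
proof -
  have "Poly_Mapping.single v (1::nat) \<noteq> 0"
    by (metis lookup_single_eq lookup_zero zero_neq_one)
  then show ?thesis by (simp add: max_ideal_def pvar_def lookup_single when_def)
qed

lemma poly_prime_mpoly:
  assumes "is_prime_ideal (P :: ('v::finite, 'k::field) mpoly set)"
  shows "poly_prime P"
  by (intro poly_prime.intro assms mpoly_no_zero_divisors mpoly_poly_no_zero_divisors)

lemma zero_prime_mpoly: "is_prime_ideal {0 :: ('v::finite, 'k::field) mpoly}"
proof -
  have "1 \<notin> {0 :: ('v, 'k) mpoly}" by simp
  then have "{0 :: ('v, 'k) mpoly} \<noteq> UNIV" by blast
  then show ?thesis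
    unfolding is_prime_ideal_def is_ideal_def
    using mpoly_no_zero_divisors[where 'v = 'v and 'k = 'k] by auto
qed

lemma height_zero_ideal: "height {0 :: ('v::finite, 'k::field) mpoly} = 0"
proof -
  have "k = 0" if "prime_chain C k" "C k = {0}" for C :: "nat \<Rightarrow> ('v, 'k) mpoly set" and k
  proof (rule ccontr)
    assume "k \<noteq> 0"
    then obtain j where k: "k = Suc j" by (cases k) auto
    then have "is_prime_ideal (C j)" "C j \<subset> {0}" using that by (auto simp: prime_chain_def)
    then show False using ideal_zero prime_ideal_ideal by blast
  qed
  then have "height_prime {0 :: ('v, 'k) mpoly} \<le> 0"
    unfolding height_prime_def by (intro SUP_least) (auto simp: zero_enat_def)
  moreover have "height {0 :: ('v, 'k) mpoly} \<le> height_prime {0 :: ('v, 'k) mpoly}"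
    unfolding height_def using zero_prime_mpoly by (intro INF_lower) auto
  ultimately show ?thesis by (metis le_zero_eq order.trans)
qed

lemma cx_diff_add: "cx_diff r s m \<phi> i (\<lambda>b. x b + y b) = (\<lambda>b. cx_diff r s m \<phi> i x b + cx_diff r s m \<phi> i y b)"
  unfolding cx_diff_def
  by (simp add: fun_eq_iff case_prod_unfold distrib_right sum.distrib)

lemma cx_diff_smult: "cx_diff r s m \<phi> i (\<lambda>b. v * x b) = (\<lambda>b. v * cx_diff r s m \<phi> i x b)"
  unfolding cx_diff_def
  by (simp add: fun_eq_iff case_prod_unfold sum_distrib_left mult.assoc)

lemma cx_aug_add: "cx_aug r s m f (\<lambda>b. x b + y b) = cx_aug r s m f x + cx_aug r s m f y"
  unfolding cx_aug_def by (simp add: case_prod_unfold distrib_right sum.distrib)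

lemma cx_aug_smult: "cx_aug r s m f (\<lambda>b. v * x b) = v * cx_aug r s m f x"
  unfolding cx_aug_def by (simp add: case_prod_unfold sum_distrib_left mult.assoc)

lemma cx_diff_zero: "cx_diff r s m \<phi> i (\<lambda>_. 0) = (\<lambda>_. 0)"
  using cx_diff_smult[of r s m \<phi> i 0 "\<lambda>_. 0"] by simp

lemma cx_basis_empty:
  assumes "m < i \<or> s < i"
  shows "cx_basis r s m i = {}"
proof (rule ccontr)
  assume "cx_basis r s m i \<noteq> {}"
  then obtain J a where "(J, a) \<in> cx_basis r s m i" by (metis ex_in_conv surj_pair)
  then have "J \<subseteq> {..<s}" "card J = i" "i \<le> m" by (simp_all add: cx_basis_def)
  moreover from this have "card J \<le> s" using card_mono[of "{..<s}" J] by simp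
  ultimately show False using assms by linarith
qed

text \<open>The local condition covers all primes other than the maximal ideal, including those not
  containing the ideal of f. The generators are given as combinations of the f_l, so they lie in
  that ideal.\<close>

locale locally_two_generated =
  fixes f :: "nat \<Rightarrow> ('v::finite, 'k::field) mpoly" and \<phi> :: "nat \<Rightarrow> nat \<Rightarrow> ('v, 'k) mpoly"
    and r s :: nat
  assumes inj: "\<And>y. (\<And>l. l < r \<Longrightarrow> (\<Sum>j<s. \<phi> l j * y j) = 0) \<Longrightarrow> \<forall>j<s. y j = 0"
    and complex: "\<And>j. j < s \<Longrightarrow> (\<Sum>l<r. f l * \<phi> l j) = 0"
    and exact: "\<And>z. (\<Sum>l<r. z l * f l) = 0 \<Longrightarrow> \<exists>y. \<forall>l<r. z l = (\<Sum>j<s. \<phi> l j * y j)"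
    and f_nz: "\<exists>l<r. f l \<noteq> 0"
    and two_generated: "\<And>P. is_prime_ideal P \<Longrightarrow> P \<noteq> max_ideal \<Longrightarrow>
      \<exists>u a b \<alpha> \<beta>. u \<notin> P \<and> (\<forall>l<r. u * f l = \<alpha> l * (\<Sum>l<r. a l * f l) + \<beta> l * (\<Sum>l<r. b l * f l))"
begin

lemma rank: "r = Suc s"
  by (rule poly_prime.resolution_rank[OF poly_prime_mpoly[OF zero_prime_mpoly] inj complex exact f_nz])

lemma cycles_torsion:
  assumes x: "x \<in> cx_module r s m i"
    and cycle: "if i = 0 then cx_aug r s m f x = 0 else cx_diff r s m \<phi> i x = (\<lambda>_. 0)"
  shows "\<exists>n. \<exists>y\<in>cx_module r s m (Suc i). (\<lambda>b. pvar v ^ n * x b) = cx_diff r s m \<phi> (Suc i) y"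
proof (rule ccontr)
  assume neg: "\<not> ?thesis"
  \<comment> \<open>The annihilator of the class of x modulo boundaries. If it misses all powers of
    the variable, some prime contains it and avoids the variable; exactness at that prime then puts
    an element outside it into J.\<close>
  define J where "J = {a. \<exists>y\<in>cx_module r s m (Suc i). (\<lambda>b. a * x b) = cx_diff r s m \<phi> (Suc i) y}"
  have "is_ideal J"
    unfolding is_ideal_def
  proof (intro conjI ballI allI)
    show "0 \<in> J"
      unfolding J_def by (auto intro!: bexI[of _ "\<lambda>_. 0"] simp: cx_diff_zero cx_module_def)
    show "p + q \<in> J" if pq: "p \<in> J" "q \<in> J" for p q
    proof -
      obtain y z where y: "y \<in> cx_module r s m (Suc i)" "(\<lambda>b. p * x b) = cx_diff r s m \<phi> (Suc i) y"
        and z: "z \<in> cx_module r s m (Suc i)" "(\<lambda>b. q * x b) = cx_diff r s m \<phi> (Suc i) z"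
        using pq by (auto simp: J_def)
      have "(\<lambda>b. (p + q) * x b) = cx_diff r s m \<phi> (Suc i) (\<lambda>b. y b + z b)"
        unfolding cx_diff_add y(2)[symmetric] z(2)[symmetric] by (simp add: distrib_right)
      moreover have "(\<lambda>b. y b + z b) \<in> cx_module r s m (Suc i)" using y z by (simp add: cx_module_def)
      ultimately show ?thesis unfolding J_def by blast
    qed
    show "q * p \<in> J" if "p \<in> J" for p q
    proof -
      obtain y where y: "y \<in> cx_module r s m (Suc i)" "(\<lambda>b. p * x b) = cx_diff r s m \<phi> (Suc i) y"
        using \<open>p \<in> J\<close> by (auto simp: J_def)
      have "(\<lambda>b. (q * p) * x b) = cx_diff r s m \<phi> (Suc i) (\<lambda>b. q * y b)"
        unfolding cx_diff_smult y(2)[symmetric] by (simp add: mult.assoc)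
      moreover have "(\<lambda>b. q * y b) \<in> cx_module r s m (Suc i)" using y by (simp add: cx_module_def)
      ultimately show ?thesis unfolding J_def by blast
    qed
  qed
  moreover have "pvar v ^ n \<notin> J" for n using neg by (auto simp: J_def)
  ultimately obtain P where P: "is_prime_ideal P" "J \<subseteq> P" "pvar v \<notin> P"
    using prime_ideal_avoiding_powers[of J "pvar v"] by blast
  have "P \<noteq> max_ideal" using P(3) pvar_in_max_ideal by blast
  from two_generated[OF P(1) this] obtain u a b \<alpha> \<beta> where
    u_uf: "u \<notin> P \<and> (\<forall>l<r. u * f l = \<alpha> l * (\<Sum>l<r. a l * f l) + \<beta> l * (\<Sum>l<r. b l * f l))"
    by (elim exE) (rule that)
  note u = conjunct1[OF u_uf] and uf = conjunct2[OF u_uf, rule_format]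
  define c where "c = (\<lambda>j. lin_form r (\<lambda>l. \<phi> l j))"
  have strand_empty: "strand x {} = 0" if "i \<noteq> 0"
  proof (rule poly_mapping_eqI)
    fix a' show "Poly_Mapping.lookup (strand x {}) a' = Poly_Mapping.lookup 0 a'"
      using that cx_moduleD[OF x] by (simp add: lookup_strand[OF x] cx_basis_def)
  qed
  have "kdiff s c (strand x) K = 0" for K
  proof (cases i)
    case 0
    have "strand x (insert j K) = 0" if j: "j \<in> {..<s} - K" for j
    proof (rule poly_mapping_eqI)
      fix a'
      have "(insert j K, Poly_Mapping.lookup a') \<notin> cx_basis r s m i"
      proof
        assume "(insert j K, Poly_Mapping.lookup a') \<in> cx_basis r s m i"
        then have "insert j K \<subseteq> {..<s}" "card (insert j K) = 0" using 0 by (simp_all add: cx_basis_def)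
        moreover from this(1) have "finite (insert j K)" by (rule finite_subset) simp
        ultimately show False by simp
      qed
      then show "Poly_Mapping.lookup (strand x (insert j K)) a' = Poly_Mapping.lookup 0 a'"
        using cx_moduleD[OF x] by (simp add: lookup_strand[OF x])
    qed
    then show ?thesis unfolding kdiff_def by simp
  next
    case (Suc i')
    then have x': "x \<in> cx_module r s m (Suc i')" using x by simp
    show ?thesis
      unfolding c_def strand_cx_diff[OF x', symmetric] using cycle Suc by simp
  qed
  moreover have "homogeneous_form r (m - i) (strand x {})" by (rule homogeneous_strand[OF x])
  moreover have "poly_eval (\<lambda>x. x) f (strand x {}) = 0"
  proof (cases "i = 0")
    case True then show ?thesis using cycle x cx_aug_strand[of x r s m f] by simp
  next
    case False then show ?thesis
      using strand_empty ring_hom_zero[OF poly_eval_hom[OF ring_hom_id]] by simp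
  qed
  ultimately obtain w Y where w: "w \<notin> P" and Y: "\<And>K. K \<subseteq> {..<s} \<Longrightarrow> pconst w * strand x K = kdiff s c Y K"
    using poly_prime.koszul_exact_two_generated[OF poly_prime_mpoly[OF P(1)] rank inj complex exact f_nz u refl refl uf,
        where x = "strand x" and m = "m - i"]
    unfolding c_def by blast
  have wx: "(\<lambda>b. w * x b) \<in> cx_module r s m i" using x by (simp add: cx_module_def)
  have "\<exists>y\<in>cx_module r s m (Suc i). (\<lambda>b. w * x b) = cx_diff r s m \<phi> (Suc i) y"
    by (rule kdiff_strand_lift[OF wx, of \<phi> Y])
      (simp add: strand_smult[OF x] Y c_def[symmetric])
  then have "w \<in> J" by (simp add: J_def)
  then show False using w P(2) by blast
qed

lemma exact_strand:
  assumes bound: "min s m < card (UNIV :: 'v set)"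
    and x: "x \<in> cx_module r s m i"
    and cycle: "if i = 0 then cx_aug r s m f x = 0 else cx_diff r s m \<phi> i x = (\<lambda>_. 0)"
  shows "\<exists>y\<in>cx_module r s m (Suc i). x = cx_diff r s m \<phi> (Suc i) y"
proof -
  define b0 :: "nat set \<times> (nat \<Rightarrow> nat)" where "b0 = ({}, \<lambda>_. 0)"
  \<comment> \<open>Position 0 is R, the target of the augmentation, with the single basis label b0;
    the strand is shifted up by one. Exactness at Sym^m G thus becomes exactness in degree
    1.\<close>
  define B where "B = case_nat {b0} (cx_basis r s m)"
  define d :: "nat \<Rightarrow> (nat set \<times> (nat \<Rightarrow> nat) \<Rightarrow> ('v, 'k) mpoly) \<Rightarrow> nat set \<times> (nat \<Rightarrow> nat) \<Rightarrow> ('v, 'k) mpoly"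
    where "d = case_nat (\<lambda>_ _. 0)
      (case_nat (\<lambda>x b. if b = b0 then cx_aug r s m f x else 0) (\<lambda>j. cx_diff r s m \<phi> (Suc j)))"
  have d_simps: "d 0 = (\<lambda>_ _. 0)" "d (Suc 0) = (\<lambda>x b. if b = b0 then cx_aug r s m f x else 0)"
    "d (Suc (Suc j)) = cx_diff r s m \<phi> (Suc j)" for j by (simp_all add: d_def)
  define L where "L = (\<lambda>i. {y :: nat set \<times> (nat \<Rightarrow> nat) \<Rightarrow> ('v, 'k) mpoly. \<forall>b. b \<notin> B i \<longrightarrow> y b = 0})"
  have L: "L (Suc j) = cx_module r s m j" for j by (simp add: L_def B_def cx_module_def)
  have L0: "L 0 = {y. \<forall>b. b \<noteq> b0 \<longrightarrow> y b = 0}" by (simp add: L_def B_def)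
  interpret free_complex B d L
  proof (unfold_locales)
    show "L j = {y. \<forall>b. b \<notin> B j \<longrightarrow> y b = 0}" for j by (simp add: L_def)
    show "d (Suc j) y \<in> L j" if "y \<in> L (Suc j)" for y j
      using that by (cases j) (auto simp: d_simps L L0 intro: cx_diff_mem)
    show "d j (\<lambda>b. y b + z b) = (\<lambda>b. d j y b + d j z b)" for j y z
      by (cases j; cases "j - 1") (auto simp: d_simps cx_diff_add cx_aug_add)
    show "d j (\<lambda>b. a * y b) = (\<lambda>b. a * d j y b)" for j a y
      by (cases j; cases "j - 1") (auto simp: d_simps cx_diff_smult cx_aug_smult)
    show "d (Suc j) (d (Suc (Suc j)) y) = (\<lambda>_. 0)" if "y \<in> L (Suc (Suc j))" for j y
      using that by (cases j) (auto simp: d_simps L cx_diff_cx_diff cx_aug_cx_diff complex)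
  qed
  obtain e :: "nat \<Rightarrow> 'v" where e: "bij_betw e {..<card (UNIV :: 'v set)} UNIV"
    using ex_bij_betw_nat_finite[of "UNIV :: 'v set"] by (auto simp: atLeast0LessThan)
  have "\<exists>w\<in>L (Suc (Suc i)). x = d (Suc (Suc i)) w"
  proof (rule acyclicity[where N = "card (UNIV :: 'v set)" and x = "\<lambda>i. pvar (e i)"])
    show "z \<in> seq_ideal (\<lambda>i. pvar (e i)) k" if "k < card (UNIV :: 'v set)" "pvar (e k) * z \<in> seq_ideal (\<lambda>i. pvar (e i)) k"
      for k and z :: "('v, 'k) mpoly"
      using pvar_regular_sequence[OF bij_betw_imp_inj_on[OF e] that] .
    show "\<exists>a. \<exists>w\<in>L (Suc j). (\<lambda>b. pvar (e k) ^ a * z b) = d (Suc j) w"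
      if j: "1 \<le> j" and z: "z \<in> L j" "d j z = (\<lambda>_. 0)" for j z k
    proof -
      obtain j' where j': "j = Suc j'" using j by (cases j) auto
      have "if j' = 0 then cx_aug r s m f z = 0 else cx_diff r s m \<phi> j' z = (\<lambda>_. 0)"
      proof (cases j')
        case 0
        then have "(\<lambda>b. if b = b0 then cx_aug r s m f z else 0) = (\<lambda>_. 0)"
          using z(2) j' by (simp only: d_simps)
        from fun_cong[OF this, of b0] show ?thesis using 0 by simp
      next
        case (Suc j'') then show ?thesis using z(2) j' by (simp add: d_simps)
      qed
      then show ?thesis
        using cycles_torsion[of z m j' "e k"] z(1) unfolding j' L d_simps by blast
    qed
    show "B j = {}" if "card (UNIV :: 'v set) < j" for j
    proof -
      \<comment> \<open>Position j holds strand degree j - 1, which is zero beyond min s m; the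
        strict bound absorbs the shift.\<close>
      have "m < j - 1 \<or> s < j - 1" using bound that by linarith
      then show ?thesis using that by (cases j) (auto simp: B_def cx_basis_empty)
    qed
    show "1 \<le> Suc i" by simp
    show "x \<in> L (Suc i)" using x by (simp add: L)
    show "d (Suc i) x = (\<lambda>_. 0)" using cycle by (cases i) (auto simp: d_simps)
  qed
  then show ?thesis by (simp add: L d_simps)
qed

end

section \<open>The image in the power of the ideal\<close>

lemma homogeneous_form_one: "homogeneous_form r 0 1"
  by (simp add: homogeneous_form_def tdeg_def)

lemma homogeneous_form_mult:
  assumes F: "homogeneous_form r m F" and G: "homogeneous_form r n G"
  shows "homogeneous_form r (m + n) (F * G)"
  unfolding homogeneous_form_def
proof
  fix c assume "c \<in> Poly_Mapping.keys (F * G)"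
  then obtain a b where ab: "c = a + b" "a \<in> Poly_Mapping.keys F" "b \<in> Poly_Mapping.keys G"
    using keys_mult[of F G] by blast
  then have "Poly_Mapping.keys a \<subseteq> {..<r}" "tdeg a = m" "Poly_Mapping.keys b \<subseteq> {..<r}" "tdeg b = n"
    using F G by (simp_all add: homogeneous_form_def)
  then show "Poly_Mapping.keys c \<subseteq> {..<r} \<and> tdeg c = m + n"
    using keys_add[of a b] unfolding ab(1) tdeg_add by blast
qed

lemma homogeneous_form_prod:
  "(\<And>k. k < m \<Longrightarrow> homogeneous_form r 1 (F k)) \<Longrightarrow> homogeneous_form r m (\<Prod>k<m. F k)"
proof (induction m)
  case 0 show ?case by (simp add: homogeneous_form_one)
next
  case (Suc m)
  then have "homogeneous_form r (m + 1) ((\<Prod>k<m. F k) * F m)" by (intro homogeneous_form_mult) simp_all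
  then show ?case by simp
qed

lemma homogeneous_form_strand:
  assumes F: "homogeneous_form r m F"
  obtains x where "x \<in> cx_module r s m 0" "strand x {} = F"
proof -
  define x where "x = (\<lambda>(J, a). if (J, a) \<in> cx_basis r s m 0 then Poly_Mapping.lookup F (Abs_poly_mapping a) else 0)"
  have x: "x \<in> cx_module r s m 0" by (auto simp: x_def cx_module_def)
  have "strand x {} = F"
  proof (rule poly_mapping_eqI)
    fix a
    show "Poly_Mapping.lookup (strand x {}) a = Poly_Mapping.lookup F a"
    proof (cases "({}, Poly_Mapping.lookup a) \<in> cx_basis r s m 0")
      case True then show ?thesis unfolding lookup_strand[OF x] by (simp add: x_def lookup_inverse)
    next
      case False
      have "a \<notin> Poly_Mapping.keys F"
      proof
        assume "a \<in> Poly_Mapping.keys F"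
        then have a: "Poly_Mapping.keys a \<subseteq> {..<r}" "tdeg a = m" using F by (auto simp: homogeneous_form_def)
        then have "(\<Sum>k<r. Poly_Mapping.lookup a k) = m" using tdeg_superset[of "{..<r}" a] by simp
        moreover have "Poly_Mapping.lookup a k = 0" if "k \<ge> r" for k
          using a(1) that by (meson in_keys_iff lessThan_iff not_less subsetD)
        ultimately show False using False by (simp add: cx_basis_def)
      qed
      then show ?thesis using False unfolding lookup_strand[OF x] by (simp add: x_def in_keys_iff)
    qed
  qed
  then show thesis using x that by blast
qed

lemma monomial_as_product:
  fixes f :: "nat \<Rightarrow> 'a::comm_ring_1"
  assumes "(\<Sum>l<r. a l) = m"
  shows "\<exists>y. (\<forall>k<m. y k \<in> f ` {..<r}) \<and> (\<Prod>l<r. f l ^ a l) = (\<Prod>k<m. y k)"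
  using assms
proof (induction m arbitrary: a)
  case 0 then show ?case by simp
next
  case (Suc m)
  then obtain l where l: "l < r" "0 < a l"
    by (metis (no_types, lifting) gr0I lessThan_iff sum.neutral nat.distinct(1))
  define a' where "a' = a(l := a l - 1)"
  have "(\<Sum>k<r. a' k) = (a l - 1) + (\<Sum>k\<in>{..<r} - {l}. a k)"
    using l by (subst sum.remove[of _ l]) (auto simp: a'_def)
  moreover have "(\<Sum>k<r. a k) = a l + (\<Sum>k\<in>{..<r} - {l}. a k)"
    using l by (subst sum.remove[of _ l]) auto
  ultimately have "(\<Sum>k<r. a' k) = m" using Suc.prems l by simp
  then obtain y where y: "\<forall>k<m. y k \<in> f ` {..<r}" "(\<Prod>k<r. f k ^ a' k) = (\<Prod>k<m. y k)"
    using Suc.IH by blast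
  have "(\<Prod>k<r. f k ^ a k) = f l ^ a l * (\<Prod>k\<in>{..<r} - {l}. f k ^ a k)"
    using l by (subst prod.remove[of _ l]) auto
  also have "f l ^ a l = f l * f l ^ (a l - 1)" using l by (metis power_eq_if less_numeral_extra(3))
  also have "f l * f l ^ (a l - 1) * (\<Prod>k\<in>{..<r} - {l}. f k ^ a k) = f l * (\<Prod>k<r. f k ^ a' k)"
    using l by (subst prod.remove[of "{..<r}" l]) (auto simp: a'_def mult.assoc intro!: prod.cong)
  finally have "(\<Prod>k<r. f k ^ a k) = (\<Prod>k<Suc m. (y(m := f l)) k)" by (simp add: y(2) mult.commute)
  moreover have "\<forall>k<Suc m. (y(m := f l)) k \<in> f ` {..<r}" using y(1) l by (auto simp: less_Suc_eq)
  ultimately show ?case by blast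
qed

lemma cx_aug_image: "cx_aug r s m f ` cx_module r s m 0 = ideal_pow (ideal_gen (f ` {..<r})) m"
proof
  show "cx_aug r s m f ` cx_module r s m 0 \<subseteq> ideal_pow (ideal_gen (f ` {..<r})) m"
  proof clarify
    fix x :: "nat set \<times> (nat \<Rightarrow> nat) \<Rightarrow> 'a"
    show "cx_aug r s m f x \<in> ideal_pow (ideal_gen (f ` {..<r})) m"
      unfolding cx_aug_def ideal_pow_def
    proof (intro ideal_sum is_ideal_ideal_gen)
      fix b assume b: "b \<in> cx_basis r s m 0"
      obtain J a where Ja: "b = (J, a)" by (cases b)
      then have "(\<Sum>l<r. a l) = m" using b by (simp add: cx_basis_def)
      from monomial_as_product[OF this, of f]
      obtain y where y: "\<forall>k<m. y k \<in> f ` {..<r}" "(\<Prod>l<r. f l ^ a l) = (\<Prod>k<m. y k)"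
        by (elim exE conjE) (rule that)
      have "\<forall>k<m. y k \<in> ideal_gen (f ` {..<r})"
        using y(1) subsetD[OF ideal_gen_superset[of "f ` {..<r}"]] by simp
      then have "(\<Prod>l<r. f l ^ a l) \<in> {(\<Prod>k<m. y k) | y. \<forall>k<m. y k \<in> ideal_gen (f ` {..<r})}"
        using y(2) by (intro CollectI exI[of _ y] conjI)
      from subsetD[OF ideal_gen_superset this] show "(case b of (J, a) \<Rightarrow> x (J, a) * (\<Prod>l<r. f l ^ a l))
          \<in> ideal_gen {(\<Prod>k<m. y k) | y. \<forall>k<m. y k \<in> ideal_gen (f ` {..<r})}"
        unfolding Ja prod.case by (rule ideal_mult[OF is_ideal_ideal_gen])
    qed
  qed
  show "ideal_pow (ideal_gen (f ` {..<r})) m \<subseteq> cx_aug r s m f ` cx_module r s m 0"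
    unfolding ideal_pow_def
  proof (rule ideal_gen_least)
    show "is_ideal (cx_aug r s m f ` cx_module r s m 0)"
      unfolding is_ideal_def
    proof (intro conjI ballI allI)
      have "cx_aug r s m f (\<lambda>_. 0) = 0" by (simp add: cx_aug_def)
      moreover have "(\<lambda>_. 0) \<in> cx_module r s m 0" by (simp add: cx_module_def)
      ultimately show "0 \<in> cx_aug r s m f ` cx_module r s m 0" by (metis imageI)
      show "p + q \<in> cx_aug r s m f ` cx_module r s m 0"
        if pq: "p \<in> cx_aug r s m f ` cx_module r s m 0" "q \<in> cx_aug r s m f ` cx_module r s m 0" for p q
      proof -
        obtain x y where x: "x \<in> cx_module r s m 0" "p = cx_aug r s m f x"
          and y: "y \<in> cx_module r s m 0" "q = cx_aug r s m f y" using pq by blast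
        have "(\<lambda>b. x b + y b) \<in> cx_module r s m 0" using x y by (simp add: cx_module_def)
        then show ?thesis unfolding x(2) y(2) cx_aug_add[symmetric] by (rule imageI)
      qed
      show "c * p \<in> cx_aug r s m f ` cx_module r s m 0"
        if p: "p \<in> cx_aug r s m f ` cx_module r s m 0" for p c
      proof -
        obtain x where x: "x \<in> cx_module r s m 0" "p = cx_aug r s m f x" using p by blast
        have "(\<lambda>b. c * x b) \<in> cx_module r s m 0" using x by (simp add: cx_module_def)
        then show ?thesis unfolding x(2) cx_aug_smult[symmetric] by (rule imageI)
      qed
    qed
    show "{(\<Prod>k<m. y k) | y. \<forall>k<m. y k \<in> ideal_gen (f ` {..<r})} \<subseteq> cx_aug r s m f ` cx_module r s m 0"
    proof clarify
      fix y assume y: "\<forall>k<m. y k \<in> ideal_gen (f ` {..<r})"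
      then have "\<forall>k. \<exists>b. k < m \<longrightarrow> y k = (\<Sum>i<r. f i * b i)"
        by (auto simp: ideal_gen_image seq_ideal_def set_ideal_def)
      then obtain b where b: "\<And>k. k < m \<Longrightarrow> y k = (\<Sum>i<r. f i * b k i)" by metis
      \<comment> \<open>Each factor is the value at f of a linear form in t, so the product is the
        value of a form of degree m, that is, of an element of Sym^m G.\<close>
      define F where "F = (\<Prod>k<m. lin_form r (b k))"
      have "homogeneous_form r m F" unfolding F_def by (intro homogeneous_form_prod homogeneous_lin_form)
      then obtain x where x: "x \<in> cx_module r s m 0" "strand x {} = F" by (rule homogeneous_form_strand)
      have "cx_aug r s m f x = (\<Prod>k<m. y k)"
        unfolding cx_aug_strand[OF x(1)] x(2) F_def ring_hom_prod[OF poly_eval_hom[OF ring_hom_id]]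
          lin_form_eval[OF ring_hom_id]
        by (intro prod.cong) (simp_all add: b mult.commute)
      then show "(\<Prod>k<m. y k) \<in> cx_aug r s m f ` cx_module r s m 0" using x(1) by (metis imageI)
    qed
  qed
qed

lemma cx_diff_in_max_ideal:
  fixes \<phi> :: "nat \<Rightarrow> nat \<Rightarrow> ('v::finite, 'k::field) mpoly"
  assumes "\<And>l j. l < r \<Longrightarrow> j < s \<Longrightarrow> \<phi> l j \<in> max_ideal" and x: "x \<in> cx_module r s m i"
  shows "cx_diff r s m \<phi> i x b \<in> max_ideal"
proof -
  obtain K a where b: "b = (K, a)" by (cases b)
  show ?thesis
    unfolding b cx_diff_eq[OF x]
    by (rule ideal_sum[OF is_ideal_max_ideal], rule ideal_mult[OF is_ideal_max_ideal],
        rule ideal_sum[OF is_ideal_max_ideal], rule ideal_mult2[OF is_ideal_max_ideal])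
      (use assms(1) in auto)
qed

text \<open>Sym^m I is the cokernel of F (x) Sym^(m-1) G --> Sym^m G. The first equation therefore
  says that Sym^m I --> I^m is injective, and the second that it is onto.\<close>

theorem theorem2p5:
  fixes I :: "('v::finite, 'k::field_char_0) mpoly set"
    and f :: "nat \<Rightarrow> ('v, 'k) mpoly"
    and \<phi> :: "nat \<Rightarrow> nat \<Rightarrow> ('v, 'k) mpoly"
    and r s m :: nat and df du :: "nat \<Rightarrow> nat"
  assumes k_closed: "alg_closed_field TYPE('k)"
    and gens: "I = ideal_gen (f ` {..<r})"
    and f_hom: "\<forall>l<r. homogeneous (f l) (df l)"
    and phi_hom: "\<forall>l<r. \<forall>j<s. \<exists>e. homogeneous (\<phi> l j) e \<and> (\<phi> l j \<noteq> 0 \<longrightarrow> e + df l = du j)"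
    and phi_inj: "\<forall>y :: nat \<Rightarrow> ('v, 'k) mpoly.
                    (\<forall>l<r. (\<Sum>j<s. \<phi> l j * y j) = 0) \<longrightarrow> (\<forall>j<s. y j = 0)"
    and complex: "\<forall>j<s. (\<Sum>l<r. f l * \<phi> l j) = 0"
    and exact_G: "\<forall>z :: nat \<Rightarrow> ('v, 'k) mpoly. (\<Sum>l<r. z l * f l) = 0 \<longrightarrow>
                    (\<exists>y. \<forall>l<r. z l = (\<Sum>j<s. \<phi> l j * y j))"
    and minimal: "\<forall>l<r. \<forall>j<s. \<phi> l j \<in> max_ideal"
    and perfect: "perfect_ideal I"
    and codim2: "height I = 2"
    and lci: "local_complete_intersection I"
    and m_pos: "m > 0"
    and bound: "min (r - 1) m \<le> card (UNIV :: 'v set) - 1"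
  shows
    "{x \<in> cx_module r s m 0. cx_aug r s m f x = 0} = cx_diff r s m \<phi> 1 ` cx_module r s m 1
     \<and> cx_aug r s m f ` cx_module r s m 0 = ideal_pow I m
     \<and> (\<forall>i\<in>{1..m}. \<forall>x\<in>cx_module r s m i. cx_diff r s m \<phi> i x \<in> cx_module r s m (i - 1))
     \<and> (\<forall>i. 1 \<le> i \<and> i < m \<longrightarrow>
          {x \<in> cx_module r s m i. cx_diff r s m \<phi> i x = (\<lambda>_. 0)}
            = cx_diff r s m \<phi> (Suc i) ` cx_module r s m (Suc i))
     \<and> (\<forall>x\<in>cx_module r s m m. cx_diff r s m \<phi> m x = (\<lambda>_. 0) \<longrightarrow> x = (\<lambda>_. 0))
     \<and> (\<forall>i\<in>{1..m}. \<forall>x\<in>cx_module r s m i. \<forall>b. cx_diff r s m \<phi> i x b \<in> max_ideal)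
     \<and> (\<forall>x\<in>cx_module r s m 0. cx_aug r s m f x = 0 \<longrightarrow> (\<forall>b. x b \<in> max_ideal))"
proof -
  have I: "I = seq_ideal f r" unfolding gens by (rule ideal_gen_image)
  interpret locally_two_generated f \<phi> r s
  proof
    show "\<forall>j<s. y j = 0" if "\<And>l. l < r \<Longrightarrow> (\<Sum>j<s. \<phi> l j * y j) = 0" for y
      by (rule phi_inj[THEN spec, THEN mp]) (simp add: that)
    show "(\<Sum>l<r. f l * \<phi> l j) = 0" if "j < s" for j
      by (rule complex[rule_format, OF that])
    show "\<exists>y. \<forall>l<r. z l = (\<Sum>j<s. \<phi> l j * y j)" if "(\<Sum>l<r. z l * f l) = 0" for z
      by (rule exact_G[THEN spec, THEN mp, OF that])
    \<comment> \<open>If all f_l vanished, I would be the zero ideal, of height 0 and not 2.\<close>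
    show "\<exists>l<r. f l \<noteq> 0"
    proof (rule ccontr)
      assume "\<not> ?thesis"
      then have "I = {0}" unfolding I seq_ideal_def set_ideal_def by auto
      then show False using codim2 by (simp add: height_zero_ideal)
    qed
    fix P :: "('v, 'k) mpoly set" assume P: "is_prime_ideal P" "P \<noteq> max_ideal"
    show "\<exists>u a b \<alpha> \<beta>. u \<notin> P \<and>
      (\<forall>l<r. u * f l = \<alpha> l * (\<Sum>l<r. a l * f l) + \<beta> l * (\<Sum>l<r. b l * f l))"
    proof (cases "I \<subseteq> P")
      \<comment> \<open>Some f_l0 lies outside P; it serves both as u and as the first generator,
        with 0 as the second.\<close>
      case False
      then obtain l0 where l0: "l0 < r" "f l0 \<notin> P"
        using ideal_gen_least[OF prime_ideal_ideal[OF P(1)], of "f ` {..<r}"] unfolding gens by blast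
      have "(\<Sum>l<r. (if l = l0 then 1 else 0) * f l) = (\<Sum>l<r. if l = l0 then f l else 0)"
        by (intro sum.cong) auto
      then have "(\<Sum>l<r. (if l = l0 then 1 else 0) * f l) = f l0" using l0 by simp
      then have "f l0 \<notin> P \<and> (\<forall>l<r. f l0 * f l = f l * (\<Sum>l<r. (if l = l0 then 1 else 0) * f l)
          + 0 * (\<Sum>l<r. 0 * f l))"
        using l0 by (simp add: mult.commute)
      then show ?thesis by (intro exI)
    next
      case True
      then obtain g u where g: "enat (length g) = height I" "set g \<subseteq> I" and u: "u \<notin> P"
        and ug: "\<And>x. x \<in> I \<Longrightarrow> u * x \<in> ideal_gen (set g)"
        using lci[unfolded local_complete_intersection_def, rule_format, OF conjI[OF P(1) conjI[OF P(2) True]]]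
        by blast
      have len: "length g = 2" using g(1) codim2 by (simp add: numeral_eq_enat)
      have set_g: "set g = (\<lambda>i. g ! i) ` {..<2}" unfolding len[symmetric] by (auto simp: set_conv_nth)
      have g_mem: "\<exists>c. g ! i = (\<Sum>l<r. c l * f l)" if "i < 2" for i
      proof -
        have "g ! i \<in> set g" using that len by simp
        then have "g ! i \<in> seq_ideal f r" using g(2) unfolding I by blast
        then obtain c where "g ! i = (\<Sum>l<r. f l * c l)" by (auto simp: seq_ideal_def set_ideal_def)
        then have "g ! i = (\<Sum>l<r. c l * f l)" by (simp add: mult.commute)
        then show ?thesis by blast
      qed
      obtain a where a: "g ! 0 = (\<Sum>l<r. a l * f l)" using g_mem[of 0] by auto
      obtain b where b: "g ! 1 = (\<Sum>l<r. b l * f l)" using g_mem[of 1] by auto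
      have "\<exists>c. u * f l = c 0 * g ! 0 + c (1::nat) * g ! 1" if "l < r" for l
      proof -
        have "u * f l \<in> ideal_gen (set g)" using that unfolding I by (intro ug[unfolded I] seq_ideal_gen)
        then obtain c where "u * f l = (\<Sum>i<2. g ! i * c i)"
          unfolding set_g ideal_gen_image seq_ideal_def set_ideal_def by blast
        then have "u * f l = c 0 * g ! 0 + c 1 * g ! 1"
          by (simp add: numeral_2_eq_2 mult.commute)
        then show ?thesis by blast
      qed
      then obtain c where c: "\<And>l. l < r \<Longrightarrow> u * f l = c l 0 * g ! 0 + c l (1::nat) * g ! 1" by metis
      show ?thesis
        by (rule exI[of _ u], rule exI[of _ a], rule exI[of _ b], rule exI[of _ "\<lambda>l. c l 0"],
            rule exI[of _ "\<lambda>l. c l 1"]) (use u c a b in simp)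
    qed
  qed
  have "0 < card (UNIV :: 'v set)" by (simp add: finite_UNIV_card_ge_0)
  then have bound': "min s m < card (UNIV :: 'v set)" using bound rank by simp
  have mem: "cx_diff r s m \<phi> i x \<in> cx_module r s m (i - 1)" if "1 \<le> i" "x \<in> cx_module r s m i" for i x
    using that cx_diff_mem[of x r s m "i - 1" \<phi>] by simp
  have aug: "{x \<in> cx_module r s m 0. cx_aug r s m f x = 0} = cx_diff r s m \<phi> 1 ` cx_module r s m 1"
  proof (intro equalityI subsetI)
    fix x assume "x \<in> {x \<in> cx_module r s m 0. cx_aug r s m f x = 0}"
    then show "x \<in> cx_diff r s m \<phi> 1 ` cx_module r s m 1" using exact_strand[OF bound', of x 0] by auto
  next
    fix x assume "x \<in> cx_diff r s m \<phi> 1 ` cx_module r s m 1"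
    then obtain y where "y \<in> cx_module r s m (Suc 0)" "x = cx_diff r s m \<phi> (Suc 0) y" by auto
    then show "x \<in> {x \<in> cx_module r s m 0. cx_aug r s m f x = 0}"
      using cx_aug_cx_diff[of y r s m f \<phi>] cx_diff_mem complex by auto
  qed
  have exact: "{x \<in> cx_module r s m i. cx_diff r s m \<phi> i x = (\<lambda>_. 0)}
      = cx_diff r s m \<phi> (Suc i) ` cx_module r s m (Suc i)" if "1 \<le> i" for i
  proof (intro equalityI subsetI)
    fix x assume "x \<in> {x \<in> cx_module r s m i. cx_diff r s m \<phi> i x = (\<lambda>_. 0)}"
    then show "x \<in> cx_diff r s m \<phi> (Suc i) ` cx_module r s m (Suc i)"
      using exact_strand[OF bound', of x i] that by auto
  next
    fix x assume "x \<in> cx_diff r s m \<phi> (Suc i) ` cx_module r s m (Suc i)"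
    then obtain y where "y \<in> cx_module r s m (Suc i)" "x = cx_diff r s m \<phi> (Suc i) y" by auto
    then show "x \<in> {x \<in> cx_module r s m i. cx_diff r s m \<phi> i x = (\<lambda>_. 0)}"
      using cx_diff_cx_diff[of y r s m "i - 1" \<phi>] cx_diff_mem[of y r s m i \<phi>] that by simp
  qed
  have last: "x = (\<lambda>_. 0)" if x: "x \<in> cx_module r s m m" "cx_diff r s m \<phi> m x = (\<lambda>_. 0)" for x
  proof -
    have "1 \<le> m" using m_pos by simp
    from exact[OF this] x obtain y where y: "y \<in> cx_module r s m (Suc m)" "x = cx_diff r s m \<phi> (Suc m) y"
      by blast
    \<comment> \<open>There is no basis in degree m + 1, so exactness in degree m is
      injectivity.\<close>
    have "y = (\<lambda>_. 0)" using y(1) cx_basis_empty[of m "Suc m" s r] by (auto simp: cx_module_def)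
    then show ?thesis using y(2) cx_diff_zero by simp
  qed
  have min': "cx_diff r s m \<phi> i x b \<in> max_ideal" if "x \<in> cx_module r s m i" for i x b
    by (rule cx_diff_in_max_ideal[OF _ that]) (use minimal in blast)
  have min0: "x b \<in> max_ideal" if "x \<in> cx_module r s m 0" "cx_aug r s m f x = 0" for x b
  proof -
    have "x \<in> cx_diff r s m \<phi> 1 ` cx_module r s m 1" using that unfolding aug[symmetric] by simp
    then show ?thesis using min' by blast
  qed
  show ?thesis
    unfolding gens
  proof (intro conjI ballI allI impI)
    show "cx_diff r s m \<phi> i x \<in> cx_module r s m (i - 1)" if "i \<in> {1..m}" "x \<in> cx_module r s m i" for i x
      using mem that by simp
    show "{x \<in> cx_module r s m i. cx_diff r s m \<phi> i x = (\<lambda>_. 0)}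
        = cx_diff r s m \<phi> (Suc i) ` cx_module r s m (Suc i)" if "1 \<le> i \<and> i < m" for i
      using exact that by blast
    show "x = (\<lambda>_. 0)" if "x \<in> cx_module r s m m" "cx_diff r s m \<phi> m x = (\<lambda>_. 0)" for x
      using last that .
    show "cx_diff r s m \<phi> i x b \<in> max_ideal" if "i \<in> {1..m}" "x \<in> cx_module r s m i" for i x b
      using min'[OF that(2)] .
    show "x b \<in> max_ideal" if "x \<in> cx_module r s m 0" "cx_aug r s m f x = 0" for x b
      using min0[OF that] .
  qed (rule aug cx_aug_image)+
qed

end
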